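(* Let $p$ be a prime, $k\ge1$, and suppose the elementary abelian group $P\cong(\mathbb Z/p)^k$ acts freely on the set $\{1,\dots,n\}$. Write $n=mp^k$ (here $p$ may divide $m$). Then there are homotopy equivalences $$|\Pi_n|^P\simeq\left((\mathbb Z/p)^{km}\right)_+\wedge_{(\mathbb Z/p)^k}\Sigma\left(T_k*|\Pi_m|\right)\simeq\bigvee_{p^{k(m-1)+\binom k2}(m-1)!}S^{m+k-3}.$$
   Context: $\Pi_n$ is the poset of partitions of $\{1,\dots,n\}$ other than the one-block partition and the partition into singletons, ordered by refinement; $|\Pi_n|$ is the geometric realization of its order complex, on which $P$ acts via its action on $\{1,\dots,n\}$, and $|\Pi_n|^P$ is the fixed point space. $T_k$ is the geometric realization of the poset of proper non-trivial subgroups of $(\mathbb Z/p)^k$. $*$ denotes join and $\Sigma X=S^0*X$ unreduced suspension. $(\mathbb Z/p)^k$ acts trivially on $\Sigma(T_k*|\Pi_m|)$ and is embedded diagonally in $((\mathbb Z/p)^{k})^m=(\mathbb Z/p)^{km}$; for a pointed $H$-space $X$ and $H\subset K$, $K_+\wedge_HX$ is the induced pointed $K$-space (a wedge of $|K/H|$ copies of $X$). Conventions: the empty space is $S^{-1}$ and is the unit for join; $|\Pi_2|=\emptyset=S^{-1}$ and $T_1=\emptyset$; $|\Pi_1|$ is regarded as $S^{-2}$, so that $\Sigma(X*|\Pi_1|)=S^0*X*|\Pi_1|:=X$. *)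

theory Defs
  imports
    "HOL-Analysis.Analysis"
    "HOL-Algebra.Product_Groups"
    "HOL-Algebra.Group_Action"
    "HOL-Computational_Algebra.Primes"
begin

definition quotient_topology :: "'a topology \<Rightarrow> ('a \<Rightarrow> 'b) \<Rightarrow> 'b topology"
  where "quotient_topology X q =
    topology (\<lambda>U. U \<subseteq> q ` topspace X \<and> openin X {x \<in> topspace X. q x \<in> U})"

lemma openin_quotient_topology:
  "openin (quotient_topology X q) U \<longleftrightarrow>
     U \<subseteq> q ` topspace X \<and> openin X {x \<in> topspace X. q x \<in> U}"
proof -
  have int: "openin X {x \<in> topspace X. q x \<in> S \<inter> T}"
    if "openin X {x \<in> topspace X. q x \<in> S}" "openin X {x \<in> topspace X. q x \<in> T}" for S T
  proof -
    have "{x \<in> topspace X. q x \<in> S \<inter> T} =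
        {x \<in> topspace X. q x \<in> S} \<inter> {x \<in> topspace X. q x \<in> T}" by auto
    then show ?thesis using that by (simp add: openin_Int)
  qed
  have un: "openin X {x \<in> topspace X. q x \<in> \<Union>\<K>}"
    if "\<forall>K\<in>\<K>. openin X {x \<in> topspace X. q x \<in> K}" for \<K>
  proof -
    have "{x \<in> topspace X. q x \<in> \<Union>\<K>} = (\<Union>K\<in>\<K>. {x \<in> topspace X. q x \<in> K})" by auto
    then show ?thesis using that by auto
  qed
  have "istopology (\<lambda>U. U \<subseteq> q ` topspace X \<and> openin X {x \<in> topspace X. q x \<in> U})"
    unfolding istopology_def using int un by blast
  then show ?thesis by (simp add: quotient_topology_def)
qed

lemma topspace_quotient_topology [simp]: "topspace (quotient_topology X q) = q ` topspace X"
proof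
  show "topspace (quotient_topology X q) \<subseteq> q ` topspace X"
    using openin_quotient_topology openin_topspace by metis
  have "{x \<in> topspace X. q x \<in> q ` topspace X} = topspace X" by auto
  then have "openin (quotient_topology X q) (q ` topspace X)"
    by (simp add: openin_quotient_topology)
  then show "q ` topspace X \<subseteq> topspace (quotient_topology X q)"
    by (rule openin_subset)
qed

lemma quotient_map_quotient_topology: "quotient_map X (quotient_topology X q) q"
  by (simp add: quotient_map_def openin_quotient_topology)

text \<open>Points are given by barycentric coordinates: nonnegative functions of sum 1 whose support
  is a nonempty finite chain. The topology is that of pointwise convergence of the coordinates,
  which for finite posets (the only ones used here) is the usual one.\<close>

definition geometric_realization :: "'a set \<Rightarrow> ('a \<Rightarrow> 'a \<Rightarrow> bool) \<Rightarrow> ('a \<Rightarrow> real) topology"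
  where "geometric_realization A rel =
    subtopology (powertop_real UNIV)
      {t. (\<forall>a. 0 \<le> t a) \<and> {a. t a \<noteq> 0} \<subseteq> A \<and> finite {a. t a \<noteq> 0} \<and>
          (\<forall>a b. t a \<noteq> 0 \<longrightarrow> t b \<noteq> 0 \<longrightarrow> rel a b \<or> rel b a) \<and>
          (\<Sum>a | t a \<noteq> 0. t a) = 1}"

text \<open>The affine map on realizations induced by a map of vertices.\<close>

definition realization_map :: "('a \<Rightarrow> 'b) \<Rightarrow> ('a \<Rightarrow> real) \<Rightarrow> ('b \<Rightarrow> real)"
  where "realization_map f t = (\<lambda>b. \<Sum>a | t a \<noteq> 0 \<and> f a = b. t a)"

definition proper_partitions :: "nat \<Rightarrow> nat set set set"
  where "proper_partitions n =
    {Q. partition_on {1..n} Q \<and> Q \<noteq> {{1..n}} \<and> Q \<noteq> (\<lambda>i. {i}) ` {1..n}}"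

definition partition_complex :: "nat \<Rightarrow> (nat set set \<Rightarrow> real) topology"
  where "partition_complex n = geometric_realization (proper_partitions n) (refines {1..n})"

definition fixed_partition_complex ::
    "('g, 'm) monoid_scheme \<Rightarrow> ('g \<Rightarrow> nat \<Rightarrow> nat) \<Rightarrow> nat \<Rightarrow> (nat set set \<Rightarrow> real) topology"
  where "fixed_partition_complex P \<phi> n =
    subtopology (partition_complex n)
      {t. \<forall>g \<in> carrier P. realization_map ((`) ((`) (\<phi> g))) t = t}"

definition free_action :: "('g, 'm) monoid_scheme \<Rightarrow> 'e set \<Rightarrow> ('g \<Rightarrow> 'e \<Rightarrow> 'e) \<Rightarrow> bool"
  where "free_action G E \<phi> \<longleftrightarrow>
    group_action G E \<phi> \<and> (\<forall>g \<in> carrier G. \<forall>x \<in> E. \<phi> g x = x \<longrightarrow> g = \<one>\<^bsub>G\<^esub>)"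

definition elem_abelian :: "nat \<Rightarrow> nat \<Rightarrow> (nat \<Rightarrow> int) monoid"
  where "elem_abelian p k = product_group {..<k} (\<lambda>_. integer_mod_group p)"

definition subgroup_complex :: "nat \<Rightarrow> nat \<Rightarrow> ((nat \<Rightarrow> int) set \<Rightarrow> real) topology"
  where "subgroup_complex p k =
    geometric_realization
      {H. subgroup H (elem_abelian p k) \<and> H \<noteq> {\<one>\<^bsub>elem_abelian p k\<^esub>} \<and>
          H \<noteq> carrier (elem_abelian p k)} (\<subseteq>)"

definition elem_abelian_power :: "nat \<Rightarrow> nat \<Rightarrow> nat \<Rightarrow> (nat \<Rightarrow> nat \<Rightarrow> int) monoid"
  where "elem_abelian_power p k m = product_group {..<m} (\<lambda>_. elem_abelian p k)"

definition diagonal_subgroup :: "nat \<Rightarrow> nat \<Rightarrow> nat \<Rightarrow> (nat \<Rightarrow> nat \<Rightarrow> int) set"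
  where "diagonal_subgroup p k m = (\<lambda>v. \<lambda>i\<in>{..<m}. v) ` carrier (elem_abelian p k)"

text \<open>The join is the double mapping cylinder of \<open>X \<leftarrow> X \<times> Y \<rightarrow> Y\<close>, that is, the quotient of
  \<open>X \<squnion> (X \<times> Y \<times> [0,1]) \<squnion> Y\<close> gluing the ends of the cylinder to \<open>X\<close> and to \<open>Y\<close>.
  Keeping \<open>X\<close> and \<open>Y\<close> as summands makes the empty space a unit.\<close>

datatype ('a, 'b) join_point = JLeft 'a | JRight 'b | JMid 'a 'b real

fun join_map :: "'a \<times> 'b \<times> real \<Rightarrow> ('a, 'b) join_point"
  where "join_map (x, y, s) = (if s = 0 then JLeft x else if s = 1 then JRight y else JMid x y s)"

definition join_cylinder :: "'a topology \<Rightarrow> 'b topology \<Rightarrow> ('a \<times> 'b \<times> real) topology"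
  where "join_cylinder X Y = prod_topology X (prod_topology Y (top_of_set {0..1}))"

definition join_points :: "'a topology \<Rightarrow> 'b topology \<Rightarrow> ('a, 'b) join_point set"
  where "join_points X Y =
    JLeft ` topspace X \<union> JRight ` topspace Y \<union> join_map ` topspace (join_cylinder X Y)"

definition space_join :: "'a topology \<Rightarrow> 'b topology \<Rightarrow> ('a, 'b) join_point topology"
  where "space_join X Y =
    topology (\<lambda>U. U \<subseteq> join_points X Y \<and>
      openin X {x \<in> topspace X. JLeft x \<in> U} \<and>
      openin Y {y \<in> topspace Y. JRight y \<in> U} \<and>
      openin (join_cylinder X Y) {z \<in> topspace (join_cylinder X Y). join_map z \<in> U})"

lemma openin_space_join:
  "openin (space_join X Y) U \<longleftrightarrow> U \<subseteq> join_points X Y \<and>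
      openin X {x \<in> topspace X. JLeft x \<in> U} \<and>
      openin Y {y \<in> topspace Y. JRight y \<in> U} \<and>
      openin (join_cylinder X Y) {z \<in> topspace (join_cylinder X Y). join_map z \<in> U}"
proof -
  have int: "openin Z {x \<in> topspace Z. q x \<in> S \<inter> T}"
    if "openin Z {x \<in> topspace Z. q x \<in> S}" "openin Z {x \<in> topspace Z. q x \<in> T}"
    for S T and Z :: "'z topology" and q :: "'z \<Rightarrow> 'w"
  proof -
    have "{x \<in> topspace Z. q x \<in> S \<inter> T} =
        {x \<in> topspace Z. q x \<in> S} \<inter> {x \<in> topspace Z. q x \<in> T}" by auto
    then show ?thesis using that by (simp add: openin_Int)
  qed
  have un: "openin Z {x \<in> topspace Z. q x \<in> \<Union>\<K>}"
    if "\<forall>K\<in>\<K>. openin Z {x \<in> topspace Z. q x \<in> K}"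
    for \<K> and Z :: "'z topology" and q :: "'z \<Rightarrow> 'w"
  proof -
    have "{x \<in> topspace Z. q x \<in> \<Union>\<K>} = (\<Union>K\<in>\<K>. {x \<in> topspace Z. q x \<in> K})" by auto
    then show ?thesis using that by auto
  qed
  have "istopology (\<lambda>U. U \<subseteq> join_points X Y \<and>
      openin X {x \<in> topspace X. JLeft x \<in> U} \<and>
      openin Y {y \<in> topspace Y. JRight y \<in> U} \<and>
      openin (join_cylinder X Y) {z \<in> topspace (join_cylinder X Y). join_map z \<in> U})"
    unfolding istopology_def by (intro conjI allI impI int un) auto
  then show ?thesis by (simp add: space_join_def)
qed

lemma topspace_space_join [simp]: "topspace (space_join X Y) = join_points X Y"
proof
  show "topspace (space_join X Y) \<subseteq> join_points X Y"
    using openin_space_join openin_topspace by metis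
  have "{x \<in> topspace X. JLeft x \<in> join_points X Y} = topspace X"
    "{y \<in> topspace Y. JRight y \<in> join_points X Y} = topspace Y"
    "{z \<in> topspace (join_cylinder X Y). join_map z \<in> join_points X Y} =
       topspace (join_cylinder X Y)"
    by (auto simp: join_points_def)
  then have "openin (space_join X Y) (join_points X Y)"
    by (simp add: openin_space_join)
  then show "join_points X Y \<subseteq> topspace (space_join X Y)"
    by (rule openin_subset)
qed

text \<open>\<open>sphere_space d\<close> is the \<open>d\<close>-sphere for \<open>d \<ge> -1\<close>, with \<open>S\<^sup>-\<^sup>1\<close> empty; \<open>sphere_pole\<close> is a point
  of every nonempty sphere.\<close>

definition sphere_space :: "int \<Rightarrow> (nat \<Rightarrow> real) topology"
  where "sphere_space d = (if d < 0 then trivial_topology else nsphere (nat d))"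

definition sphere_pole :: "nat \<Rightarrow> real"
  where "sphere_pole = (\<lambda>i. if i = 0 then 1 else 0)"

definition suspension :: "'a topology \<Rightarrow> (nat \<Rightarrow> real, 'a) join_point topology"
  where "suspension X = space_join (sphere_space 0) X"

text \<open>\<open>\<Sigma>(X * |\<Pi>\<^sub>m|)\<close>, where for \<open>m = 1\<close> the complex is regarded as \<open>S\<^sup>-\<^sup>2\<close>, so that the result
  is \<open>X\<close>: there it is a copy of \<open>X\<close>, transported along an injection so that the type does not
  depend on \<open>m\<close>.\<close>

definition suspended_partition_join ::
    "'a topology \<Rightarrow> nat \<Rightarrow> (nat \<Rightarrow> real, ('a, nat set set \<Rightarrow> real) join_point) join_point topology"
  where "suspended_partition_join X m =
    (if m = 1 then quotient_topology X (\<lambda>x. JRight (JLeft x))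
     else suspension (space_join X (partition_complex m)))"

text \<open>The base point is a suspension point; for \<open>m = 1\<close> it is an arbitrary point of \<open>X\<close> (and
  irrelevant if \<open>X\<close> is empty).\<close>

definition suspended_partition_join_base ::
    "'a topology \<Rightarrow> nat \<Rightarrow> (nat \<Rightarrow> real, ('a, nat set set \<Rightarrow> real) join_point) join_point"
  where "suspended_partition_join_base X m =
    (if m = 1 then JRight (JLeft (SOME x. x \<in> topspace X)) else JLeft sphere_pole)"

text \<open>For a subgroup \<open>H\<close> of a discrete group \<open>K\<close> acting through \<open>\<rho>\<close> on \<open>X\<close> with fixed base point
  \<open>x\<^sub>0\<close>, the space \<open>K\<^sub>+ \<and>\<^sub>H X\<close> is the quotient of \<open>K \<times> X\<close> identifying \<open>(a h, y)\<close> with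
  \<open>(a, h y)\<close> and collapsing \<open>K \<times> {x\<^sub>0}\<close>. No base point is adjoined, so that the result is empty
  if \<open>X\<close> is.\<close>

definition induced_rel ::
    "('k, 'm) monoid_scheme \<Rightarrow> 'k set \<Rightarrow> ('k \<Rightarrow> 'x \<Rightarrow> 'x) \<Rightarrow> 'x topology \<Rightarrow> 'x \<Rightarrow>
     (('k \<times> 'x) \<times> ('k \<times> 'x)) set"
  where "induced_rel K H \<rho> X x\<^sub>0 =
    {((a, x), (b, y)). a \<in> carrier K \<and> b \<in> carrier K \<and> x \<in> topspace X \<and> y \<in> topspace X \<and>
       ((\<exists>h\<in>H. b = a \<otimes>\<^bsub>K\<^esub> h \<and> x = \<rho> h y) \<or> (x = x\<^sub>0 \<and> y = x\<^sub>0))}"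

definition induced_space ::
    "('k, 'm) monoid_scheme \<Rightarrow> 'k set \<Rightarrow> ('k \<Rightarrow> 'x \<Rightarrow> 'x) \<Rightarrow> 'x topology \<Rightarrow> 'x \<Rightarrow>
     ('k \<times> 'x) set topology"
  where "induced_space K H \<rho> X x\<^sub>0 =
    quotient_topology (prod_topology (discrete_topology (carrier K)) X)
      (\<lambda>z. induced_rel K H \<rho> X x\<^sub>0 `` {z})"

text \<open>The wedge of a nonempty family of pointed spaces; \<open>None\<close> is the common base point. A wedge
  of copies of the empty space is empty.\<close>

definition wedge :: "'i set \<Rightarrow> ('i \<Rightarrow> 'a topology) \<Rightarrow> ('i \<Rightarrow> 'a) \<Rightarrow> ('i \<times> 'a) option topology"
  where "wedge I X x\<^sub>0 =
    quotient_topology (sum_topology X I) (\<lambda>(i, x). if x = x\<^sub>0 i then None else Some (i, x))"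

end

theory Submission
  imports Defs
begin

text \<open>The fixed points of the realization are the realization of the poset of \<open>P\<close>-invariant partitions.
  Both this poset and the induced space are compared with a wedge of spheres, by counting the critical
  faces of acyclic matchings. If all faces of a complex but \<open>N\<close> maximal ones of dimension \<open>d\<close> can be
  removed by elementary collapses (the last one removing the empty face together with a vertex), then
  \<open>N\<close> and \<open>d\<close> determine the homotopy type: doubling the critical faces and coning off the rest connects
  the complex by collapses with a standard bouquet of spheres.

  In a finite lattice, the chains are matched relative to an element \<open>a\<close> as in the homotopy
  complementation formula, so that only the chains starting with a complement of \<open>a\<close> remain. For
  subgroups, \<open>a\<close> is a maximal subgroup. For invariant equivalence relations, \<open>a\<close> splits off one orbit
  \<open>b\<close>; its complements identify \<open>b\<close> with another orbit by an equivariant bijection, of which there are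
  \<open>(m - 1) p\<^sup>k\<close>, and one orbit fewer remains. When a single orbit is left, the invariant relations are
  the subgroups of \<open>P\<close>.\<close>

section \<open>Collapses and critical faces\<close>

text \<open>No map between the two sides is built; it suffices that their numbers agree. Counting is
  enough because critical faces are required to be maximal: then none of them is glued onto another.
  The empty face belongs to every complex, so that S^{-1} is a single critical face without vertices
  and joins multiply the numbers of critical faces without exceptions. The constants arise as
  follows. Removing orbits one at a time multiplies by i p^k for i = 1, ..., m-1, which gives (m-1)!
  p^(k(m-1)). The last orbit leaves the subgroup complex of (Z/p)^k; a maximal subgroup of (Z/p)^i
  has p^(i-1) complements, and the product over i = 2, ..., k is p^(k choose 2). On the other side
  the same factors reappear as the index of the diagonal, the subgroup complex, and the (m-1)!
  spheres of |Pi_m|, which is the case of the trivial group.\<close>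

text \<open>If \<open>L \<subseteq> K\<close> are complexes and \<open>D = K - L\<close>, then \<open>erasable D\<close> means that \<open>K\<close> collapses to \<open>L\<close>: as \<open>L\<close> is
  closed under subsets, \<open>\<sigma>\<close> is a free face of \<open>K\<close> as soon as it is one within \<open>D\<close>. The empty face counts.\<close>

inductive erasable :: "'a set set \<Rightarrow> bool" where
  erasable_empty: "erasable {}"
| erasable_step: "erasable D"
  if "\<sigma> \<in> D" "insert v \<sigma> \<in> D" "v \<notin> \<sigma>"
    and "\<And>\<rho>. \<rho> \<in> D \<Longrightarrow> \<sigma> \<subseteq> \<rho> \<Longrightarrow> \<rho> = \<sigma> \<or> \<rho> = insert v \<sigma>"
    and "erasable (D - {\<sigma>, insert v \<sigma>})"

text \<open>The removals of \<open>A\<close> come first: no face of \<open>A\<close> lies under a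
  face of \<open>B\<close>, so a pair that is free within \<open>A\<close> is free within the
  union.\<close>

lemma erasable_Un:
  assumes "erasable A" "erasable B" "\<And>\<sigma> \<rho>. \<sigma> \<in> A \<Longrightarrow> \<rho> \<in> B \<Longrightarrow> \<not> \<sigma> \<subseteq> \<rho>"
  shows "erasable (A \<union> B)"
  using assms
proof (induction A rule: erasable.induct)
  case (erasable_step \<sigma> A v)
  have "(A \<union> B) - {\<sigma>, insert v \<sigma>} = (A - {\<sigma>, insert v \<sigma>}) \<union> B"
    using erasable_step by blast
  then have "erasable ((A \<union> B) - {\<sigma>, insert v \<sigma>})"
    using erasable_step by auto
  then show ?case
    using erasable_step.hyps(1-4) erasable_step.prems(2)
    by (rule_tac erasable.erasable_step[of \<sigma> _ v]) blast+
qed simp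

text \<open>Toggling \<open>v\<close> pairs off all of \<open>D\<close>. A maximal face without
  \<open>v\<close> has only its partner as a proper coface, so this pair can go first, and what is
  left is still closed under toggling \<open>v\<close>.\<close>

lemma erasable_toggle:
  assumes "finite D" "\<And>\<sigma>. \<sigma> \<in> D \<Longrightarrow> insert v \<sigma> \<in> D \<and> \<sigma> - {v} \<in> D"
  shows "erasable D"
  using assms
proof (induction "card D" arbitrary: D rule: less_induct)
  case less
  show ?case
  proof (cases "D = {}")
    case False
    then have "{\<sigma> \<in> D. v \<notin> \<sigma>} \<noteq> {}" using less.prems by fastforce
    then obtain \<sigma> where s: "\<sigma> \<in> D" "v \<notin> \<sigma>"
      and max: "\<And>\<rho>. \<rho> \<in> D \<Longrightarrow> v \<notin> \<rho> \<Longrightarrow> \<sigma> \<subseteq> \<rho> \<Longrightarrow> \<rho> = \<sigma>"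
      using finite_has_maximal[of "{\<sigma> \<in> D. v \<notin> \<sigma>}"] less.prems(1) by auto
    have only: "\<rho> = \<sigma> \<or> \<rho> = insert v \<sigma>" if "\<rho> \<in> D" "\<sigma> \<subseteq> \<rho>" for \<rho>
      using max[of "\<rho> - {v}"] max[of \<rho>] that less.prems(2)[of \<rho>] s by blast
    have "erasable (D - {\<sigma>, insert v \<sigma>})"
    proof (rule less.hyps)
      show "card (D - {\<sigma>, insert v \<sigma>}) < card D"
        using s less.prems by (intro psubset_card_mono) auto
      show "insert v \<rho> \<in> D - {\<sigma>, insert v \<sigma>} \<and> \<rho> - {v} \<in> D - {\<sigma>, insert v \<sigma>}"
        if "\<rho> \<in> D - {\<sigma>, insert v \<sigma>}" for \<rho>
      proof -
        have \<rho>: "\<rho> \<in> D" "\<rho> \<noteq> \<sigma>" "\<rho> \<noteq> insert v \<sigma>" using that by auto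
        then have "\<rho> - {v} \<noteq> \<sigma>" "\<rho> - {v} \<noteq> insert v \<sigma>" "insert v \<rho> \<noteq> \<sigma>" using s(2) by blast+
        moreover from this have "insert v \<rho> \<noteq> insert v \<sigma>"
          using Diff_insert_absorb[OF s(2)] by (auto dest: arg_cong[of _ _ "\<lambda>A. A - {v}"])
        ultimately show ?thesis using less.prems(2)[OF \<rho>(1)] by blast
      qed
    qed (use less.prems in auto)
    moreover have "insert v \<sigma> \<in> D" using less.prems(2) s by blast
    ultimately show ?thesis
      by (rule_tac erasable.erasable_step[OF s(1) _ s(2) only])
  qed (simp add: erasable.erasable_empty)
qed

text \<open>The patchwork (cluster) lemma of discrete Morse theory. Passing to a larger face keeps
  \<open>f\<close> or raises its rank, so a fibre of highest rank is closed under cofaces in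
  \<open>D\<close> and can be removed first.\<close>

lemma erasable_patchwork:
  fixes rank :: "'i \<Rightarrow> nat"
  assumes "finite D"
    and "\<And>\<sigma> \<rho>. \<sigma> \<in> D \<Longrightarrow> \<rho> \<in> D \<Longrightarrow> \<sigma> \<subseteq> \<rho> \<Longrightarrow> f \<sigma> = f \<rho> \<or> rank (f \<sigma>) < rank (f \<rho>)"
    and "\<And>i. i \<in> f ` D \<Longrightarrow> erasable {\<sigma> \<in> D. f \<sigma> = i}"
  shows "erasable D"
  using assms
proof (induction "card (f ` D)" arbitrary: D rule: less_induct)
  case less
  show ?case
  proof (cases "D = {}")
    case False
    then obtain i where i: "i \<in> f ` D" and max: "\<And>j. j \<in> f ` D \<Longrightarrow> rank j \<le> rank i"
      using less.prems(1) Max_in[of "rank ` f ` D"] Max_ge[of "rank ` f ` D"]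
      by (metis (no_types, lifting) finite_imageI imageE imageI image_is_empty)
    let ?A = "{\<sigma> \<in> D. f \<sigma> = i}" and ?B = "{\<sigma> \<in> D. f \<sigma> \<noteq> i}"
    have fB: "f ` ?B = f ` D - {i}" by auto
    have "erasable ?B"
    proof (rule less.hyps)
      show "card (f ` ?B) < card (f ` D)"
        unfolding fB using i less.prems(1) by (intro psubset_card_mono) auto
      show "erasable {\<sigma> \<in> ?B. f \<sigma> = j}" if "j \<in> f ` ?B" for j
      proof -
        have "{\<sigma> \<in> ?B. f \<sigma> = j} = {\<sigma> \<in> D. f \<sigma> = j}" using that by auto
        then show ?thesis using less.prems(3)[of j] that by auto
      qed
    qed (use less.prems in auto)
    moreover have "\<not> \<sigma> \<subseteq> \<rho>" if "\<sigma> \<in> ?A" "\<rho> \<in> ?B" for \<sigma> \<rho>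
      using that less.prems(2)[of \<sigma> \<rho>] max[of "f \<rho>"] by auto
    ultimately have "erasable (?A \<union> ?B)"
      using less.prems(3)[OF i] by (intro erasable_Un) auto
    moreover have "?A \<union> ?B = D" by auto
    ultimately show ?thesis by simp
  qed (simp add: erasable.erasable_empty)
qed

text \<open>The form of the more delicate matchings below: the toggled vertex \<open>w\<close> is
  computed from the value of \<open>f\<close>, and toggling it must not change that value.\<close>

lemma erasable_patchwork_toggle:
  fixes rank :: "'i \<Rightarrow> nat"
  assumes "finite D"
    and "\<And>\<sigma> \<rho>. \<sigma> \<in> D \<Longrightarrow> \<rho> \<in> D \<Longrightarrow> \<sigma> \<subseteq> \<rho> \<Longrightarrow> f \<sigma> = f \<rho> \<or> rank (f \<sigma>) < rank (f \<rho>)"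
    and "\<And>\<sigma>. \<sigma> \<in> D \<Longrightarrow> insert (w (f \<sigma>)) \<sigma> \<in> D \<and> f (insert (w (f \<sigma>)) \<sigma>) = f \<sigma>"
    and "\<And>\<sigma>. \<sigma> \<in> D \<Longrightarrow> \<sigma> - {w (f \<sigma>)} \<in> D \<and> f (\<sigma> - {w (f \<sigma>)}) = f \<sigma>"
  shows "erasable D"
proof (rule erasable_patchwork[where f = f and rank = rank])
  show "erasable {\<sigma> \<in> D. f \<sigma> = i}" if "i \<in> f ` D" for i
    by (rule erasable_toggle[of _ "w i"]) (use assms in auto)
qed (use assms in auto)

text \<open>Adding a fixed disjoint set preserves and reflects inclusions, so a matching on a link
  becomes one on the faces containing \<open>X\<close>.\<close>

lemma erasable_shift:
  assumes "erasable D" "\<And>\<sigma>. \<sigma> \<in> D \<Longrightarrow> \<sigma> \<inter> X = {}"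
  shows "erasable ((\<union>) X ` D)"
  using assms
proof (induction D rule: erasable.induct)
  case erasable_empty
  then show ?case by (simp add: erasable.erasable_empty)
next
  case (erasable_step \<sigma> D v)
  have inj: "A = B" if "A \<in> D" "B \<in> D" "X \<union> A = X \<union> B" for A B
    using that erasable_step.prems by blast
  have "(\<union>) X ` D - {X \<union> \<sigma>, insert v (X \<union> \<sigma>)} = (\<union>) X ` (D - {\<sigma>, insert v \<sigma>})"
    using inj[OF _ erasable_step.hyps(1)] inj[OF _ erasable_step.hyps(2)] by auto
  then have e: "erasable ((\<union>) X ` D - {X \<union> \<sigma>, insert v (X \<union> \<sigma>)})"
    using erasable_step by simp
  have "X \<union> insert v \<sigma> = insert v (X \<union> \<sigma>)" by simp
  then have 2: "insert v (X \<union> \<sigma>) \<in> (\<union>) X ` D" using erasable_step.hyps(2) by (metis imageI)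
  have 3: "v \<notin> X \<union> \<sigma>" using erasable_step.prems[OF erasable_step.hyps(2)] erasable_step.hyps(3) by auto
  have 4: "\<rho> = X \<union> \<sigma> \<or> \<rho> = insert v (X \<union> \<sigma>)" if r: "\<rho> \<in> (\<union>) X ` D" "X \<union> \<sigma> \<subseteq> \<rho>" for \<rho>
  proof -
    obtain \<tau> where t: "\<tau> \<in> D" "\<rho> = X \<union> \<tau>" using r by auto
    then have "\<sigma> \<subseteq> \<tau>" using r erasable_step.prems[OF erasable_step.hyps(1)] by auto
    then show ?thesis using erasable_step.hyps(4)[OF t(1)] t by auto
  qed
  show ?case
    by (rule erasable.erasable_step[OF _ 2 3 4 e]) (use erasable_step.hyps in auto)
qed

lemma erasable_image:
  assumes "erasable D" "inj_on h (\<Union>D)"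
  shows "erasable ((`) h ` D)"
  using assms
proof (induction D rule: erasable.induct)
  case erasable_empty
  then show ?case by (simp add: erasable.erasable_empty)
next
  case (erasable_step \<sigma> D v)
  have inj: "inj_on ((`) h) D"
    by (rule inj_onI) (meson Sup_upper erasable_step.prems inj_on_image_eq_iff)
  have "(`) h ` D - {h ` \<sigma>, insert (h v) (h ` \<sigma>)} = (`) h ` (D - {\<sigma>, insert v \<sigma>})"
    using inj_on_image_set_diff[OF inj, of D "{\<sigma>, insert v \<sigma>}"] erasable_step.hyps by simp
  moreover have "inj_on h (\<Union>(D - {\<sigma>, insert v \<sigma>}))"
    using erasable_step.prems by (rule inj_on_subset) auto
  ultimately have e: "erasable ((`) h ` D - {h ` \<sigma>, insert (h v) (h ` \<sigma>)})"
    using erasable_step by simp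
  have 2: "insert (h v) (h ` \<sigma>) \<in> (`) h ` D" using erasable_step.hyps(2) by (metis image_insert imageI)
  have 3: "h v \<notin> h ` \<sigma>" using erasable_step.prems erasable_step.hyps(2,3)
    by (auto dest!: inj_onD)
  have 4: "\<rho> = h ` \<sigma> \<or> \<rho> = insert (h v) (h ` \<sigma>)" if r: "\<rho> \<in> (`) h ` D" "h ` \<sigma> \<subseteq> \<rho>" for \<rho>
  proof -
    obtain \<tau> where t: "\<tau> \<in> D" "\<rho> = h ` \<tau>" using r by auto
    have "\<sigma> \<subseteq> \<tau>" using r t erasable_step.prems erasable_step.hyps(1)
      by (metis Sup_upper inj_on_image_subset_iff)
    then show ?thesis using erasable_step.hyps(4)[OF t(1)] t by auto
  qed
  show ?case
    by (rule erasable.erasable_step[OF _ 2 3 4 e]) (use erasable_step.hyps in auto)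
qed

text \<open>Maximality in \<open>D\<close> means that no critical face is attached along another,
  and the common size \<open>d\<close> makes all of them cells of one dimension; together they let
  the number alone decide the homotopy type.\<close>

definition critical_faces :: "'a set set \<Rightarrow> nat \<Rightarrow> 'a set set \<Rightarrow> bool" where
  "critical_faces D d F \<longleftrightarrow> F \<subseteq> D \<and>
     (\<forall>\<sigma>\<in>F. finite \<sigma> \<and> card \<sigma> = d \<and> (\<forall>\<rho>\<in>D. \<sigma> \<subseteq> \<rho> \<longrightarrow> \<rho> = \<sigma>)) \<and> erasable (D - F)"

text \<open>Here \<open>d\<close> counts vertices, so that the critical faces have dimension \<open>d - 1\<close>.\<close>

definition spherical :: "'a set set \<Rightarrow> nat \<Rightarrow> nat \<Rightarrow> bool" where
  "spherical D N d \<longleftrightarrow> finite D \<and> (\<exists>F. critical_faces D d F \<and> card F = N)"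

lemma sphericalE:
  assumes "spherical D N d"
  obtains F where "F \<subseteq> D" "card F = N" "erasable (D - F)" "\<And>\<sigma>. \<sigma> \<in> F \<Longrightarrow> finite \<sigma> \<and> card \<sigma> = d"
    "\<And>\<sigma> \<rho>. \<sigma> \<in> F \<Longrightarrow> \<rho> \<in> D \<Longrightarrow> \<sigma> \<subseteq> \<rho> \<Longrightarrow> \<rho> = \<sigma>"
proof -
  obtain F where "critical_faces D d F" "card F = N" using assms unfolding spherical_def by blast
  then show ?thesis unfolding critical_faces_def by (intro that[of F]) simp_all
qed

lemma sphericalI:
  assumes "finite D" "F \<subseteq> D" "card F = N" "erasable (D - F)"
    "\<And>\<sigma>. \<sigma> \<in> F \<Longrightarrow> finite \<sigma> \<and> card \<sigma> = d"
    "\<And>\<sigma> \<rho>. \<sigma> \<in> F \<Longrightarrow> \<rho> \<in> D \<Longrightarrow> \<sigma> \<subseteq> \<rho> \<Longrightarrow> \<rho> = \<sigma>"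
  shows "spherical D N d"
  unfolding spherical_def critical_faces_def
  by (rule conjI[OF assms(1)], rule exI[of _ F]) (use assms(2-) in \<open>simp add: Ball_def\<close>)

lemma spherical_finite: "spherical D N d \<Longrightarrow> finite D"
  by (simp add: spherical_def)

lemma spherical_erasable: "finite D \<Longrightarrow> erasable D \<Longrightarrow> spherical D 0 d"
  by (rule sphericalI[of _ "{}"]) auto

lemma spherical_singleton: "finite \<sigma> \<Longrightarrow> spherical {\<sigma>} 1 (card \<sigma>)"
  by (rule sphericalI[of _ "{\<sigma>}"]) (auto simp: erasable_empty)

text \<open>A fibre with critical faces has to be closed under cofaces (\<open>up\<close>): only
  then is a face that is maximal in its fibre also maximal in \<open>D\<close>. The other fibres are
  erased completely, in the order of the ranks.\<close>

lemma spherical_patchwork: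
  fixes rank :: "'i \<Rightarrow> nat"
  assumes fin: "finite D"
    and mono: "\<And>\<sigma> \<rho>. \<sigma> \<in> D \<Longrightarrow> \<rho> \<in> D \<Longrightarrow> \<sigma> \<subseteq> \<rho> \<Longrightarrow> f \<sigma> = f \<rho> \<or> rank (f \<sigma>) < rank (f \<rho>)"
    and fib: "\<And>i. i \<in> f ` D \<Longrightarrow> spherical {\<sigma> \<in> D. f \<sigma> = i} (N i) d"
    and up: "\<And>\<sigma> \<rho>. \<sigma> \<in> D \<Longrightarrow> \<rho> \<in> D \<Longrightarrow> \<sigma> \<subseteq> \<rho> \<Longrightarrow> N (f \<sigma>) \<noteq> 0 \<Longrightarrow> f \<rho> = f \<sigma>"
  shows "spherical D (\<Sum>i\<in>f ` D. N i) d"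
proof -
  let ?I = "f ` D" and ?D = "\<lambda>i. {\<sigma> \<in> D. f \<sigma> = i}"
  have "\<forall>i\<in>?I. \<exists>F. critical_faces (?D i) d F \<and> card F = N i"
    using fib unfolding spherical_def by blast
  then obtain F where cF: "\<And>i. i \<in> ?I \<Longrightarrow> critical_faces (?D i) d (F i) \<and> card (F i) = N i"
    using bchoice[of ?I "\<lambda>i F. critical_faces (?D i) d F \<and> card F = N i"] by blast
  have F: "F i \<subseteq> ?D i" "card (F i) = N i" "erasable (?D i - F i)"
    "\<And>\<sigma>. \<sigma> \<in> F i \<Longrightarrow> finite \<sigma> \<and> card \<sigma> = d \<and> (\<forall>\<rho>\<in>?D i. \<sigma> \<subseteq> \<rho> \<longrightarrow> \<rho> = \<sigma>)" if "i \<in> ?I" for i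
    using cF[OF that] unfolding critical_faces_def by (blast, blast, blast, blast)
  have finF: "finite (F i)" if "i \<in> ?I" for i
    using F(1)[OF that] fin by (auto intro: finite_subset)
  let ?F = "\<Union>i\<in>?I. F i"
  have "card ?F = (\<Sum>i\<in>?I. card (F i))"
  proof (rule card_UN_disjoint)
    show "\<forall>i\<in>?I. \<forall>j\<in>?I. i \<noteq> j \<longrightarrow> F i \<inter> F j = {}"
    proof (intro ballI impI equals0I)
      fix i j x assume "i \<in> ?I" "j \<in> ?I" "i \<noteq> j" "x \<in> F i \<inter> F j"
      then show False using subsetD[OF F(1)[of i], of x] subsetD[OF F(1)[of j], of x] by simp
    qed
  qed (use fin finF in auto)
  then have card: "card ?F = (\<Sum>i\<in>?I. N i)" using F(2) by simp
  have sub: "?F \<subseteq> D" using F(1) by blast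
  have max: "\<rho> = \<sigma>" if "\<sigma> \<in> ?F" "\<rho> \<in> D" "\<sigma> \<subseteq> \<rho>" for \<sigma> \<rho>
  proof -
    obtain i where i: "i \<in> ?I" "\<sigma> \<in> F i" using \<open>\<sigma> \<in> ?F\<close> by (rule UN_E)
    then have s: "\<sigma> \<in> D" "f \<sigma> = i" using F(1) by auto
    have "N i \<noteq> 0" using F(2)[OF i(1)] finF[OF i(1)] i(2) by (metis card_eq_0_iff empty_iff)
    then have "f \<rho> = i" using up[OF s(1) that(2,3)] s by simp
    then show ?thesis using F(4)[OF i] that by auto
  qed
  have "erasable (D - ?F)"
  proof (rule erasable_patchwork[where f = f and rank = rank])
    show "erasable {\<sigma> \<in> D - ?F. f \<sigma> = i}" if "i \<in> f ` (D - ?F)" for i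
    proof -
      have "i \<in> ?I" using that by auto
      then have "{\<sigma> \<in> D - ?F. f \<sigma> = i} = ?D i - F i" using F(1) by fastforce
      then show ?thesis using F(3) \<open>i \<in> ?I\<close> by simp
    qed
  qed (use fin mono in auto)
  moreover have "finite \<sigma> \<and> card \<sigma> = d" if "\<sigma> \<in> ?F" for \<sigma>
    using that F(4) by blast
  ultimately show ?thesis
    by (intro sphericalI[OF fin sub card _ _ max])
qed

lemma spherical_shift:
  assumes "spherical D N d" "finite X" "\<And>\<sigma>. \<sigma> \<in> D \<Longrightarrow> \<sigma> \<inter> X = {}"
  shows "spherical ((\<union>) X ` D) N (card X + d)"
proof -
  obtain F where F: "F \<subseteq> D" "card F = N" "erasable (D - F)"
    "\<And>\<sigma>. \<sigma> \<in> F \<Longrightarrow> finite \<sigma> \<and> card \<sigma> = d"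
    "\<And>\<sigma> \<rho>. \<sigma> \<in> F \<Longrightarrow> \<rho> \<in> D \<Longrightarrow> \<sigma> \<subseteq> \<rho> \<Longrightarrow> \<rho> = \<sigma>"
    using assms(1) by (rule sphericalE) auto
  have inj: "inj_on ((\<union>) X) D" using assms(3) by (intro inj_onI) blast
  have "card ((\<union>) X ` F) = N" using F inj by (metis card_image inj_on_subset)
  moreover have "erasable ((\<union>) X ` D - (\<union>) X ` F)"
    using erasable_shift[OF F(3), of X] assms(3) inj_on_image_set_diff[OF inj, of D F] F(1) by auto
  moreover have "finite (X \<union> \<sigma>) \<and> card (X \<union> \<sigma>) = card X + d" if "\<sigma> \<in> F" for \<sigma>
    using F(4)[OF that] assms(2) assms(3)[of \<sigma>] F(1) that by (auto intro!: card_Un_disjoint)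
  moreover have "X \<union> \<rho> = X \<union> \<sigma>" if "\<sigma> \<in> F" "\<rho> \<in> D" "X \<union> \<sigma> \<subseteq> X \<union> \<rho>" for \<sigma> \<rho>
  proof -
    have "\<sigma> \<subseteq> \<rho>" using that assms(3)[of \<sigma>] F(1) by blast
    then show ?thesis using F(5)[OF that(1,2)] by simp
  qed
  ultimately show ?thesis
  proof (rule_tac sphericalI[of _ "(\<union>) X ` F"])
    show "finite ((\<union>) X ` D)" using spherical_finite[OF assms(1)] by simp
    show "(\<union>) X ` F \<subseteq> (\<union>) X ` D" using F(1) by blast
  qed fast+
qed

lemma spherical_image:
  assumes "spherical D N d" "inj_on h (\<Union>D)"
  shows "spherical ((`) h ` D) N d"
proof -
  obtain F where F: "F \<subseteq> D" "card F = N" "erasable (D - F)"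
    "\<And>\<sigma>. \<sigma> \<in> F \<Longrightarrow> finite \<sigma> \<and> card \<sigma> = d"
    "\<And>\<sigma> \<rho>. \<sigma> \<in> F \<Longrightarrow> \<rho> \<in> D \<Longrightarrow> \<sigma> \<subseteq> \<rho> \<Longrightarrow> \<rho> = \<sigma>"
    using assms(1) by (rule sphericalE) auto
  have inj: "inj_on ((`) h) D"
    by (rule inj_onI) (meson Sup_upper assms(2) inj_on_image_eq_iff)
  have h: "inj_on h \<sigma>" if "\<sigma> \<in> D" for \<sigma>
    using assms(2) by (rule inj_on_subset) (use that in auto)
  have "card ((`) h ` F) = N" using F inj by (metis card_image inj_on_subset)
  moreover have "erasable ((`) h ` D - (`) h ` F)"
    using erasable_image[OF F(3), of h] assms(2) inj_on_image_set_diff[OF inj, of D F] F(1)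
      inj_on_subset[OF assms(2), of "\<Union>(D - F)"] by auto
  moreover have "finite (h ` \<sigma>) \<and> card (h ` \<sigma>) = d" if "\<sigma> \<in> F" for \<sigma>
    using F(4)[OF that] h that F(1) by (auto simp: card_image)
  moreover have "h ` \<rho> = h ` \<sigma>" if "\<sigma> \<in> F" "\<rho> \<in> D" "h ` \<sigma> \<subseteq> h ` \<rho>" for \<sigma> \<rho>
  proof -
    have "\<sigma> \<subseteq> \<rho>" using that F(1) inj_on_image_subset_iff[OF assms(2), of \<sigma> \<rho>] by blast
    then show ?thesis using F(5)[OF that(1,2)] by simp
  qed
  ultimately show ?thesis
  proof (rule_tac sphericalI[of _ "(`) h ` F"])
    show "finite ((`) h ` D)" using spherical_finite[OF assms(1)] by simp
    show "(`) h ` F \<subseteq> (`) h ` D" using F(1) by blast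
  qed fast+
qed

definition join_complex :: "'a set set \<Rightarrow> 'b set set \<Rightarrow> ('a + 'b) set set" where
  "join_complex K L = {Inl ` \<sigma> \<union> Inr ` \<rho> | \<sigma> \<rho>. \<sigma> \<in> K \<and> \<rho> \<in> L}"

lemma join_complex_iff: "\<tau> \<in> join_complex K L \<longleftrightarrow> Inl -` \<tau> \<in> K \<and> Inr -` \<tau> \<in> L"
proof -
  have "\<tau> = Inl ` (Inl -` \<tau>) \<union> Inr ` (Inr -` \<tau>)"
  proof (rule Set.set_eqI)
    fix x show "x \<in> \<tau> \<longleftrightarrow> x \<in> Inl ` (Inl -` \<tau>) \<union> Inr ` (Inr -` \<tau>)" by (cases x) auto
  qed
  moreover have "Inl -` (Inl ` \<sigma> \<union> Inr ` \<rho>) = \<sigma>" "Inr -` (Inl ` \<sigma> \<union> Inr ` \<rho>) = \<rho>"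
    for \<sigma> :: "'a set" and \<rho> :: "'b set" by auto
  ultimately show ?thesis unfolding join_complex_def by (smt (verit) mem_Collect_eq)
qed

text \<open>The critical faces are the joins of critical faces. Faces over \<open>F\<close> with
  noncritical second part are removed first, by the matching of \<open>E\<close>; they lie under no
  face of the remaining kind because the members of \<open>F\<close> are maximal. The rest is
  removed by the matching of \<open>D\<close>, separately for each second part.\<close>

lemma spherical_join:
  fixes D :: "'a set set" and E :: "'b set set"
  assumes "spherical D N d" "spherical E M e" "\<And>\<rho>. \<rho> \<in> E \<Longrightarrow> finite \<rho>"
  shows "spherical (join_complex D E) (N * M) (d + e)"
proof -
  obtain F where F: "F \<subseteq> D" "card F = N" "erasable (D - F)"
    "\<And>\<sigma>. \<sigma> \<in> F \<Longrightarrow> finite \<sigma> \<and> card \<sigma> = d"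
    "\<And>\<sigma> \<rho>. \<sigma> \<in> F \<Longrightarrow> \<rho> \<in> D \<Longrightarrow> \<sigma> \<subseteq> \<rho> \<Longrightarrow> \<rho> = \<sigma>"
    using assms(1) by (rule sphericalE) auto
  obtain G where G: "G \<subseteq> E" "card G = M" "erasable (E - G)"
    "\<And>\<sigma>. \<sigma> \<in> G \<Longrightarrow> finite \<sigma> \<and> card \<sigma> = e"
    "\<And>\<sigma> \<rho>. \<sigma> \<in> G \<Longrightarrow> \<rho> \<in> E \<Longrightarrow> \<sigma> \<subseteq> \<rho> \<Longrightarrow> \<rho> = \<sigma>"
    using assms(2) by (rule sphericalE) auto
  have finD: "finite D" and finE: "finite E" using assms unfolding spherical_def by auto
  have join_image: "join_complex A B = (\<lambda>(\<sigma>, \<rho>). Inl ` \<sigma> \<union> Inr ` \<rho>) ` (A \<times> B)"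
    for A :: "'a set set" and B :: "'b set set"
    unfolding join_complex_def by auto
  have inj: "inj_on (\<lambda>(\<sigma>, \<rho>). Inl ` \<sigma> \<union> Inr ` \<rho>) (A \<times> B)"
    for A :: "'a set set" and B :: "'b set set"
    by (rule inj_onI) (auto simp: set_eq_iff Un_iff image_iff split: sum.splits)
  have fin: "finite (join_complex A B)" if "A \<subseteq> D" "B \<subseteq> E" for A B
    unfolding join_image using that finD finE by (meson finite_SigmaI finite_imageI finite_subset)
  have 1: "erasable (join_complex (D - F) E)"
  proof (rule erasable_patchwork[where f = "(-`) Inr" and rank = card])
    show "finite (join_complex (D - F) E)" by (rule fin) auto
    show "Inr -` \<sigma> = Inr -` \<rho> \<or> card (Inr -` \<sigma>) < card (Inr -` \<rho>)"
      if "\<sigma> \<in> join_complex (D - F) E" "\<rho> \<in> join_complex (D - F) E" "\<sigma> \<subseteq> \<rho>" for \<sigma> \<rho>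
    proof -
      have "finite (Inr -` \<rho>)" using that(2) assms(3) by (auto simp: join_complex_iff)
      moreover have "Inr -` \<sigma> \<subseteq> Inr -` \<rho>" using that by auto
      ultimately show ?thesis by (metis psubsetI psubset_card_mono)
    qed
    show "erasable {\<tau> \<in> join_complex (D - F) E. Inr -` \<tau> = \<rho>}"
      if "\<rho> \<in> (-`) Inr ` join_complex (D - F) E" for \<rho>
    proof -
      have "\<rho> \<in> E" using that by (auto simp: join_complex_iff)
      have "{\<tau> \<in> join_complex (D - F) E. Inr -` \<tau> = \<rho>} = (\<union>) (Inr ` \<rho>) ` ((`) Inl ` (D - F))"
        using \<open>\<rho> \<in> E\<close> unfolding join_complex_def image_image
        by (auto simp: image_iff vimage_Un)
      moreover have "erasable ((\<union>) (Inr ` \<rho>) ` ((`) Inl ` (D - F)))"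
        by (rule erasable_shift, rule erasable_image) (use F in auto)
      ultimately show ?thesis by simp
    qed
  qed
  have 2: "erasable (join_complex F (E - G))"
  proof (rule erasable_patchwork[where f = "(-`) Inl" and rank = card])
    show "finite (join_complex F (E - G))" by (rule fin) (use F in auto)
    show "Inl -` \<sigma> = Inl -` \<rho> \<or> card (Inl -` \<sigma>) < card (Inl -` \<rho>)"
      if "\<sigma> \<in> join_complex F (E - G)" "\<rho> \<in> join_complex F (E - G)" "\<sigma> \<subseteq> \<rho>" for \<sigma> \<rho>
      using that F(5)[of "Inl -` \<sigma>" "Inl -` \<rho>"] F(1) vimage_mono[of \<sigma> \<rho> Inl]
      by (auto simp: join_complex_iff)
    show "erasable {\<tau> \<in> join_complex F (E - G). Inl -` \<tau> = \<rho>}"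
      if "\<rho> \<in> (-`) Inl ` join_complex F (E - G)" for \<rho>
    proof -
      have "\<rho> \<in> F" using that by (auto simp: join_complex_iff)
      have "{\<tau> \<in> join_complex F (E - G). Inl -` \<tau> = \<rho>} = (\<union>) (Inl ` \<rho>) ` ((`) Inr ` (E - G))"
        using \<open>\<rho> \<in> F\<close> unfolding join_complex_def image_image
        by (auto simp: image_iff vimage_Un)
      moreover have "erasable ((\<union>) (Inl ` \<rho>) ` ((`) Inr ` (E - G)))"
        by (rule erasable_shift, rule erasable_image) (use G in auto)
      ultimately show ?thesis by simp
    qed
  qed
  have "erasable (join_complex F (E - G) \<union> join_complex (D - F) E)"
  proof (rule erasable_Un[OF 2 1])
    fix \<sigma> \<rho> assume a: "\<sigma> \<in> join_complex F (E - G)" "\<rho> \<in> join_complex (D - F) E"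
    then have "Inl -` \<sigma> \<in> F" "Inl -` \<rho> \<in> D - F" by (auto simp: join_complex_iff)
    then show "\<not> \<sigma> \<subseteq> \<rho>" using F(5) by (metis Diff_iff vimage_mono)
  qed
  moreover have "join_complex F (E - G) \<union> join_complex (D - F) E = join_complex D E - join_complex F G"
    using F(1) G(1) by (auto simp: join_complex_iff)
  ultimately have e: "erasable (join_complex D E - join_complex F G)" by simp
  have "card (join_complex F G) = N * M"
    unfolding join_image card_image[OF inj] using F G by (simp add: card_cartesian_product)
  moreover have "join_complex F G \<subseteq> join_complex D E" using F(1) G(1) by (auto simp: join_complex_iff)
  moreover have "finite \<tau> \<and> card \<tau> = d + e" if "\<tau> \<in> join_complex F G" for \<tau>
  proof -
    obtain \<sigma> \<rho> where \<tau>: "\<tau> = Inl ` \<sigma> \<union> Inr ` \<rho>" "\<sigma> \<in> F" "\<rho> \<in> G"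
      using \<open>\<tau> \<in> join_complex F G\<close> unfolding join_complex_def by blast
    then have "card \<tau> = card (Inl ` \<sigma> :: ('a + 'b) set) + card (Inr ` \<rho> :: ('a + 'b) set)"
      using F(4)[OF \<tau>(2)] G(4)[OF \<tau>(3)] by (simp only: \<tau>(1)) (rule card_Un_disjoint, auto)
    then show ?thesis using F(4)[OF \<tau>(2)] G(4)[OF \<tau>(3)] \<tau>(1) by (simp add: card_image)
  qed
  moreover have "\<rho> = \<tau>" if "\<tau> \<in> join_complex F G" "\<rho> \<in> join_complex D E" "\<tau> \<subseteq> \<rho>" for \<tau> \<rho>
  proof -
    have "Inl -` \<rho> = Inl -` \<tau>" "Inr -` \<rho> = Inr -` \<tau>"
      using that F(5)[of "Inl -` \<tau>" "Inl -` \<rho>"] G(5)[of "Inr -` \<tau>" "Inr -` \<rho>"]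
        vimage_mono[of \<tau> \<rho> Inl] vimage_mono[of \<tau> \<rho> Inr] by (auto simp: join_complex_iff)
    then have "x \<in> \<rho> \<longleftrightarrow> x \<in> \<tau>" for x by (cases x) auto
    then show ?thesis by auto
  qed
  ultimately show ?thesis
    using e fin by (intro sphericalI[of _ "join_complex F G"]) blast+
qed

section \<open>Realizations of finite simplicial complexes\<close>

definition simplicial_complex :: "'a set set \<Rightarrow> bool" where
  "simplicial_complex K \<longleftrightarrow> finite K \<and> (\<forall>\<sigma>\<in>K. finite \<sigma>) \<and> (\<forall>\<sigma>\<in>K. \<forall>\<rho>. \<rho> \<subseteq> \<sigma> \<longrightarrow> \<rho> \<in> K)"

lemma simplicial_complexD:
  assumes "simplicial_complex K"
  shows "finite K" "\<sigma> \<in> K \<Longrightarrow> finite \<sigma>" "\<sigma> \<in> K \<Longrightarrow> \<rho> \<subseteq> \<sigma> \<Longrightarrow> \<rho> \<in> K" "finite (\<Union>K)"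
  using assms by (auto simp: simplicial_complex_def)

lemma simplicial_complexI:
  assumes "finite K" "\<And>\<sigma>. \<sigma> \<in> K \<Longrightarrow> finite \<sigma>" "\<And>\<sigma> \<rho>. \<sigma> \<in> K \<Longrightarrow> \<rho> \<subseteq> \<sigma> \<Longrightarrow> \<rho> \<in> K"
  shows "simplicial_complex K"
  using assms by (simp add: simplicial_complex_def)

text \<open>The coordinate sum 1 excludes the empty support, so the empty face carries no point and
  \<open>{{}}\<close> realizes the empty space, that is S^{-1}.\<close>

definition realization_points :: "'a set set \<Rightarrow> ('a \<Rightarrow> real) set" where
  "realization_points K =
    {t. (\<forall>a. 0 \<le> t a) \<and> {a. t a \<noteq> 0} \<in> K \<and> sum t {a. t a \<noteq> 0} = 1}"

definition realization :: "'a set set \<Rightarrow> ('a \<Rightarrow> real) topology" where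
  "realization K = subtopology (powertop_real UNIV) (realization_points K)"

lemma topspace_realization [simp]: "topspace (realization K) = realization_points K"
  by (simp add: realization_def)

lemma Hausdorff_realization: "Hausdorff_space (realization K)"
  unfolding realization_def
  by (intro Hausdorff_space_subtopology) (simp add: Hausdorff_space_product_topology)

lemma continuous_map_realization_component [continuous_intros]:
  "continuous_map (realization K) euclideanreal (\<lambda>t. t a)"
  unfolding realization_def
  by (intro continuous_map_from_subtopology continuous_map_product_projection) simp

lemma continuous_map_into_realization:
  "continuous_map X (realization K) f \<longleftrightarrow>
    (\<forall>a. continuous_map X euclideanreal (\<lambda>x. f x a)) \<and> f ` topspace X \<subseteq> realization_points K"
  unfolding realization_def continuous_map_in_subtopology continuous_map_componentwise_UNIV
  by auto

lemma realization_pointsI: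
  assumes "\<And>a. 0 \<le> t a" "{a. t a \<noteq> 0} \<in> K" "finite V" "{a. t a \<noteq> 0} \<subseteq> V" "sum t V = 1"
  shows "t \<in> realization_points K"
proof -
  have "sum t {a. t a \<noteq> 0} = sum t V"
    by (rule sum.mono_neutral_left) (use assms in auto)
  then show ?thesis using assms by (simp add: realization_points_def)
qed

lemma realization_pointsD:
  assumes "t \<in> realization_points K"
  shows "0 \<le> t a" "{a. t a \<noteq> 0} \<in> K" "{a. t a \<noteq> 0} \<noteq> {}"
proof -
  show "{a. t a \<noteq> 0} \<noteq> {}"
  proof
    assume "{a. t a \<noteq> 0} = {}"
    then show False using assms by (simp add: realization_points_def)
  qed
qed (use assms in \<open>auto simp: realization_points_def\<close>)

lemma realization_points_sum:
  assumes "t \<in> realization_points K" "finite V" "{a. t a \<noteq> 0} \<subseteq> V"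
  shows "sum t V = 1"
proof -
  have "sum t {a. t a \<noteq> 0} = sum t V"
    by (rule sum.mono_neutral_left) (use assms in auto)
  then show ?thesis using assms by (simp add: realization_points_def)
qed

lemma continuous_map_Min:
  assumes "finite I" "I \<noteq> {}" "\<And>i. i \<in> I \<Longrightarrow> continuous_map X euclideanreal (f i)"
  shows "continuous_map X euclideanreal (\<lambda>x. Min ((\<lambda>i. f i x) ` I))"
  using assms
proof (induction rule: finite_ne_induct)
  case (insert i I)
  have "(\<lambda>x. Min ((\<lambda>i. f i x) ` insert i I)) = (\<lambda>x. min (f i x) (Min ((\<lambda>i. f i x) ` I)))"
    using insert by (auto simp: Min_insert)
  then show ?case using insert by (simp add: continuous_map_real_min)
qed simp

text \<open>A point of the open faces \<open>\<sigma>\<close> or \<open>\<sigma> \<union> {v}\<close> is pushed away from the barycentre of \<open>\<sigma>\<close>, towards \<open>v\<close>,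
  until a coordinate in \<open>\<sigma>\<close> vanishes; all other points have minimum \<open>0\<close> on \<open>\<sigma>\<close> and stay fixed.\<close>

definition push :: "'a set \<Rightarrow> 'a \<Rightarrow> real \<Rightarrow> ('a \<Rightarrow> real) \<Rightarrow> 'a \<Rightarrow> real" where
  "push \<sigma> v u t a = t a + u * Min (t ` \<sigma>) * (if a = v then real (card \<sigma>) else if a \<in> \<sigma> then -1 else 0)"

text \<open>A point whose support contains \<sigma> lies in the closed simplex on
  \<open>insert v \<sigma>\<close>, as \<sigma> is free. The displacement has coordinate sum 0 and
  for u \<le> 1 makes no coordinate negative; at u = 1 the smallest coordinate in \<sigma> vanishes.
  If the support misses a vertex of \<sigma>, the minimum is 0 and nothing moves.\<close>

lemma
  assumes K: "simplicial_complex K" and \<sigma>: "\<sigma> \<in> K" "insert v \<sigma> \<in> K" "v \<notin> \<sigma>" "\<sigma> \<noteq> {}"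
    and only: "\<And>\<rho>. \<rho> \<in> K \<Longrightarrow> \<sigma> \<subseteq> \<rho> \<Longrightarrow> \<rho> = \<sigma> \<or> \<rho> = insert v \<sigma>"
    and t: "t \<in> realization_points K"
  shows push_fixes: "t \<in> realization_points (K - {\<sigma>, insert v \<sigma>}) \<Longrightarrow> push \<sigma> v u t = t"
    and push_in: "0 \<le> u \<Longrightarrow> u \<le> 1 \<Longrightarrow> push \<sigma> v u t \<in> realization_points K"
    and push_retracts: "push \<sigma> v 1 t \<in> realization_points (K - {\<sigma>, insert v \<sigma>})"
proof -
  let ?S = "{a. t a \<noteq> 0}" and ?m = "Min (t ` \<sigma>)" and ?L = "K - {\<sigma>, insert v \<sigma>}"
  have fin: "finite \<sigma>" using simplicial_complexD[OF K] \<sigma> by auto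
  note tD = realization_pointsD[OF t]
  have m_le: "?m \<le> t a" if "a \<in> \<sigma>" for a using that fin by simp
  have "?m \<in> t ` \<sigma>" using fin \<sigma> by (intro Min_in) auto
  then obtain b where b: "b \<in> \<sigma>" "?m = t b" by auto
  have m0: "0 \<le> ?m" using b tD by simp
  have notsub: "?m = 0" if "\<not> \<sigma> \<subseteq> ?S"
  proof -
    obtain a where "a \<in> \<sigma>" "t a = 0" using \<open>\<not> \<sigma> \<subseteq> ?S\<close> by auto
    then show ?thesis using m_le[of a] m0 by simp
  qed
  have id: "push \<sigma> v u t = t" if "\<not> \<sigma> \<subseteq> ?S" for u
    using notsub[OF that] by (simp add: push_def fun_eq_iff)
  have sub: "push \<sigma> v u t \<in> realization_points K \<and>
      (u = 1 \<longrightarrow> push \<sigma> v u t \<in> realization_points ?L)"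
    if S: "\<sigma> \<subseteq> ?S" and u: "0 \<le> u" "u \<le> 1" for u
  proof -
    let ?p = "push \<sigma> v u t" and ?V = "insert v \<sigma>"
    have SV: "?S \<subseteq> ?V" using only[OF tD(2) S] by auto
    have nn: "0 \<le> ?p a" for a
    proof -
      have "u * ?m \<le> t a" if "a \<in> \<sigma>"
        using mult_mono[OF u(2) m_le[OF that]] tD m0 by simp
      then show ?thesis using tD(1)[of a] m0 u \<sigma>(3) by (auto simp: push_def)
    qed
    have supp: "{a. ?p a \<noteq> 0} \<subseteq> ?V" using SV by (auto simp: push_def)
    have "sum ?p ?V = sum t ?V + u * ?m * (\<Sum>a\<in>?V. if a = v then real (card \<sigma>) else if a \<in> \<sigma> then -1 else 0)"
      by (simp add: push_def sum.distrib sum_distrib_left)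
    also have "(\<Sum>a\<in>?V. if a = v then real (card \<sigma>) else if a \<in> \<sigma> then -1 else 0) =
        real (card \<sigma>) + (\<Sum>a\<in>\<sigma>. -1)"
    proof -
      have "(\<Sum>a\<in>\<sigma>. if a = v then real (card \<sigma>) else if a \<in> \<sigma> then -1 else 0) = (\<Sum>a\<in>\<sigma>. -1)"
        by (rule sum.cong) (use \<sigma>(3) in auto)
      then show ?thesis using fin \<sigma>(3) by simp
    qed
    also have "\<dots> = 0" by simp
    finally have one: "sum ?p ?V = 1" using realization_points_sum[OF t _ SV] fin by simp
    have inK: "{a. ?p a \<noteq> 0} \<in> K" using simplicial_complexD(3)[OF K \<sigma>(2) supp] .
    have "{a. ?p a \<noteq> 0} \<in> ?L" if "u = 1"
    proof -
      have "?p b = 0" using b \<sigma>(3) that by (auto simp: push_def)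
      then show ?thesis using inK b by auto
    qed
    then show ?thesis using nn inK supp one fin by (auto intro!: realization_pointsI[of _ _ ?V])
  qed
  show "push \<sigma> v u t = t" if "t \<in> realization_points ?L"
  proof (rule id)
    show "\<not> \<sigma> \<subseteq> ?S" using realization_pointsD(2)[OF that] only[of ?S] by auto
  qed
  show "push \<sigma> v u t \<in> realization_points K" if "0 \<le> u" "u \<le> 1"
    using that sub[of u] id[of u] t by (cases "\<sigma> \<subseteq> ?S") auto
  show "push \<sigma> v 1 t \<in> realization_points ?L"
  proof (cases "\<sigma> \<subseteq> ?S")
    case False
    then have "t \<in> realization_points ?L" using t by (auto simp: realization_points_def)
    then show ?thesis using id[OF False] by simp
  qed (use sub[of 1] in auto)
qed

text \<open>\<open>push\<close> is one formula without cases on the support of the point, hence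
  visibly continuous, and for u from 0 to 1 it deforms the identity into the retraction. The
  condition \<open>\<sigma> \<noteq> {}\<close> matters: removing the empty face with the only
  vertex would turn a point into the empty space.\<close>

lemma elementary_collapse:
  assumes K: "simplicial_complex K" and \<sigma>: "\<sigma> \<in> K" "insert v \<sigma> \<in> K" "v \<notin> \<sigma>" "\<sigma> \<noteq> {}"
    and only: "\<And>\<rho>. \<rho> \<in> K \<Longrightarrow> \<sigma> \<subseteq> \<rho> \<Longrightarrow> \<rho> = \<sigma> \<or> \<rho> = insert v \<sigma>"
  shows "realization K homotopy_equivalent_space realization (K - {\<sigma>, insert v \<sigma>})"
proof -
  let ?L = "K - {\<sigma>, insert v \<sigma>}"
  have fin: "finite \<sigma>" using simplicial_complexD[OF K] \<sigma> by auto
  note p = push_fixes[OF K \<sigma> only] push_in[OF K \<sigma> only] push_retracts[OF K \<sigma> only]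
  have LK: "realization_points ?L \<subseteq> realization_points K" by (auto simp: realization_points_def)
  have cont: "continuous_map X euclideanreal (\<lambda>x. push \<sigma> v (f x) (g x) a)"
    if "continuous_map X euclideanreal f" "\<And>b. continuous_map X euclideanreal (\<lambda>x. g x b)"
    for X :: "'x topology" and f g a
  proof -
    have "continuous_map X euclideanreal (\<lambda>x. Min ((\<lambda>b. g x b) ` \<sigma>))"
      by (rule continuous_map_Min[OF fin \<sigma>(4)]) (rule that)
    then show ?thesis unfolding push_def using that
      by (intro continuous_map_add continuous_map_real_mult) auto
  qed
  have r: "continuous_map (realization K) (realization ?L) (push \<sigma> v 1)"
    unfolding continuous_map_into_realization using p(3)
    by (auto intro!: cont continuous_map_realization_component)
  have i: "continuous_map (realization ?L) (realization K) id"
    unfolding continuous_map_into_realization using LK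
    by (auto intro!: continuous_map_realization_component)
  have "homotopic_with (\<lambda>x. True) (realization K) (realization K) id (push \<sigma> v 1)"
    unfolding homotopic_with_def
  proof (intro exI[of _ "\<lambda>(u, t). push \<sigma> v u t"] conjI allI ballI)
    have "continuous_map (prod_topology (top_of_set {0..1}) (realization K)) euclideanreal (\<lambda>x. fst x)"
      using continuous_map_fst continuous_map_into_fulltopology by blast
    moreover have "continuous_map (prod_topology (top_of_set {0..1}) (realization K)) euclideanreal (\<lambda>x. snd x b)" for b
      using continuous_map_compose[OF continuous_map_snd continuous_map_realization_component]
      by (auto simp: o_def)
    ultimately show "continuous_map (prod_topology (top_of_set {0..1}) (realization K)) (realization K) (\<lambda>(u, t). push \<sigma> v u t)"
      unfolding continuous_map_into_realization case_prod_beta using p(2)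
      by (auto intro!: cont)
  qed (auto simp: push_def)
  then show ?thesis
    by (intro deformation_retract_imp_homotopy_equivalent_space[where r = "push \<sigma> v 1"])
      (use r i p(1) LK in \<open>auto simp: retraction_maps_def homotopic_with_symD\<close>)
qed

text \<open>The condition \<open>{} \<in> L\<close> keeps the empty face out of the removals, so
  that each of them is a geometric collapse.\<close>

lemma erasable_homotopy_equivalent:
  assumes "simplicial_complex K" "simplicial_complex L" "L \<subseteq> K" "{} \<in> L" "erasable (K - L)"
  shows "realization K homotopy_equivalent_space realization L"
proof -
  have "realization K homotopy_equivalent_space realization L"
    if "erasable D" "simplicial_complex K" "L \<subseteq> K" "K - L = D" for K D
    using that
  proof (induction arbitrary: K rule: erasable.induct)
    case erasable_empty
    then have "K = L" by auto
    then show ?case by (simp add: homotopy_equivalent_space_refl)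
  next
    case (erasable_step \<sigma> D v K)
    have only: "\<rho> = \<sigma> \<or> \<rho> = insert v \<sigma>" if "\<rho> \<in> K" "\<sigma> \<subseteq> \<rho>" for \<rho>
    proof -
      have "\<rho> \<notin> L" using that simplicial_complexD(3)[OF assms(2)] erasable_step.hyps(1) erasable_step.prems(3) by blast
      then show ?thesis using that erasable_step.hyps(4) erasable_step.prems(3) by blast
    qed
    let ?K = "K - {\<sigma>, insert v \<sigma>}"
    have ne: "\<sigma> \<noteq> {}" using erasable_step.hyps(1) erasable_step.prems(3) assms(4) by auto
    have in_K: "\<sigma> \<in> K" "insert v \<sigma> \<in> K" using erasable_step.hyps erasable_step.prems by auto
    have sub: "\<rho> \<in> ?K" if "\<tau> \<in> ?K" "\<rho> \<subseteq> \<tau>" for \<tau> \<rho>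
    proof -
      have "\<rho> \<in> K" using that simplicial_complexD(3)[OF erasable_step.prems(1), of \<tau> \<rho>] by simp
      moreover have "\<not> \<sigma> \<subseteq> \<rho>" using only[of \<tau>] that by auto
      ultimately show ?thesis by auto
    qed
    have "simplicial_complex ?K"
      using simplicial_complexD(1,2)[OF erasable_step.prems(1)]
      by (intro simplicial_complexI[OF _ _ sub]) simp_all
    moreover have "L \<subseteq> ?K" using erasable_step.hyps(1,2) erasable_step.prems(2,3) by blast
    moreover have "?K - L = D - {\<sigma>, insert v \<sigma>}" using erasable_step.prems(3) by blast
    ultimately have "realization ?K homotopy_equivalent_space realization L"
      by (rule erasable_step.IH)
    then show ?case
      using elementary_collapse[OF erasable_step.prems(1) in_K erasable_step.hyps(3) ne only]
      by (rule_tac homotopy_eqv_trans)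
  qed
  then show ?thesis using assms by blast
qed

text \<open>\<open>h\<close> is injective only on the vertices of \<open>K\<close>; all coordinates
  elsewhere vanish, which is why both maps are set to 0 there.\<close>

lemma realization_relabel:
  assumes "finite (\<Union>K)" "inj_on h (\<Union>K)"
  shows "realization K homeomorphic_space realization ((`) h ` K)"
proof -
  let ?V = "\<Union>K"
  define f where "f = (\<lambda>t b. if b \<in> h ` ?V then t (inv_into ?V h b) else 0 :: real)"
  define g where "g = (\<lambda>t a. if a \<in> ?V then t (h a) else 0 :: real)"
  have fh: "f t (h a) = t a" if "a \<in> ?V" for t a using that assms(2) by (simp add: f_def)
  have f: "f t \<in> realization_points ((`) h ` K)" if t: "t \<in> realization_points K" for t
  proof (rule realization_pointsI[of _ _ "h ` ?V"])
    have S: "{a. t a \<noteq> 0} \<subseteq> ?V" using realization_pointsD(2)[OF t] by auto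
    have "b \<in> h ` {a. t a \<noteq> 0}" if "f t b \<noteq> 0" for b
    proof -
      have "b \<in> h ` ?V" using that by (auto simp: f_def split: if_splits)
      then obtain a where "a \<in> ?V" "b = h a" by (rule imageE)
      then show ?thesis using that fh by auto
    qed
    moreover have "f t (h a) \<noteq> 0" if "t a \<noteq> 0" for a
      using that fh[OF subsetD[OF S], of a t] by simp
    ultimately have "{b. f t b \<noteq> 0} = h ` {a. t a \<noteq> 0}" by blast
    then show "{b. f t b \<noteq> 0} \<in> (`) h ` K" using realization_pointsD(2)[OF t] by auto
    have "sum (f t) (h ` ?V) = sum t ?V"
      by (subst sum.reindex[OF assms(2)]) (auto intro!: sum.cong simp: fh simp del: Union_iff)
    then show "sum (f t) (h ` ?V) = 1" using realization_points_sum[OF t assms(1) S] by simp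
  qed (use realization_pointsD[OF t] assms in \<open>auto simp: f_def split: if_splits\<close>)
  have g: "g t \<in> realization_points K" if t: "t \<in> realization_points ((`) h ` K)" for t
  proof (rule realization_pointsI[of _ _ ?V])
    obtain \<sigma> where \<sigma>: "\<sigma> \<in> K" "{b. t b \<noteq> 0} = h ` \<sigma>" using realization_pointsD(2)[OF t] by auto
    have "g t a \<noteq> 0 \<longleftrightarrow> a \<in> \<sigma>" for a
    proof (cases "a \<in> ?V")
      case True
      have "t (h a) \<noteq> 0 \<longleftrightarrow> h a \<in> h ` \<sigma>" using \<sigma>(2) by blast
      then show ?thesis
        using True inj_on_image_mem_iff[OF assms(2) True, of \<sigma>] \<sigma>(1) by (auto simp: g_def)
    next
      case False
      then show ?thesis using \<sigma>(1) by (auto simp: g_def)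
    qed
    then have "{a. g t a \<noteq> 0} = \<sigma>" by blast
    then show "{a. g t a \<noteq> 0} \<in> K" "{a. g t a \<noteq> 0} \<subseteq> ?V" using \<sigma> by auto
    have "sum (g t) ?V = sum t (h ` ?V)"
      by (subst sum.reindex[OF assms(2)]) (auto intro!: sum.cong simp: g_def)
    moreover have "{b. t b \<noteq> 0} \<subseteq> h ` ?V" using \<sigma> by auto
    ultimately show "sum (g t) ?V = 1" using realization_points_sum[OF t, of "h ` ?V"] assms(1) by simp
  qed (use realization_pointsD[OF t] assms in \<open>auto simp: g_def split: if_splits\<close>)
  have gf: "g (f t) = t" if "t \<in> realization_points K" for t
  proof
    fix a show "g (f t) a = t a"
    proof (cases "a \<in> ?V")
      case False
      then have "t a = 0" using realization_pointsD(2)[OF that] by blast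
      then show ?thesis using False by (simp add: g_def)
    qed (simp add: fh g_def)
  qed
  have fg: "f (g t) = t" if t: "t \<in> realization_points ((`) h ` K)" for t
  proof
    fix b
    show "f (g t) b = t b"
    proof (cases "b \<in> h ` ?V")
      case True
      then obtain a where "a \<in> ?V" "b = h a" by blast
      then show ?thesis using fh[of a "g t"] by (simp add: g_def)
    next
      case False
      then have "t b = 0" using realization_pointsD(2)[OF t] by blast
      then show ?thesis using False by (simp add: f_def)
    qed
  qed
  have "continuous_map (realization K) (realization ((`) h ` K)) f"
    unfolding continuous_map_into_realization using f
    by (auto simp: f_def intro: continuous_map_realization_component)
  moreover have "continuous_map (realization ((`) h ` K)) (realization K) g"
    unfolding continuous_map_into_realization using g
    by (auto simp: g_def intro: continuous_map_realization_component)
  ultimately have "homeomorphic_maps (realization K) (realization ((`) h ` K)) f g"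
    using gf fg by (simp add: homeomorphic_maps_def)
  then show ?thesis by (auto simp: homeomorphic_space_def)
qed

text \<open>One sphere for each i: the boundary of the simplex on \<open>A i\<close> and a vertex
  \<open>None\<close> shared by all. The last clause leaves out the full simplices; for empty
  \<open>I\<close> the bouquet is the single point \<open>None\<close>.\<close>

definition bouquet :: "'i set \<Rightarrow> ('i \<Rightarrow> 'v set) \<Rightarrow> ('i \<times> 'v) option set set" where
  "bouquet I A = {\<rho>. (\<forall>i v. Some (i, v) \<in> \<rho> \<longrightarrow> i \<in> I \<and> v \<in> A i) \<and>
     (\<forall>i v j w. Some (i, v) \<in> \<rho> \<longrightarrow> Some (j, w) \<in> \<rho> \<longrightarrow> i = j) \<and>
     (None \<in> \<rho> \<longrightarrow> (\<forall>i\<in>I. \<exists>v\<in>A i. Some (i, v) \<notin> \<rho>))}"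

lemma bouquetD:
  assumes "\<rho> \<in> bouquet I A"
  shows "Some (i, v) \<in> \<rho> \<Longrightarrow> i \<in> I \<and> v \<in> A i"
    and "Some (i, v) \<in> \<rho> \<Longrightarrow> Some (j, w) \<in> \<rho> \<Longrightarrow> i = j"
    and "None \<in> \<rho> \<Longrightarrow> i \<in> I \<Longrightarrow> \<exists>v\<in>A i. Some (i, v) \<notin> \<rho>"
proof -
  note * = assms[unfolded bouquet_def mem_Collect_eq]
  show "Some (i, v) \<in> \<rho> \<Longrightarrow> i \<in> I \<and> v \<in> A i"
    by (rule conjunct1[OF *, rule_format])
  show "Some (i, v) \<in> \<rho> \<Longrightarrow> Some (j, w) \<in> \<rho> \<Longrightarrow> i = j"
    by (rule conjunct1[OF conjunct2[OF *], rule_format])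
  show "None \<in> \<rho> \<Longrightarrow> i \<in> I \<Longrightarrow> \<exists>v\<in>A i. Some (i, v) \<notin> \<rho>"
    by (rule conjunct2[OF conjunct2[OF *], rule_format])
qed

lemma finite_Union_bouquet:
  assumes "finite I" "\<And>i. i \<in> I \<Longrightarrow> finite (A i)"
  shows "finite (\<Union>(bouquet I A))"
proof (rule finite_subset)
  show "finite (insert None (Some ` Sigma I A))" using assms by auto
  show "\<Union>(bouquet I A) \<subseteq> insert None (Some ` Sigma I A)"
  proof
    fix x assume "x \<in> \<Union>(bouquet I A)"
    then show "x \<in> insert None (Some ` Sigma I A)" by (cases x) (auto simp: bouquet_def)
  qed
qed

text \<open>Here the actual critical faces are forgotten: up to renaming of vertices, a bouquet
  knows only how many spheres there are and of which sizes.\<close>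

lemma bouquet_relabel:
  assumes \<beta>: "bij_betw \<beta> I J" and \<gamma>: "\<And>i. i \<in> I \<Longrightarrow> bij_betw (\<gamma> i) (A i) (B (\<beta> i))"
  obtains h where "inj_on h (\<Union>(bouquet I A))" "(`) h ` bouquet I A = bouquet J B"
proof -
  define h where "h = map_option (\<lambda>(i, v). (\<beta> i, \<gamma> i v))"
  define V where "V = insert None (Some ` Sigma I A)"
  have VU: "\<Union>(bouquet I A) \<subseteq> V"
  proof
    fix x assume "x \<in> \<Union>(bouquet I A)"
    then show "x \<in> V" by (cases x) (auto simp: V_def bouquet_def)
  qed
  have \<beta>inj: "\<beta> i = \<beta> j \<longleftrightarrow> i = j" if "i \<in> I" "j \<in> I" for i j
    using \<beta> that by (auto simp: bij_betw_def inj_on_def)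
  have \<gamma>inj: "\<gamma> i v = \<gamma> i w \<longleftrightarrow> v = w" if "i \<in> I" "v \<in> A i" "w \<in> A i" for i v w
    using \<gamma>[of i] that by (auto simp: bij_betw_def inj_on_def)
  have inj: "inj_on h V"
    by (rule inj_onI) (auto simp: h_def V_def \<beta>inj \<gamma>inj)
  have hN: "h x = None \<longleftrightarrow> x = None" for x by (simp add: h_def)
  have mem: "Some (\<beta> i, \<gamma> i v) \<in> h ` \<rho> \<longleftrightarrow> Some (i, v) \<in> \<rho>"
    if "\<rho> \<subseteq> V" "i \<in> I" "v \<in> A i" for \<rho> i v
  proof -
    have "Some (i, v) \<in> V" using that by (auto simp: V_def)
    from inj_on_image_mem_iff[OF inj this that(1)] show ?thesis by (simp add: h_def)
  qed
  have memN: "None \<in> h ` \<rho> \<longleftrightarrow> None \<in> \<rho>" for \<rho> using hN by (metis image_iff)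
  have surj: "\<exists>i\<in>I. \<exists>v\<in>A i. j = \<beta> i \<and> w = \<gamma> i v" if "j \<in> J" "w \<in> B j" for j w
    using that \<beta> \<gamma> unfolding bij_betw_def by (metis imageE)
  have in_iff: "h ` \<rho> \<in> bouquet J B \<longleftrightarrow> \<rho> \<in> bouquet I A" if "\<rho> \<subseteq> V" for \<rho>
  proof -
    have mem': "Some (j, w) \<in> h ` \<rho> \<longleftrightarrow> (\<exists>i\<in>I. \<exists>v\<in>A i. j = \<beta> i \<and> w = \<gamma> i v \<and> Some (i, v) \<in> \<rho>)" for j w
      using that by (force simp: h_def V_def)
    have \<beta>J: "\<beta> i \<in> J" if "i \<in> I" for i using that \<beta> by (auto simp: bij_betw_def)
    have \<gamma>B: "\<gamma> i v \<in> B (\<beta> i)" if "i \<in> I" "v \<in> A i" for i v using that \<gamma> by (auto simp: bij_betw_def)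
    have \<rho>V: "i \<in> I \<and> v \<in> A i" if "Some (i, v) \<in> \<rho>" for i v using that \<open>\<rho> \<subseteq> V\<close> by (auto simp: V_def)
    have 1: "\<forall>j w. Some (j, w) \<in> h ` \<rho> \<longrightarrow> j \<in> J \<and> w \<in> B j" using mem' \<beta>J \<gamma>B by (metis (no_types))
    have 2: "(\<forall>i v j w. Some (i, v) \<in> h ` \<rho> \<longrightarrow> Some (j, w) \<in> h ` \<rho> \<longrightarrow> i = j) \<longleftrightarrow>
        (\<forall>i v j w. Some (i, v) \<in> \<rho> \<longrightarrow> Some (j, w) \<in> \<rho> \<longrightarrow> i = j)"
      (is "?L \<longleftrightarrow> ?R")
    proof
      assume L: ?L
      show ?R
      proof (intro allI impI)
        fix i v j w assume *: "Some (i, v) \<in> \<rho>" "Some (j, w) \<in> \<rho>"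
        then have "Some (\<beta> i, \<gamma> i v) \<in> h ` \<rho>" "Some (\<beta> j, \<gamma> j w) \<in> h ` \<rho>"
          using mem[OF that] \<rho>V by blast+
        then have "\<beta> i = \<beta> j" using L by blast
        then show "i = j" using \<beta>inj \<rho>V * by blast
      qed
    next
      assume R: ?R
      show ?L
      proof (intro allI impI)
        fix i v j w assume "Some (i, v) \<in> h ` \<rho>" "Some (j, w) \<in> h ` \<rho>"
        then show "i = j" unfolding mem' using R by blast
      qed
    qed
    have 3: "(\<exists>w\<in>B j. Some (j, w) \<notin> h ` \<rho>) \<longleftrightarrow> (\<exists>v\<in>A i. Some (i, v) \<notin> \<rho>)" if "i \<in> I" "j = \<beta> i" for i j
    proof -
      have "B j = \<gamma> i ` A i" using \<gamma>[OF that(1)] that(2) by (simp add: bij_betw_def)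
      then show ?thesis using mem[OF \<open>\<rho> \<subseteq> V\<close> that(1)] that(2) by auto
    qed
    have "J = \<beta> ` I" using \<beta> by (simp add: bij_betw_def)
    then have 4: "(\<forall>j\<in>J. \<exists>w\<in>B j. Some (j, w) \<notin> h ` \<rho>) \<longleftrightarrow> (\<forall>i\<in>I. \<exists>v\<in>A i. Some (i, v) \<notin> \<rho>)"
      using 3 by simp
    show ?thesis
      unfolding bouquet_def mem_Collect_eq memN 2 4 using 1 \<rho>V by blast
  qed
  have "(`) h ` bouquet I A = bouquet J B"
  proof
    show "(`) h ` bouquet I A \<subseteq> bouquet J B"
    proof
      fix \<rho>' assume "\<rho>' \<in> (`) h ` bouquet I A"
      then obtain \<rho> where \<rho>: "\<rho> \<in> bouquet I A" "\<rho>' = h ` \<rho>" by blast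
      then have "\<rho> \<subseteq> V" using VU by blast
      then show "\<rho>' \<in> bouquet J B" using in_iff \<rho> by blast
    qed
    show "bouquet J B \<subseteq> (`) h ` bouquet I A"
    proof
      fix \<rho>' assume \<rho>': "\<rho>' \<in> bouquet J B"
      define \<rho> where "\<rho> = {x \<in> V. h x \<in> \<rho>'}"
      have "y \<in> h ` V" if "y \<in> \<rho>'" for y
      proof (cases y)
        case None
        then show ?thesis by (auto simp: V_def h_def image_iff)
      next
        case (Some z)
        obtain j w where z: "z = (j, w)" by (cases z)
        then have "j \<in> J" "w \<in> B j" using \<rho>' Some that by (auto simp: bouquet_def)
        then obtain i v where "i \<in> I" "v \<in> A i" "j = \<beta> i" "w = \<gamma> i v" using surj by blast
        then have "y = h (Some (i, v))" "Some (i, v) \<in> V" using Some z by (auto simp: h_def V_def)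
        then show ?thesis by blast
      qed
      then have "h ` \<rho> = \<rho>'" by (auto simp: \<rho>_def)
      moreover have "\<rho> \<subseteq> V" by (auto simp: \<rho>_def)
      ultimately show "\<rho>' \<in> (`) h ` bouquet I A" using in_iff[of \<rho>] \<rho>' by blast
    qed
  qed
  then show ?thesis using that inj_on_subset[OF inj VU] by blast
qed

section \<open>Comparison of a complex with a bouquet of spheres\<close>

type_synonym 'a doubled = "'a + ('a set \<times> 'a) option"

abbreviation apex :: "'a doubled" where "apex \<equiv> Inr None"
abbreviation copy :: "'a set \<Rightarrow> 'a \<Rightarrow> 'a doubled" where "copy F v \<equiv> Inr (Some (F, v))"

definition shadow :: "'a doubled set \<Rightarrow> 'a set" where
  "shadow \<sigma> = {v. Inl v \<in> \<sigma> \<or> (\<exists>F. copy F v \<in> \<sigma>)}"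

text \<open>A complex \<open>K\<close> with critical faces \<open>\<F>\<close> is enlarged by a cone on \<open>K - \<F>\<close> and by a copy of each
  critical face, joined to the original by all simplices over it. It erases both to \<open>K\<close> and, by means
  of the cone, to the subcomplex without original vertices, which is a bouquet of spheres.\<close>

definition enlargement :: "'a set set \<Rightarrow> 'a set set \<Rightarrow> 'a doubled set set" where
  "enlargement K \<F> = {\<sigma>. shadow \<sigma> \<in> K \<and> (apex \<in> \<sigma> \<longrightarrow> shadow \<sigma> \<notin> \<F>) \<and>
     (\<forall>F v. copy F v \<in> \<sigma> \<longrightarrow> F \<in> \<F> \<and> shadow \<sigma> \<subseteq> F) \<and>
     (\<forall>F v F' v'. copy F v \<in> \<sigma> \<longrightarrow> copy F' v' \<in> \<sigma> \<longrightarrow> F = F')}"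

lemma shadow_mono: "\<rho> \<subseteq> \<sigma> \<Longrightarrow> shadow \<rho> \<subseteq> shadow \<sigma>"
  by (auto simp: shadow_def)

text \<open>Only the apex clause is not visibly inherited by subsets. If the smaller shadow is
  critical, it is maximal in \<open>K\<close>, so the larger shadow equals it, and this is what the
  apex rules out.\<close>

lemma simplicial_complex_enlargement:
  assumes K: "simplicial_complex K" and F: "\<F> \<subseteq> K"
    and max: "\<And>\<sigma> \<rho>. \<sigma> \<in> \<F> \<Longrightarrow> \<rho> \<in> K \<Longrightarrow> \<sigma> \<subseteq> \<rho> \<Longrightarrow> \<rho> = \<sigma>"
  shows "simplicial_complex (enlargement K \<F>)"
proof -
  let ?V = "Inl ` (\<Union>K) \<union> {apex} \<union> (\<lambda>(F, v). copy F v) ` (\<F> \<times> \<Union>K)"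
  have finV: "finite ?V"
    using simplicial_complexD(1,4)[OF K] finite_subset[OF F] by auto
  have sub: "\<sigma> \<subseteq> ?V" if \<sigma>: "\<sigma> \<in> enlargement K \<F>" for \<sigma>
  proof
    fix x assume x: "x \<in> \<sigma>"
    have *: "v \<in> \<Union>K" if "v \<in> shadow \<sigma>" for v using \<sigma> that by (auto simp: enlargement_def)
    consider v where "x = Inl v" | "x = apex" | F v where "x = copy F v"
      by (metis obj_sumE option.exhaust surj_pair)
    then show "x \<in> ?V"
    proof cases
      case 3
      then have "F \<in> \<F>" "v \<in> shadow \<sigma>" using \<sigma> x by (auto simp: enlargement_def shadow_def)
      then show ?thesis using *[of v] 3 by (force simp: image_iff)
    qed (use *[unfolded shadow_def] x in auto)
  qed
  show ?thesis
  proof (rule simplicial_complexI)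
    have "enlargement K \<F> \<subseteq> Pow ?V" using sub by blast
    then show "finite (enlargement K \<F>)" using finV by (meson finite_Pow_iff finite_subset)
    show "finite \<sigma>" if "\<sigma> \<in> enlargement K \<F>" for \<sigma>
      using sub[OF that] finV by (rule finite_subset)
    show "\<rho> \<in> enlargement K \<F>" if \<sigma>: "\<sigma> \<in> enlargement K \<F>" and \<rho>: "\<rho> \<subseteq> \<sigma>" for \<sigma> \<rho>
    proof -
      note m = shadow_mono[OF \<rho>]
      have \<sigma>K: "shadow \<sigma> \<in> K" using \<sigma> by (simp add: enlargement_def)
      then have "shadow \<rho> \<in> K" using m simplicial_complexD(3)[OF K] by blast
      moreover have "shadow \<rho> \<notin> \<F>" if "apex \<in> \<rho>"
      proof
        assume "shadow \<rho> \<in> \<F>"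
        then have "shadow \<sigma> \<in> \<F>" using max[OF _ \<sigma>K m] by simp
        then show False using \<sigma> \<rho> that by (auto simp: enlargement_def)
      qed
      moreover have "F \<in> \<F> \<and> shadow \<rho> \<subseteq> F" if "copy F v \<in> \<rho>" for F v
        using that \<rho> m \<sigma> by (auto simp: enlargement_def)
      moreover have "F = F'" if "copy F v \<in> \<rho>" "copy F' v' \<in> \<rho>" for F v F' v'
        using that \<rho> \<sigma> unfolding enlargement_def by blast
      ultimately show ?thesis unfolding enlargement_def by blast
    qed
  qed
qed

lemma simplicial_complex_filter:
  assumes "simplicial_complex K" "\<And>\<sigma> \<rho>. P \<sigma> \<Longrightarrow> \<rho> \<subseteq> \<sigma> \<Longrightarrow> P \<rho>"
  shows "simplicial_complex {\<sigma> \<in> K. P \<sigma>}"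
  using simplicial_complexD(1-3)[OF assms(1)] assms(2) by (intro simplicial_complexI) (simp, simp, blast)

text \<open>The original of the largest vertex with a copy in the face can be toggled freely,
  because the copy already casts its shadow. Vertices are natural numbers in order that this largest
  vertex exists and can only grow with the face.\<close>

lemma erasable_copies:
  fixes K :: "nat set set"
  assumes "finite (enlargement K \<F>)" "\<And>\<sigma>. \<sigma> \<in> enlargement K \<F> \<Longrightarrow> finite (shadow \<sigma>)"
  shows "erasable {\<sigma> \<in> enlargement K \<F>. \<exists>F v. copy F v \<in> \<sigma>}"
proof -
  define C where "C = (\<lambda>\<sigma>. {v. \<exists>F. copy F v \<in> (\<sigma> :: nat doubled set)})"
  have C: "finite (C \<sigma>) \<and> C \<sigma> \<noteq> {}" if "\<sigma> \<in> {\<sigma> \<in> enlargement K \<F>. \<exists>F v. copy F v \<in> \<sigma>}" for \<sigma>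
  proof -
    have "C \<sigma> \<subseteq> shadow \<sigma>" by (auto simp: C_def shadow_def)
    then show ?thesis using that assms(2)[of \<sigma>] finite_subset by (auto simp: C_def)
  qed
  show ?thesis
  proof (rule erasable_patchwork_toggle[where f = "\<lambda>\<sigma>. Max (C \<sigma>)" and rank = id and w = Inl])
    show "Max (C \<sigma>) = Max (C \<rho>) \<or> id (Max (C \<sigma>)) < id (Max (C \<rho>))"
      if "\<sigma> \<in> {\<sigma> \<in> enlargement K \<F>. \<exists>F v. copy F v \<in> \<sigma>}"
        "\<rho> \<in> {\<sigma> \<in> enlargement K \<F>. \<exists>F v. copy F v \<in> \<sigma>}" "\<sigma> \<subseteq> \<rho>" for \<sigma> \<rho>
    proof -
      have "C \<sigma> \<subseteq> C \<rho>" using that(3) by (auto simp: C_def)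
      then have "Max (C \<sigma>) \<le> Max (C \<rho>)" using C[OF that(1)] C[OF that(2)] by (intro Max_mono) auto
      then show ?thesis by auto
    qed
  next
    fix \<sigma> assume \<sigma>: "\<sigma> \<in> {\<sigma> \<in> enlargement K \<F>. \<exists>F v. copy F v \<in> \<sigma>}"
    let ?v = "Max (C \<sigma>)"
    have "?v \<in> C \<sigma>" using C[OF \<sigma>] by (intro Max_in) auto
    then have s: "shadow (insert (Inl ?v) \<sigma>) = shadow \<sigma>" "shadow (\<sigma> - {Inl ?v}) = shadow \<sigma>"
      unfolding shadow_def C_def by auto
    have c: "C (insert (Inl ?v) \<sigma>) = C \<sigma>" "C (\<sigma> - {Inl ?v}) = C \<sigma>" by (auto simp: C_def)
    show "insert (Inl ?v) \<sigma> \<in> {\<sigma> \<in> enlargement K \<F>. \<exists>F v. copy F v \<in> \<sigma>} \<and> Max (C (insert (Inl ?v) \<sigma>)) = ?v"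
      using \<sigma> unfolding c by (simp add: enlargement_def s)
    show "\<sigma> - {Inl ?v} \<in> {\<sigma> \<in> enlargement K \<F>. \<exists>F v. copy F v \<in> \<sigma>} \<and> Max (C (\<sigma> - {Inl ?v})) = ?v"
      using \<sigma> unfolding c by (simp add: enlargement_def s)
  qed (use assms in auto)
qed

text \<open>Two matchings. A face with critical shadow cannot contain the apex and contains only
  copies belonging to that shadow, so the copy of its largest original vertex is toggled; otherwise
  the apex is toggled. The first kind goes first, since critical shadows are maximal.\<close>

lemma erasable_originals:
  fixes K :: "nat set set"
  assumes fin: "finite (enlargement K \<F>)" "\<And>\<sigma>. \<sigma> \<in> enlargement K \<F> \<Longrightarrow> finite (shadow \<sigma>)"
    and F: "\<F> \<subseteq> K" and max: "\<And>\<sigma> \<rho>. \<sigma> \<in> \<F> \<Longrightarrow> \<rho> \<in> K \<Longrightarrow> \<sigma> \<subseteq> \<rho> \<Longrightarrow> \<rho> = \<sigma>"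
  shows "erasable {\<sigma> \<in> enlargement K \<F>. \<exists>v. Inl v \<in> \<sigma>}"
proof -
  let ?D = "{\<sigma> \<in> enlargement K \<F>. \<exists>v. Inl v \<in> \<sigma>}"
  let ?A = "{\<sigma> \<in> ?D. shadow \<sigma> \<in> \<F>}" and ?B = "{\<sigma> \<in> ?D. shadow \<sigma> \<notin> \<F>}"
  define C where "C = (\<lambda>\<sigma>. {v. Inl v \<in> (\<sigma> :: nat doubled set)})"
  have C: "finite (C \<sigma>) \<and> C \<sigma> \<noteq> {}" if "\<sigma> \<in> ?D" for \<sigma>
  proof -
    have "C \<sigma> \<subseteq> shadow \<sigma>" by (auto simp: C_def shadow_def)
    then show ?thesis using that fin(2)[of \<sigma>] finite_subset by (auto simp: C_def)
  qed
  have "erasable ?A"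
  proof (rule erasable_patchwork_toggle[where f = "\<lambda>\<sigma>. (shadow \<sigma>, Max (C \<sigma>))" and rank = snd
        and w = "\<lambda>(F, v). copy F v"])
    show "(shadow \<sigma>, Max (C \<sigma>)) = (shadow \<rho>, Max (C \<rho>)) \<or>
        snd (shadow \<sigma>, Max (C \<sigma>)) < snd (shadow \<rho>, Max (C \<rho>))"
      if "\<sigma> \<in> ?A" "\<rho> \<in> ?A" "\<sigma> \<subseteq> \<rho>" for \<sigma> \<rho>
    proof -
      have "C \<sigma> \<subseteq> C \<rho>" using that(3) by (auto simp: C_def)
      then have "Max (C \<sigma>) \<le> Max (C \<rho>)" using C that by (intro Max_mono) auto
      moreover have "shadow \<rho> = shadow \<sigma>"
        by (rule max) (use that shadow_mono[OF that(3)] in \<open>auto simp: enlargement_def\<close>)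
      ultimately show ?thesis by auto
    qed
  next
    fix \<sigma> assume \<sigma>: "\<sigma> \<in> ?A"
    let ?v = "Max (C \<sigma>)" and ?F = "shadow \<sigma>"
    let ?i = "insert (copy ?F ?v) \<sigma>" and ?d = "\<sigma> - {copy ?F ?v}"
    have v: "?v \<in> C \<sigma>" using C \<sigma> by (intro Max_in) auto
    then have s: "shadow ?i = ?F" "shadow ?d = ?F"
      unfolding shadow_def C_def by auto
    have c: "C ?i = C \<sigma>" "C ?d = C \<sigma>" by (auto simp: C_def)
    have FK: "?F \<in> \<F>" using \<sigma> by simp
    have copies: "F = ?F" if "copy F w \<in> \<sigma>" for F w
    proof -
      have "F \<in> \<F>" "?F \<subseteq> F" using that \<sigma> by (auto simp: enlargement_def)
      then show ?thesis using max[OF FK, of F] F by blast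
    qed
    have "?i \<in> enlargement K \<F>" "?d \<in> enlargement K \<F>"
      using \<sigma> copies by (auto simp: enlargement_def s)
    then show "insert (case (?F, ?v) of (F, v) \<Rightarrow> copy F v) \<sigma> \<in> ?A \<and>
        (shadow (insert (case (?F, ?v) of (F, v) \<Rightarrow> copy F v) \<sigma>),
         Max (C (insert (case (?F, ?v) of (F, v) \<Rightarrow> copy F v) \<sigma>))) = (?F, ?v)"
      and "\<sigma> - {case (?F, ?v) of (F, v) \<Rightarrow> copy F v} \<in> ?A \<and>
        (shadow (\<sigma> - {case (?F, ?v) of (F, v) \<Rightarrow> copy F v}),
         Max (C (\<sigma> - {case (?F, ?v) of (F, v) \<Rightarrow> copy F v}))) = (?F, ?v)"
      using \<sigma> FK by (simp_all add: s c)
  qed (use fin in auto)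
  moreover have "erasable ?B"
  proof (rule erasable_toggle[where v = apex])
    show "insert apex \<sigma> \<in> ?B \<and> \<sigma> - {apex} \<in> ?B" if "\<sigma> \<in> ?B" for \<sigma>
    proof -
      have "shadow (insert apex \<sigma>) = shadow \<sigma>" "shadow (\<sigma> - {apex}) = shadow \<sigma>"
        by (auto simp: shadow_def)
      then show ?thesis using that by (auto simp: enlargement_def)
    qed
  qed (use fin in auto)
  moreover have "\<not> \<sigma> \<subseteq> \<rho>" if "\<sigma> \<in> ?A" "\<rho> \<in> ?B" for \<sigma> \<rho>
    using max[of "shadow \<sigma>" "shadow \<rho>"] shadow_mono[of \<sigma> \<rho>] that by (auto simp: enlargement_def)
  ultimately have "erasable (?A \<union> ?B)" by (rule erasable_Un)
  moreover have "?A \<union> ?B = ?D" by auto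
  ultimately show ?thesis by simp
qed

lemma critical_faces_bouquet:
  fixes K :: "nat set set"
  assumes K: "simplicial_complex K" "{} \<in> K" and F: "critical_faces K d \<F>"
  shows "realization K homotopy_equivalent_space realization (bouquet \<F> (\<lambda>F. F))"
proof -
  have \<F>: "\<F> \<subseteq> K" "erasable (K - \<F>)"
    and max: "\<And>\<sigma> \<rho>. \<sigma> \<in> \<F> \<Longrightarrow> \<rho> \<in> K \<Longrightarrow> \<sigma> \<subseteq> \<rho> \<Longrightarrow> \<rho> = \<sigma>"
    using F unfolding critical_faces_def by blast+
  let ?E = "enlargement K \<F>"
  have E: "simplicial_complex ?E" by (rule simplicial_complex_enlargement[OF K(1) \<F>(1) max])
  have finS: "finite (shadow \<sigma>)" if "\<sigma> \<in> ?E" for \<sigma>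
    using that simplicial_complexD(2)[OF K(1)] by (auto simp: enlargement_def)
  let ?C = "{\<sigma> \<in> ?E. \<not> (\<exists>F v. copy F v \<in> \<sigma>)}" and ?O = "{\<sigma> \<in> ?E. \<not> (\<exists>v. Inl v \<in> \<sigma>)}"
  let ?K = "(`) Inl ` K :: nat doubled set set"
  have empty: "{} \<in> ?E" using K(2) by (auto simp: enlargement_def shadow_def)
  have C: "simplicial_complex ?C" and O: "simplicial_complex ?O"
    by (rule simplicial_complex_filter[OF E]; blast)+
  have "?E - ?C = {\<sigma> \<in> ?E. \<exists>F v. copy F v \<in> \<sigma>}" "?E - ?O = {\<sigma> \<in> ?E. \<exists>v. Inl v \<in> \<sigma>}" by auto
  then have EC: "realization ?E homotopy_equivalent_space realization ?C"
    and EO: "realization ?E homotopy_equivalent_space realization ?O"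
    using erasable_homotopy_equivalent[OF E C] erasable_homotopy_equivalent[OF E O] empty
      erasable_copies[of K \<F>] erasable_originals[of K \<F>, OF _ _ \<F>(1) max] simplicial_complexD(1)[OF E] finS
    by auto
  have sh: "shadow (Inl ` \<sigma>) = \<sigma>" "shadow (insert apex (Inl ` \<sigma>)) = \<sigma>" for \<sigma> :: "nat set"
    by (auto simp: shadow_def)
  have C_eq: "?C = ?K \<union> (\<union>) {apex} ` ((`) Inl ` (K - \<F>))"
  proof (intro equalityI subsetI)
    fix \<sigma> assume \<sigma>: "\<sigma> \<in> ?C"
    have "\<sigma> - {apex} = Inl ` shadow \<sigma>"
    proof (intro equalityI subsetI)
      fix x assume x: "x \<in> \<sigma> - {apex}"
      show "x \<in> Inl ` shadow \<sigma>"
      proof (cases x)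
        case (Inr y)
        then show ?thesis using x \<sigma> by (cases y) auto
      qed (use x in \<open>auto simp: shadow_def\<close>)
    qed (use \<sigma> in \<open>auto simp: shadow_def\<close>)
    then have "\<sigma> = (if apex \<in> \<sigma> then {apex} \<union> Inl ` shadow \<sigma> else Inl ` shadow \<sigma>)" by auto
    then show "\<sigma> \<in> ?K \<union> (\<union>) {apex} ` ((`) Inl ` (K - \<F>))"
      using \<sigma> unfolding enlargement_def by (auto split: if_splits)
  next
    fix \<sigma> assume "\<sigma> \<in> ?K \<union> (\<union>) {apex} ` ((`) Inl ` (K - \<F>))"
    then show "\<sigma> \<in> ?C" by (auto simp: enlargement_def sh)
  qed
  have "?C - ?K = (\<union>) {apex} ` ((`) Inl ` (K - \<F>))" unfolding C_eq by auto
  \<comment> \<open>The cone faces disappear in the same order as the noncritical faces of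
    \<open>K\<close>. The removal of a noncritical empty face becomes that of the vertex
    \<open>apex\<close> with an edge, a genuine collapse.\<close>
  moreover have "erasable ((\<union>) {apex} ` ((`) Inl ` (K - \<F>)))"
    by (intro erasable_shift erasable_image \<F>) auto
  moreover have "simplicial_complex ?K"
    using simplicial_complexD[OF K(1)] by (intro simplicial_complexI) (auto simp: subset_image_iff)
  ultimately have CK: "realization ?C homotopy_equivalent_space realization ?K"
  proof (rule_tac erasable_homotopy_equivalent[OF C])
    show "?K \<subseteq> ?C" unfolding C_eq by blast
    show "{} \<in> ?K" using K(2) by (metis image_empty imageI)
  qed simp_all
  have KK: "realization K homotopy_equivalent_space realization ?K"
    using simplicial_complexD(4)[OF K(1)]
    by (intro homeomorphic_imp_homotopy_equivalent_space realization_relabel) auto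
  have O_eq: "?O = (`) Inr ` bouquet \<F> (\<lambda>F. F)"
  proof (intro equalityI subsetI)
    fix \<sigma> assume \<sigma>: "\<sigma> \<in> ?O"
    have sK: "shadow \<sigma> \<in> K" using \<sigma> by (simp add: enlargement_def)
    \<comment> \<open>All copies of \<open>F\<close> together would make the shadow contain
      \<open>F\<close>, hence be critical; so the apex clause amounts to leaving out the full
      simplices of the bouquet.\<close>
    have "\<exists>v\<in>F. copy F v \<notin> \<sigma>" if "apex \<in> \<sigma>" "F \<in> \<F>" for F
    proof (rule ccontr)
      assume "\<not> (\<exists>v\<in>F. copy F v \<notin> \<sigma>)"
      then have "F \<subseteq> shadow \<sigma>" by (auto simp: shadow_def)
      then have "shadow \<sigma> \<in> \<F>" using max[OF that(2) sK] that(2) by simp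
      then show False using \<sigma> that(1) by (simp add: enlargement_def)
    qed
    moreover have "F \<in> \<F> \<and> v \<in> F" if "copy F v \<in> \<sigma>" for F v
    proof -
      have "F \<in> \<F>" "shadow \<sigma> \<subseteq> F" "v \<in> shadow \<sigma>"
        using \<sigma> that by (auto simp: enlargement_def shadow_def)
      then show ?thesis by auto
    qed
    moreover have "F = F'" if "copy F v \<in> \<sigma>" "copy F' v' \<in> \<sigma>" for F v F' v'
      using \<sigma> that unfolding enlargement_def by blast
    ultimately have "Inr -` \<sigma> \<in> bouquet \<F> (\<lambda>F. F)"
      unfolding bouquet_def by (simp only: mem_Collect_eq vimage_eq) blast
    moreover have "\<sigma> = Inr ` (Inr -` \<sigma>)"
    proof (intro equalityI subsetI)
      fix x assume "x \<in> \<sigma>"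
      then show "x \<in> Inr ` (Inr -` \<sigma>)" using \<sigma> by (cases x) auto
    qed auto
    ultimately show "\<sigma> \<in> (`) Inr ` bouquet \<F> (\<lambda>F. F)" by blast
  next
    fix \<sigma> :: "nat doubled set" assume "\<sigma> \<in> (`) Inr ` bouquet \<F> (\<lambda>F. F)"
    then obtain \<rho> where \<sigma>: "\<sigma> = Inr ` \<rho>" and \<rho>: "\<rho> \<in> bouquet \<F> (\<lambda>F. F)" by auto
    have copies: "copy F v \<in> \<sigma> \<longleftrightarrow> Some (F, v) \<in> \<rho>" for F v using \<sigma> by auto
    note same = bouquetD(2)[OF \<rho>] and mem = bouquetD(1)[OF \<rho>]
    have shadow: "shadow \<sigma> = {v. \<exists>F. Some (F, v) \<in> \<rho>}"
      unfolding shadow_def copies using \<sigma> by auto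
    have sub: "shadow \<sigma> \<subseteq> F" if "Some (F, v) \<in> \<rho>" for F v
    proof
      fix w assume "w \<in> shadow \<sigma>"
      then obtain F' where F': "Some (F', w) \<in> \<rho>" unfolding shadow by blast
      show "w \<in> F" using same[OF F' \<open>Some (F, v) \<in> \<rho>\<close>] mem[OF F'] by simp
    qed
    have "shadow \<sigma> \<in> K"
    proof (cases "\<exists>F v. Some (F, v) \<in> \<rho>")
      case True
      then obtain F v where Fv: "Some (F, v) \<in> \<rho>" by blast
      then show ?thesis using sub[OF Fv] mem[OF Fv] \<F>(1) simplicial_complexD(3)[OF K(1)] by blast
    next
      case False
      then have "shadow \<sigma> = {}" unfolding shadow by blast
      then show ?thesis using K(2) by simp
    qed
    moreover have "shadow \<sigma> \<notin> \<F>" if "apex \<in> \<sigma>"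
    proof
      assume s: "shadow \<sigma> \<in> \<F>"
      have "None \<in> \<rho>" using that \<sigma> by auto
      then obtain v where v: "v \<in> shadow \<sigma>" "Some (shadow \<sigma>, v) \<notin> \<rho>" using bouquetD(3)[OF \<rho> _ s] by auto
      then obtain F where F: "Some (F, v) \<in> \<rho>" unfolding shadow by blast
      then have "F = shadow \<sigma>" using max[OF s, of F] sub[OF F] mem[OF F] \<F>(1) by blast
      then show False using F v by simp
    qed
    moreover have "\<not> (\<exists>v. Inl v \<in> \<sigma>)" using \<sigma> by auto
    ultimately show "\<sigma> \<in> ?O"
      unfolding enlargement_def mem_Collect_eq copies
    proof (intro conjI allI impI)
      show "F = F'" if "Some (F, v) \<in> \<rho>" "Some (F', v') \<in> \<rho>" for F v F' v'
        using that by (rule same)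
    qed (use sub mem in blast)+
  qed
  have "finite (\<Union>(bouquet \<F> (\<lambda>F. F)))"
    using finite_subset[OF \<F>(1)] simplicial_complexD(1,2)[OF K(1)] \<F>(1)
    by (intro finite_Union_bouquet) auto
  then have "realization (bouquet \<F> (\<lambda>F. F)) homotopy_equivalent_space realization ?O"
    unfolding O_eq by (intro homeomorphic_imp_homotopy_equivalent_space realization_relabel) auto
  with KK CK EC EO show ?thesis
    by (meson homotopy_eqv_trans homotopy_equivalent_space_sym)
qed

text \<open>Each complex is renamed to natural vertices, as the matchings on the enlargement use a
  linear order, and is compared with the bouquet of its critical faces; the two bouquets are
  isomorphic.\<close>

theorem spherical_homotopy_equivalent:
  assumes K: "simplicial_complex K" "{} \<in> K" "spherical K N d"
    and L: "simplicial_complex L" "{} \<in> L" "spherical L N d"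
  shows "realization K homotopy_equivalent_space realization L"
proof -
  have nat: "\<exists>\<F>. (\<forall>F\<in>\<F>. finite F \<and> card F = d) \<and> finite \<F> \<and> card \<F> = N \<and>
      realization M homotopy_equivalent_space realization (bouquet \<F> (\<lambda>F :: nat set. F))"
    if M: "simplicial_complex M" "{} \<in> M" "spherical M N d" for M :: "'x set set"
  proof -
    obtain h :: "'x \<Rightarrow> nat" where h: "inj_on h (\<Union>M)"
      using finite_imp_inj_to_nat_seg[OF simplicial_complexD(4)[OF M(1)]] by blast
    let ?M = "(`) h ` M"
    have "\<rho> \<in> ?M" if "\<sigma> \<in> ?M" "\<rho> \<subseteq> \<sigma>" for \<sigma> \<rho>
    proof -
      obtain \<tau> where "\<tau> \<in> M" "\<sigma> = h ` \<tau>" using \<open>\<sigma> \<in> ?M\<close> by blast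
      moreover obtain \<upsilon> where "\<upsilon> \<subseteq> \<tau>" "\<rho> = h ` \<upsilon>" using \<open>\<rho> \<subseteq> \<sigma>\<close> calculation by (auto simp: subset_image_iff)
      ultimately show ?thesis using simplicial_complexD(3)[OF M(1)] by blast
    qed
    then have "simplicial_complex ?M"
      using simplicial_complexD(1,2)[OF M(1)] by (rule_tac simplicial_complexI) auto
    moreover have "{} \<in> ?M" using M(2) by (metis image_empty imageI)
    moreover obtain \<F> where \<F>: "critical_faces ?M d \<F>" "card \<F> = N"
      using spherical_image[OF M(3) h] by (auto simp: spherical_def)
    ultimately have "realization ?M homotopy_equivalent_space realization (bouquet \<F> (\<lambda>F. F))"
      by (intro critical_faces_bouquet)
    moreover have "realization M homotopy_equivalent_space realization ?M"
      by (intro homeomorphic_imp_homotopy_equivalent_space realization_relabel h simplicial_complexD(4) M)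
    moreover have "finite \<F>" "\<forall>F\<in>\<F>. finite F \<and> card F = d"
      using \<F> simplicial_complexD(1)[OF M(1)] by (auto simp: critical_faces_def intro: finite_subset)
    ultimately show ?thesis using \<F>(2) homotopy_eqv_trans by blast
  qed
  obtain \<F> where \<F>: "\<forall>F\<in>\<F>. finite F \<and> card F = d" "finite \<F>" "card \<F> = N"
      "realization K homotopy_equivalent_space realization (bouquet \<F> (\<lambda>F :: nat set. F))"
    using nat[OF K] by blast
  obtain \<G> where \<G>: "\<forall>F\<in>\<G>. finite F \<and> card F = d" "finite \<G>" "card \<G> = N"
      "realization L homotopy_equivalent_space realization (bouquet \<G> (\<lambda>F :: nat set. F))"
    using nat[OF L] by blast
  obtain \<beta> where \<beta>: "bij_betw \<beta> \<F> \<G>" using \<F> \<G> finite_same_card_bij by metis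
  have "\<exists>g. bij_betw g F (\<beta> F)" if "F \<in> \<F>" for F
    using \<F>(1) \<G>(1) that \<beta> by (intro finite_same_card_bij) (auto simp: bij_betw_def)
  then obtain \<gamma> where "\<And>F. F \<in> \<F> \<Longrightarrow> bij_betw (\<gamma> F) F (\<beta> F)" by metis
  then obtain h where h: "inj_on h (\<Union>(bouquet \<F> (\<lambda>F. F)))" "(`) h ` bouquet \<F> (\<lambda>F. F) = bouquet \<G> (\<lambda>F. F)"
    using bouquet_relabel[OF \<beta>, of \<gamma> "\<lambda>F. F" "\<lambda>F. F"] by blast
  have "realization (bouquet \<F> (\<lambda>F. F)) homotopy_equivalent_space realization (bouquet \<G> (\<lambda>F. F))"
    using realization_relabel[OF _ h(1)] finite_Union_bouquet[of \<F> "\<lambda>F. F"] \<F>(1,2) h(2)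
    by (auto intro: homeomorphic_imp_homotopy_equivalent_space)
  then show ?thesis using \<F>(4) \<G>(4)
    by (meson homotopy_eqv_trans homotopy_equivalent_space_sym)
qed

section \<open>Complements in closure systems\<close>

text \<open>The order complex with the empty chain included, so that an empty poset gives
  \<open>{{}}\<close>, with one critical face and no vertices.\<close>

definition rel_chains :: "'a set \<Rightarrow> ('a \<Rightarrow> 'a \<Rightarrow> bool) \<Rightarrow> 'a set set" where
  "rel_chains A rel = {\<sigma>. finite \<sigma> \<and> \<sigma> \<subseteq> A \<and> (\<forall>x\<in>\<sigma>. \<forall>y\<in>\<sigma>. rel x y \<or> rel y x)}"

lemma geometric_realization_rel_chains: "geometric_realization A rel = realization (rel_chains A rel)"
proof -
  have "(\<forall>a b. t a \<noteq> 0 \<longrightarrow> t b \<noteq> 0 \<longrightarrow> rel a b \<or> rel b a) \<longleftrightarrow>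
      (\<forall>x\<in>{a. t a \<noteq> 0}. \<forall>y\<in>{a. t a \<noteq> 0}. rel x y \<or> rel y x)" for t :: "'a \<Rightarrow> real"
    by auto
  then show ?thesis
    unfolding geometric_realization_def realization_def realization_points_def rel_chains_def
    by (intro arg_cong[where f = "subtopology _"] Collect_cong) auto
qed

lemma simplicial_complex_rel_chains: "finite A \<Longrightarrow> simplicial_complex (rel_chains A rel)"
proof (rule simplicial_complexI)
  assume "finite A"
  moreover have "rel_chains A rel \<subseteq> Pow A" by (auto simp: rel_chains_def)
  ultimately show "finite (rel_chains A rel)" by (meson finite_Pow_iff finite_subset)
qed (auto simp: rel_chains_def intro: finite_subset)

lemma empty_in_rel_chains [simp]: "{} \<in> rel_chains A rel"
  by (simp add: rel_chains_def)

lemma rel_chains_empty [simp]: "rel_chains {} rel = {{}}"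
  by (auto simp: rel_chains_def)

lemma rel_chains_image:
  assumes "bij_betw h A B" "\<And>x y. x \<in> A \<Longrightarrow> y \<in> A \<Longrightarrow> rel' (h x) (h y) \<longleftrightarrow> rel x y"
  shows "(`) h ` rel_chains A rel = rel_chains B rel'"
proof (intro equalityI subsetI)
  fix \<sigma> assume "\<sigma> \<in> rel_chains B rel'"
  then have \<sigma>: "finite \<sigma>" "\<sigma> \<subseteq> h ` A" "\<forall>x\<in>\<sigma>. \<forall>y\<in>\<sigma>. rel' x y \<or> rel' y x"
    using assms(1) by (auto simp: rel_chains_def bij_betw_def)
  then obtain \<rho> where \<rho>: "\<rho> \<subseteq> A" "finite \<rho>" "\<sigma> = h ` \<rho>" by (meson finite_subset_image)
  have "rel x y \<or> rel y x" if "x \<in> \<rho>" "y \<in> \<rho>" for x y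
    using that \<rho> \<sigma>(3) assms(2)[of x y] assms(2)[of y x] by blast
  then have "\<rho> \<in> rel_chains A rel" using \<rho> by (simp add: rel_chains_def)
  then show "\<sigma> \<in> (`) h ` rel_chains A rel" using \<rho>(3) by blast
next
  fix \<sigma> assume "\<sigma> \<in> (`) h ` rel_chains A rel"
  then obtain \<rho> where "\<rho> \<in> rel_chains A rel" "\<sigma> = h ` \<rho>" by blast
  then show "\<sigma> \<in> rel_chains B rel'"
    using assms unfolding rel_chains_def bij_betw_def by (auto simp: subset_iff)
qed

lemma spherical_rel_chains_iso:
  assumes "spherical (rel_chains A rel) N d" "bij_betw h A B"
    "\<And>x y. x \<in> A \<Longrightarrow> y \<in> A \<Longrightarrow> rel' (h x) (h y) \<longleftrightarrow> rel x y"
  shows "spherical (rel_chains B rel') N d"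
proof -
  have "\<Union>(rel_chains A rel) \<subseteq> A" by (auto simp: rel_chains_def)
  then have "spherical ((`) h ` rel_chains A rel) N d"
    using assms(1,2) by (intro spherical_image) (auto simp: bij_betw_def intro: inj_on_subset)
  then show ?thesis using rel_chains_image[of h A B rel' rel] assms(2,3) by simp
qed

abbreviation subset_chains :: "'a set set \<Rightarrow> 'a set set set" where
  "subset_chains A \<equiv> rel_chains A (\<subseteq>)"

lemma subset_chainsI:
  assumes "finite \<sigma>" "\<And>x. x \<in> \<sigma> \<Longrightarrow> x \<in> A" "\<And>x y. x \<in> \<sigma> \<Longrightarrow> y \<in> \<sigma> \<Longrightarrow> x \<subseteq> y \<or> y \<subseteq> x"
  shows "\<sigma> \<in> subset_chains A"
  unfolding rel_chains_def using assms by simp blast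

lemma subset_chainsD:
  assumes "\<sigma> \<in> subset_chains A"
  shows "finite \<sigma>" "x \<in> \<sigma> \<Longrightarrow> x \<in> A" "x \<in> \<sigma> \<Longrightarrow> y \<in> \<sigma> \<Longrightarrow> x \<subseteq> y \<or> y \<subseteq> x"
  using assms unfolding rel_chains_def by auto

text \<open>A finite lattice in concrete form: the order is inclusion, meets are intersections, and
  joins exist because there is a top. With concrete sets, cardinality can serve as rank in
  patchworks. The two instances are the subgroups above \<open>K\<close> and the invariant
  equivalence relations above a kernel.\<close>

locale closure_system =
  fixes L :: "'a set set" and R T :: "'a set"
  assumes finite_L: "finite L" and finite_T: "finite T"
    and Int_closed: "x \<in> L \<Longrightarrow> y \<in> L \<Longrightarrow> x \<inter> y \<in> L"
    and bot: "R \<in> L" "x \<in> L \<Longrightarrow> R \<subseteq> x" and top: "T \<in> L" "x \<in> L \<Longrightarrow> x \<subseteq> T"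
begin

definition join :: "'a set \<Rightarrow> 'a set \<Rightarrow> 'a set" where
  "join x y = \<Inter>{z \<in> L. x \<subseteq> z \<and> y \<subseteq> z}"

lemma Inter_closed: "finite S \<Longrightarrow> S \<noteq> {} \<Longrightarrow> S \<subseteq> L \<Longrightarrow> \<Inter>S \<in> L"
  by (induction S rule: finite_ne_induct) (auto intro: Int_closed)

lemma join_closed: "x \<in> L \<Longrightarrow> y \<in> L \<Longrightarrow> join x y \<in> L"
  unfolding join_def using finite_L top by (intro Inter_closed) auto

definition complements :: "'a set \<Rightarrow> 'a set set" where
  "complements a = {c \<in> L. c \<inter> a = R \<and> join c a = T}"

text \<open>The matching behind the homotopy complementation formula of Bjoerner and Walker. For a chain, let
  \<open>y\<close> be its largest element with \<open>y \<inter> a = R\<close> (or \<open>R\<close>) and \<open>z\<close> its smallest element not below the join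
  \<open>u\<close> of \<open>y\<close> and \<open>a\<close> (or \<open>T\<close>). Toggling \<open>z \<inter> u\<close> changes neither \<open>y\<close> nor \<open>z\<close> and is possible unless \<open>y\<close> is a
  complement of \<open>a\<close>.\<close>

theorem spherical_complements:
  assumes a: "a \<in> L" "a \<noteq> R" "a \<noteq> T"
    and atom: "\<And>c x. c \<in> complements a \<Longrightarrow> x \<in> L \<Longrightarrow> R \<subset> x \<Longrightarrow> \<not> x \<subset> c"
    and cover: "\<And>c x. c \<in> complements a \<Longrightarrow> x \<in> L \<Longrightarrow> c \<subset> x \<Longrightarrow> x \<inter> a \<noteq> R"
    and sph: "\<And>c. c \<in> complements a \<Longrightarrow> spherical (subset_chains {x \<in> L. c \<subset> x \<and> x \<subset> T}) n d"
  shows "spherical (subset_chains {x \<in> L. R \<subset> x \<and> x \<subset> T}) (card (complements a) * n) (Suc d)"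
proof -
  let ?D = "subset_chains {x \<in> L. R \<subset> x \<and> x \<subset> T}"
  define Y where "Y = (\<lambda>\<sigma>. R \<union> \<Union>{x \<in> \<sigma>. x \<inter> a = R})"
  have finD: "finite ?D" using finite_L by (intro simplicial_complexD(1)[OF simplicial_complex_rel_chains]) auto
  have finL: "finite x" if "x \<in> L" for x using top(2)[OF that] finite_T finite_subset by blast
  have D: "finite \<sigma>" "\<sigma> \<subseteq> L" "\<And>x. x \<in> \<sigma> \<Longrightarrow> R \<subset> x \<and> x \<subset> T" "\<And>x y. x \<in> \<sigma> \<Longrightarrow> y \<in> \<sigma> \<Longrightarrow> x \<subseteq> y \<or> y \<subseteq> x"
    if "\<sigma> \<in> ?D" for \<sigma> using subset_chainsD[OF that] by auto
  have Ya: "Y \<sigma> \<inter> a = R" for \<sigma> using bot(2)[OF a(1)] by (auto simp: Y_def)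
  have Y_cases: "Y \<sigma> = R \<or> Y \<sigma> \<in> \<sigma>" if \<sigma>: "\<sigma> \<in> ?D" for \<sigma>
  proof (cases "{x \<in> \<sigma>. x \<inter> a = R} = {}")
    case False
    let ?S = "{x \<in> \<sigma>. x \<inter> a = R}"
    have "finite ?S" using D(1)[OF \<sigma>] by simp
    moreover have "subset.chain UNIV ?S" using D(4)[OF \<sigma>] by (auto simp: subset_chain_def)
    ultimately have "\<Union>?S \<in> ?S" using False by (intro Union_in_chain) auto
    moreover from this have "Y \<sigma> = \<Union>?S" using D(3)[OF \<sigma>, of "\<Union>?S"] by (auto simp: Y_def)
    ultimately show ?thesis by simp
  next
    case True
    then show ?thesis unfolding Y_def by (simp only: True) simp
  qed
  have YL: "Y \<sigma> \<in> L" if "\<sigma> \<in> ?D" for \<sigma> using Y_cases[OF that] bot(1) D(2)[OF that] by auto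
  have Y_mono: "Y \<sigma> \<subseteq> Y \<rho>" if "\<sigma> \<subseteq> \<rho>" for \<sigma> \<rho> using that by (auto simp: Y_def)
  have RC: "R \<notin> complements a"
  proof
    assume "R \<in> complements a"
    moreover have "join R a \<subseteq> a" using a(1) bot(2)[OF a(1)] by (auto simp: join_def)
    ultimately show False using a top(2)[OF a(1)] by (auto simp: complements_def)
  qed
  have T_notC: "T \<notin> complements a" using a top by (auto simp: complements_def)
  have rank: "Y \<sigma> = Y \<rho> \<or> card (Y \<sigma>) < card (Y \<rho>)" if "\<rho> \<in> ?D" "\<sigma> \<subseteq> \<rho>" for \<sigma> \<rho>
    using Y_mono[OF that(2)] finL[OF YL[OF that(1)]] by (metis psubsetI psubset_card_mono)
  \<comment> \<open>By \<open>cover\<close>, an element above a complement meets \<open>a\<close> in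
    more than the bottom, so no later element of the chain competes with \<open>c\<close>.\<close>
  have Y_complement: "Y \<rho> = c" if "c \<in> complements a" "\<rho> \<in> ?D" "c \<in> \<rho>" for c \<rho>
  proof -
    have c: "c \<in> L" "c \<inter> a = R" using that by (auto simp: complements_def)
    have "x \<subseteq> c" if "x \<in> \<rho>" "x \<inter> a = R" for x
      using cover[OF \<open>c \<in> complements a\<close>, of x] D(2,4)[OF \<open>\<rho> \<in> ?D\<close>] that \<open>c \<in> \<rho>\<close> by blast
    then show ?thesis using c that(3) bot(2)[OF c(1)] by (auto simp: Y_def)
  qed
  \<comment> \<open>By \<open>atom\<close> there is nothing strictly between the bottom and
    \<open>c\<close>, so a chain through \<open>c\<close> is \<open>c\<close> together with a chain
    above it.\<close>
  have fibre: "{\<sigma> \<in> ?D. Y \<sigma> = c} = (\<union>) {c} ` subset_chains {x \<in> L. c \<subset> x \<and> x \<subset> T}"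
    if c: "c \<in> complements a" for c
  proof (intro equalityI subsetI)
    fix \<sigma> assume "\<sigma> \<in> {\<sigma> \<in> ?D. Y \<sigma> = c}"
    then have \<sigma>: "\<sigma> \<in> ?D" "Y \<sigma> = c" by auto
    then have "c \<in> \<sigma>" using Y_cases[OF \<sigma>(1)] RC c by auto
    have "x \<in> L \<and> c \<subset> x \<and> x \<subset> T" if x: "x \<in> \<sigma>" "x \<noteq> c" for x
    proof -
      have "x \<in> L" "R \<subset> x" "x \<subset> T" using D(2,3)[OF \<sigma>(1)] x(1) by auto
      moreover from this have "\<not> x \<subset> c" using atom[OF c] by simp
      ultimately show ?thesis using D(4)[OF \<sigma>(1) x(1) \<open>c \<in> \<sigma>\<close>] x(2) by auto
    qed
    then have "\<sigma> - {c} \<in> subset_chains {x \<in> L. c \<subset> x \<and> x \<subset> T}"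
      using D(1,4)[OF \<sigma>(1)] by (auto simp: rel_chains_def)
    moreover have "\<sigma> = {c} \<union> (\<sigma> - {c})" using \<open>c \<in> \<sigma>\<close> by auto
    ultimately show "\<sigma> \<in> (\<union>) {c} ` subset_chains {x \<in> L. c \<subset> x \<and> x \<subset> T}" by blast
  next
    fix \<sigma> assume "\<sigma> \<in> (\<union>) {c} ` subset_chains {x \<in> L. c \<subset> x \<and> x \<subset> T}"
    then obtain \<rho> where \<rho>: "\<sigma> = {c} \<union> \<rho>" "\<rho> \<in> subset_chains {x \<in> L. c \<subset> x \<and> x \<subset> T}" by blast
    have c': "c \<in> L" "R \<subset> c" "c \<subset> T" using c RC T_notC bot top unfolding complements_def by blast+
    have "\<sigma> \<in> ?D"
    proof (rule subset_chainsI)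
      show "x \<in> {x \<in> L. R \<subset> x \<and> x \<subset> T}" if "x \<in> \<sigma>" for x
        using that \<rho>(1) subset_chainsD(2)[OF \<rho>(2), of x] c' by auto
      show "x \<subseteq> y \<or> y \<subseteq> x" if "x \<in> \<sigma>" "y \<in> \<sigma>" for x y
        using that \<rho>(1) subset_chainsD(2)[OF \<rho>(2), of x] subset_chainsD(2)[OF \<rho>(2), of y]
          subset_chainsD(3)[OF \<rho>(2), of x y] by auto
    qed (use \<rho>(1) subset_chainsD(1)[OF \<rho>(2)] in simp)
    moreover from this have "Y \<sigma> = c" using Y_complement[OF c] \<rho>(1) by simp
    ultimately show "\<sigma> \<in> {\<sigma> \<in> ?D. Y \<sigma> = c}" by simp
  qed
  have noncomplement: "erasable {\<sigma> \<in> ?D. Y \<sigma> = y}" if y: "y \<in> Y ` ?D" "y \<notin> complements a" for y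
  proof -
    define u where "u = join y a"
    have yL: "y \<in> L" "y \<inter> a = R" using y YL Ya by auto
    have uL: "u \<in> L" unfolding u_def by (rule join_closed[OF yL(1) a(1)])
    have yu: "y \<subseteq> u" and au: "a \<subseteq> u" by (auto simp: u_def join_def)
    \<comment> \<open>\<open>y\<close> meets \<open>a\<close> in the bottom in any case, so failing
      to be a complement means failing to span the top together with \<open>a\<close>. This keeps
      the toggled element \<open>?w\<close> strictly below \<open>T\<close>.\<close>
    have uT: "u \<noteq> T" using y(2) yL by (auto simp: complements_def u_def)
    define Z where "Z = (\<lambda>\<sigma>. T \<inter> \<Inter>{x \<in> \<sigma>. \<not> x \<subseteq> u})"
    have Z_cases: "Z \<sigma> = T \<or> Z \<sigma> \<in> {x \<in> \<sigma>. \<not> x \<subseteq> u}" if \<sigma>: "\<sigma> \<in> ?D" for \<sigma>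
    proof (cases "{x \<in> \<sigma>. \<not> x \<subseteq> u} = {}")
      case False
      let ?S = "{x \<in> \<sigma>. \<not> x \<subseteq> u}"
      have "finite ?S" using D(1)[OF \<sigma>] by simp
      moreover have "subset.chain UNIV ?S" using D(4)[OF \<sigma>] by (auto simp: subset_chain_def)
      ultimately have "\<Inter>?S \<in> ?S" using False by (intro Inter_in_chain) auto
      moreover from this have "Z \<sigma> = \<Inter>?S" using D(3)[OF \<sigma>, of "\<Inter>?S"] by (auto simp: Z_def)
      ultimately show ?thesis by simp
    next
      case True
      then show ?thesis unfolding Z_def by (simp only: True) simp
    qed
    have Z_anti: "Z \<rho> \<subseteq> Z \<sigma>" if "\<sigma> \<subseteq> \<rho>" for \<sigma> \<rho> using that by (auto simp: Z_def)
    have finZ: "finite (Z \<sigma>)" "card (Z \<sigma>) \<le> card T" for \<sigma>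
      using finite_T by (auto simp: Z_def intro: finite_subset card_mono)
    show ?thesis
    \<comment> \<open>\<open>Z\<close> shrinks as the chain grows, so its rank is the number of
      missing elements.\<close>
    proof (rule erasable_patchwork_toggle[where f = Z and rank = "\<lambda>z. card T - card z" and w = "\<lambda>z. z \<inter> u"])
      show "Z \<sigma> = Z \<rho> \<or> card T - card (Z \<sigma>) < card T - card (Z \<rho>)" if "\<sigma> \<subseteq> \<rho>" for \<sigma> \<rho>
      proof (cases "Z \<sigma> = Z \<rho>")
        case False
        then have "card (Z \<rho>) < card (Z \<sigma>)" using Z_anti[OF that] finZ by (intro psubset_card_mono) auto
        then show ?thesis using finZ(2)[of \<sigma>] by linarith
      qed simp
    next
      fix \<sigma> assume "\<sigma> \<in> {\<sigma> \<in> ?D. Y \<sigma> = y}"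
      then have \<sigma>: "\<sigma> \<in> ?D" "Y \<sigma> = y" by auto
      let ?z = "Z \<sigma>" and ?w = "Z \<sigma> \<inter> u"
      have zL: "?z \<in> L" using Z_cases[OF \<sigma>(1)] D(2)[OF \<sigma>(1)] top(1) by auto
      have wL: "?w \<in> L" by (rule Int_closed[OF zL uL])
      \<comment> \<open>A chain element that meets \<open>a\<close> in the bottom lies below
        \<open>Y \<sigma>\<close> and therefore below \<open>u\<close>, which \<open>?z\<close> does
        not.\<close>
      have "?z \<inter> a \<noteq> R"
      proof (cases "?z = T")
        case False
        then have z: "?z \<in> \<sigma>" "\<not> ?z \<subseteq> u" using Z_cases[OF \<sigma>(1)] by auto
        then show ?thesis using \<sigma>(2) yu by (auto simp: Y_def)
      qed (use a top(2)[OF a(1)] in auto)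
      moreover have "?w \<inter> a = ?z \<inter> a" using au by blast
      ultimately have wa: "?w \<inter> a \<noteq> R" by simp
      have wR: "R \<subset> ?w" using bot(2)[OF wL] wa bot(2)[OF a(1)] by blast
      have wT: "?w \<subset> T" using uT top(2)[OF uL] by blast
      have comp: "x \<subseteq> ?w \<or> ?w \<subseteq> x" if x: "x \<in> \<sigma>" for x
      proof (cases "x \<subseteq> u")
        case True
        have "x \<subseteq> ?z"
        proof (cases "?z = T")
          case False
          then have "?z \<in> \<sigma>" "\<not> ?z \<subseteq> u" using Z_cases[OF \<sigma>(1)] by auto
          then show ?thesis using D(4)[OF \<sigma>(1) x, of ?z] True by blast
        qed (use D(3)[OF \<sigma>(1) x] in auto)
        then show ?thesis using True by auto
      next
        case False
        then show ?thesis using x by (auto simp: Z_def)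
      qed
      \<comment> \<open>\<open>?w\<close> meets \<open>a\<close> in more than the bottom, hence is
        ignored by \<open>Y\<close>; it lies below \<open>u\<close>, hence is ignored by
        \<open>Z\<close>.\<close>
      have Ys: "Y (insert ?w \<sigma>) = Y \<sigma>" "Y (\<sigma> - {?w}) = Y \<sigma>" using wa by (auto simp: Y_def)
      have Zs: "Z (insert ?w \<sigma>) = Z \<sigma>" "Z (\<sigma> - {?w}) = Z \<sigma>" by (auto simp: Z_def)
      have "insert ?w \<sigma> \<in> ?D"
      proof (rule subset_chainsI)
        show "x \<subseteq> y \<or> y \<subseteq> x" if "x \<in> insert ?w \<sigma>" "y \<in> insert ?w \<sigma>" for x y
          using that comp[of x] comp[of y] D(4)[OF \<sigma>(1), of x y] by auto
        show "x \<in> {x \<in> L. R \<subset> x \<and> x \<subset> T}" if "x \<in> insert ?w \<sigma>" for x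
          using that wL wR wT subset_chainsD(2)[OF \<sigma>(1), of x] by auto
      qed (use D(1)[OF \<sigma>(1)] in simp)
      then show "insert ?w \<sigma> \<in> {\<sigma> \<in> ?D. Y \<sigma> = y} \<and> Z (insert ?w \<sigma>) = Z \<sigma>"
        using Ys Zs \<sigma>(2) by simp
      have "\<sigma> - {?w} \<in> ?D"
        by (rule subset_chainsI) (use subset_chainsD[OF \<sigma>(1)] in auto)
      then show "\<sigma> - {?w} \<in> {\<sigma> \<in> ?D. Y \<sigma> = y} \<and> Z (\<sigma> - {?w}) = Z \<sigma>"
        using Ys Zs \<sigma>(2) by simp
    qed (use finD in auto)
  qed
  have "spherical ?D (\<Sum>y\<in>Y ` ?D. if y \<in> complements a then n else 0) (Suc d)"
  proof (rule spherical_patchwork[where f = Y and rank = card, OF finD])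
    show "spherical {\<sigma> \<in> ?D. Y \<sigma> = y} (if y \<in> complements a then n else 0) (Suc d)"
      if y: "y \<in> Y ` ?D" for y
    proof (cases "y \<in> complements a")
      case True
      have "spherical ((\<union>) {y} ` subset_chains {x \<in> L. y \<subset> x \<and> x \<subset> T}) n (card {y} + d)"
        by (rule spherical_shift[OF sph[OF True]]) (auto simp: rel_chains_def)
      then show ?thesis using True fibre[OF True] by simp
    next
      case False
      then show ?thesis using noncomplement[OF y False] finD by (auto intro: spherical_erasable)
    qed
    show "Y \<rho> = Y \<sigma>" if "\<sigma> \<in> ?D" "\<rho> \<in> ?D" "\<sigma> \<subseteq> \<rho>" "(if Y \<sigma> \<in> complements a then n else 0) \<noteq> 0" for \<sigma> \<rho>
      using Y_cases[OF that(1)] RC that Y_complement[of "Y \<sigma>" \<rho>] by (auto split: if_splits)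
  qed (use rank in auto)
  moreover have "complements a \<subseteq> Y ` ?D"
  proof
    fix c assume c: "c \<in> complements a"
    have "{c} \<in> {\<sigma> \<in> ?D. Y \<sigma> = c}" unfolding fibre[OF c] by force
    then show "c \<in> Y ` ?D" by blast
  qed
  then have "(\<Sum>y\<in>Y ` ?D. if y \<in> complements a then n else 0) = card (complements a) * n"
    using finD by (simp add: sum.If_cases Int_absorb1 inf.absorb2)
  ultimately show ?thesis by simp
qed

end

section \<open>Subgroups of elementary abelian groups\<close>

locale elementary_abelian_group = comm_group G for G (structure) +
  fixes p :: nat
  assumes prime_p: "prime p" and finite_carrier: "finite (carrier G)"
    and exponent: "x \<in> carrier G \<Longrightarrow> x [^] p = \<one>"
begin

text \<open>The subgroup generated by \<open>H\<close> and \<open>g\<close>. Natural exponents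
  suffice, as the inverse of \<open>g\<close> is its power with exponent p - 1.\<close>

definition adjoin :: "'a set \<Rightarrow> 'a \<Rightarrow> 'a set" where
  "adjoin H g = {h \<otimes> g [^] i | h i. h \<in> H \<and> i \<in> (UNIV :: nat set)}"

lemma adjoinI: "h \<in> H \<Longrightarrow> h \<otimes> g [^] (i :: nat) \<in> adjoin H g"
  by (auto simp: adjoin_def)

lemma subset_adjoin: "subgroup H G \<Longrightarrow> g \<in> carrier G \<Longrightarrow> H \<subseteq> adjoin H g"
  using adjoinI[of _ H g 0] subgroup.mem_carrier by fastforce

lemma mem_adjoin: "subgroup H G \<Longrightarrow> g \<in> carrier G \<Longrightarrow> g \<in> adjoin H g"
  using adjoinI[of \<one> H g 1] subgroup.one_closed by fastforce

lemma subgroup_nat_pow: "subgroup H G \<Longrightarrow> g \<in> H \<Longrightarrow> g [^] (i :: nat) \<in> H"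
  by (induction i) (auto simp: subgroup.one_closed subgroup.m_closed)

lemma adjoin_least: "subgroup K G \<Longrightarrow> H \<subseteq> K \<Longrightarrow> g \<in> K \<Longrightarrow> adjoin H g \<subseteq> K"
  by (auto simp: adjoin_def intro!: subgroup.m_closed subgroup_nat_pow)

lemma subgroup_adjoin:
  assumes H: "subgroup H G" and g: "g \<in> carrier G"
  shows "subgroup (adjoin H g) G"
proof (rule subgroupI)
  show "adjoin H g \<subseteq> carrier G" using g subgroup.mem_carrier[OF H] by (auto simp: adjoin_def)
  show "adjoin H g \<noteq> {}" using mem_adjoin[OF assms] by auto
next
  fix a assume "a \<in> adjoin H g"
  then obtain h i where a: "a = h \<otimes> g [^] (i :: nat)" "h \<in> H" by (auto simp: adjoin_def)
  have hc: "h \<in> carrier G" using a subgroup.mem_carrier[OF H] by auto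
  have "g [^] i \<otimes> g [^] ((p - 1) * i) = g [^] (p * i)"
    using prime_gt_0_nat[OF prime_p] by (simp add: nat_pow_mult[OF g] algebra_simps)
  also have "\<dots> = \<one>" using exponent[OF g] g by (simp flip: nat_pow_pow)
  finally have "inv (g [^] i) = g [^] ((p - 1) * i)"
    using g by (intro inv_unique'[symmetric]) (auto simp: m_comm)
  then have "inv a = inv h \<otimes> g [^] ((p - 1) * i)"
    using a hc g by (simp add: inv_mult)
  then show "inv a \<in> adjoin H g" using subgroup.m_inv_closed[OF H a(2)] by (auto intro: adjoinI)
next
  fix a b assume "a \<in> adjoin H g" "b \<in> adjoin H g"
  then obtain h i h' i' where a: "a = h \<otimes> g [^] (i :: nat)" "h \<in> H" "b = h' \<otimes> g [^] (i' :: nat)" "h' \<in> H"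
    by (auto simp: adjoin_def)
  have "h \<in> carrier G" "h' \<in> carrier G" using a subgroup.mem_carrier[OF H] by auto
  then have "a \<otimes> b = (h \<otimes> h') \<otimes> g [^] (i + i')"
    using a g by (simp add: nat_pow_mult[symmetric] m_ac)
  then show "a \<otimes> b \<in> adjoin H g" using subgroup.m_closed[OF H] a by (auto intro: adjoinI)
qed

text \<open>Modulo p the exponent \<open>d\<close> has an inverse, so \<open>g\<close> is itself a
  power of \<open>g [^] d\<close>.\<close>

lemma power_mem_imp_mem:
  assumes H: "subgroup H G" and g: "g \<in> carrier G" and "g [^] (d :: nat) \<in> H" "\<not> p dvd d"
  shows "g \<in> H"
proof -
  have "coprime d p" using assms prime_p by (metis prime_imp_coprime coprime_commute)
  moreover have "d \<noteq> 0" using \<open>\<not> p dvd d\<close> by (metis dvd_0_right)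
  ultimately obtain x y where "d * x = p * y + 1" using bezout_nat[of d p] by (auto simp: coprime_iff_gcd_eq_1)
  then have "(g [^] d) [^] x = (g [^] p) [^] y \<otimes> g"
    using g by (simp add: nat_pow_pow flip: nat_pow_mult)
  then have "(g [^] d) [^] x = g" using exponent[OF g] g by simp
  then show ?thesis using subgroup_nat_pow[OF H assms(3), of x] by simp
qed

text \<open>Each element is h g^i for a unique i < p: two expressions with different exponents would
  put a power of \<open>g\<close> with exponent prime to p into \<open>H\<close>, and then
  \<open>g\<close> as well.\<close>

lemma card_adjoin:
  assumes H: "subgroup H G" and g: "g \<in> carrier G" "g \<notin> H"
  shows "card (adjoin H g) = p * card H"
proof -
  let ?f = "\<lambda>(h, i :: nat). h \<otimes> g [^] i"
  have "adjoin H g = ?f ` (H \<times> {..<p})"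
  proof (intro equalityI subsetI)
    fix x assume "x \<in> adjoin H g"
    then obtain h i where x: "x = h \<otimes> g [^] (i :: nat)" "h \<in> H" by (auto simp: adjoin_def)
    have "g [^] i = g [^] (p * (i div p) + i mod p)" by simp
    also have "\<dots> = (g [^] p) [^] (i div p) \<otimes> g [^] (i mod p)"
      using g by (simp only: nat_pow_pow nat_pow_mult)
    also have "\<dots> = g [^] (i mod p)" using exponent g by simp
    finally have "x = ?f (h, i mod p)" using x by simp
    moreover have "(h, i mod p) \<in> H \<times> {..<p}" using x prime_gt_0_nat[OF prime_p] by simp
    ultimately show "x \<in> ?f ` (H \<times> {..<p})" by blast
  qed (auto intro: adjoinI)
  moreover have "inj_on ?f (H \<times> {..<p})"
  proof -
    have "i = j \<and> h = h'" if *: "h \<in> H" "h' \<in> H" "i < p" "j < p" "h \<otimes> g [^] i = h' \<otimes> g [^] j" "i \<le> j" for h h' i j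
    proof -
      have c: "h \<in> carrier G" "h' \<in> carrier G" using * subgroup.mem_carrier[OF H] by auto
      have "h \<otimes> g [^] i = (h' \<otimes> g [^] (j - i)) \<otimes> g [^] i"
        using * c g by (simp add: m_assoc nat_pow_mult)
      then have e: "h = h' \<otimes> g [^] (j - i)" using c g by simp
      then have "g [^] (j - i) = inv h' \<otimes> h" using c g by (simp add: m_assoc[symmetric])
      then have "g [^] (j - i) \<in> H"
        using * subgroup.m_inv_closed[OF H] subgroup.m_closed[OF H] by simp
      then have "p dvd j - i" using power_mem_imp_mem[OF H g(1)] g(2) by blast
      then have "i = j" using * by (auto dest!: dvd_imp_le)
      then show ?thesis using e c by simp
    qed
    then show ?thesis unfolding inj_on_def by (auto; metis nle_le)
  qed
  ultimately show ?thesis by (simp add: card_image card_cartesian_product)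
qed

lemma card_subgroup_dvd:
  assumes "subgroup H G" "subgroup K G" "H \<subseteq> K"
  shows "card H dvd card K"
proof -
  have "group (G\<lparr>carrier := K\<rparr>)" "subgroup H (G\<lparr>carrier := K\<rparr>)"
    using assms subgroup_imp_group subgroup_incl by auto
  then have "card (rcosets\<^bsub>G\<lparr>carrier := K\<rparr>\<^esub> H) * card H = order (G\<lparr>carrier := K\<rparr>)"
    by (rule group.lagrange)
  then show ?thesis by (auto simp: order_def intro: dvd_triv_right dest: sym)
qed

lemma finite_subgroup: "subgroup H G \<Longrightarrow> finite H"
  using finite_carrier subgroup.subset finite_subset by blast

lemma card_subgroup_pos: "subgroup H G \<Longrightarrow> card H > 0"
  using finite_subgroup subgroup.one_closed card_gt_0_iff by blast

text \<open>A maximal proper subgroup above \<open>K\<close> generates everything together with any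
  further element, and \<open>card_adjoin\<close> then shows that its index is p.\<close>

lemma ex_maximal_subgroup:
  assumes "subgroup K G" "K \<noteq> carrier G"
  obtains a where "subgroup a G" "K \<subseteq> a" "p * card a = card (carrier G)"
    "\<And>g. g \<in> carrier G - a \<Longrightarrow> adjoin a g = carrier G"
proof -
  let ?S = "{a. subgroup a G \<and> K \<subseteq> a \<and> a \<noteq> carrier G}"
  have "?S \<subseteq> Pow (carrier G)" using subgroup.subset by auto
  then have "finite ?S" using finite_carrier by (meson finite_Pow_iff finite_subset)
  moreover have "K \<in> ?S" using assms by auto
  ultimately obtain a where a: "a \<in> ?S" and max: "\<And>b. b \<in> ?S \<Longrightarrow> a \<subseteq> b \<Longrightarrow> a = b"
    using finite_has_maximal[of ?S] by auto
  have full: "adjoin a g = carrier G" if g: "g \<in> carrier G - a" for g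
  proof (rule ccontr)
    assume "adjoin a g \<noteq> carrier G"
    then have "adjoin a g \<in> ?S" using subgroup_adjoin subset_adjoin[of a g] a g by auto
    then have "a = adjoin a g" using max subset_adjoin a g by auto
    then show False using mem_adjoin[of a g] a g by auto
  qed
  obtain g where g: "g \<in> carrier G - a" using a subgroup.subset by blast
  have "p * card a = card (carrier G)" using card_adjoin[of a g] full[OF g] a g by simp
  then show ?thesis using that[of a] a full by blast
qed

lemma closure_system_subgroups:
  assumes "subgroup K G"
  shows "closure_system {H. subgroup H G \<and> K \<subseteq> H} K (carrier G)"
proof
  have "{H. subgroup H G \<and> K \<subseteq> H} \<subseteq> Pow (carrier G)" using subgroup.subset by auto
  then show "finite {H. subgroup H G \<and> K \<subseteq> H}" using finite_carrier by (meson finite_Pow_iff finite_subset)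
qed (use assms finite_carrier subgroup_self subgroup.subset subgroups_Inter_pair in auto)

text \<open>The order complex of the proper nonzero subspaces of the vector space G/K over the field
  with p elements (the theorem of Solomon and Tits). In the induction step G/K has order p^(j+2); a
  hyperplane has p^(j+1) complementary lines, and above each line one dimension is gone.\<close>

theorem spherical_subgroups:
  assumes "subgroup K G" "card (carrier G) = p ^ Suc j * card K"
  shows "spherical (subset_chains {H. subgroup H G \<and> K \<subset> H \<and> H \<subset> carrier G}) (p ^ (Suc j choose 2)) j"
  using assms
proof (induction j arbitrary: K)
  case 0
  \<comment> \<open>The index of \<open>K\<close> is the prime p, so by Lagrange nothing lies
    strictly in between.\<close>
  have "\<not> (subgroup H G \<and> K \<subset> H \<and> H \<subset> carrier G)" for H
  proof
    assume H: "subgroup H G \<and> K \<subset> H \<and> H \<subset> carrier G"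
    obtain c where c: "card H = card K * c"
      using card_subgroup_dvd[of K H] H 0 by auto
    obtain e where e: "card (carrier G) = card H * e"
      using card_subgroup_dvd[of H "carrier G"] H subgroup_self by auto
    have lt: "card K < card H" "card H < card (carrier G)"
      using H finite_subgroup finite_carrier by (auto intro: psubset_card_mono)
    have "card (carrier G) = c * e * card K" using c e by simp
    then have "p * card K = c * e * card K" using 0(2) by simp
    moreover have "card K \<noteq> 0" using card_subgroup_pos[OF 0(1)] by simp
    ultimately have "p = c * e" using mult_right_cancel by blast
    then have "c = 1 \<or> e = 1" using prime_p by (metis prime_product)
    then show False using lt c e by auto
  qed
  then have *: "{H. subgroup H G \<and> K \<subset> H \<and> H \<subset> carrier G} = {}" by blast
  show ?case unfolding * using spherical_singleton[of "{}"] by (simp add: binomial_eq_0)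
next
  case (Suc j)
  note K = Suc.prems(1)
  let ?L = "{H. subgroup H G \<and> K \<subseteq> H}"
  interpret closure_system ?L K "carrier G" by (rule closure_system_subgroups[OF K])
  have p1: "p > 1" using prime_gt_1_nat[OF prime_p] .
  have Kpos: "card K > 0" by (rule card_subgroup_pos[OF K])
  have "p ^ Suc (Suc j) > 1" using p1 by (intro one_less_power) auto
  then have "K \<noteq> carrier G" using Suc.prems(2) Kpos by auto
  then obtain a where a: "subgroup a G" "K \<subseteq> a" "p * card a = card (carrier G)"
      and full: "\<And>g. g \<in> carrier G - a \<Longrightarrow> adjoin a g = carrier G"
    using ex_maximal_subgroup[OF K] by metis
  have carda: "card a = p ^ Suc j * card K" using a(3) Suc.prems(2) p1 by simp
  have aK: "a \<noteq> K"
  proof -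
    have "p ^ Suc j > 1" using p1 by (intro one_less_power) auto
    then show ?thesis using carda Kpos by auto
  qed
  have aG: "a \<noteq> carrier G" using a(3) card_subgroup_pos[OF a(1)] p1 by auto
  have decompose: "\<exists>h\<in>a. \<exists>i::nat. x = h \<otimes> g [^] i" if "g \<in> carrier G - a" "x \<in> carrier G" for g x
  proof -
    have "x \<in> adjoin a g" using full[OF that(1)] that(2) by simp
    then show ?thesis unfolding adjoin_def by blast
  qed
  \<comment> \<open>The modular law: writing x in \<open>c\<close> as h g^i with h in
    \<open>a\<close> puts h into \<open>c \<inter> a = K\<close>.\<close>
  have is_adjoin: "c = adjoin K g" if c: "subgroup c G" "K \<subseteq> c" "c \<inter> a = K" "g \<in> c" "g \<notin> a" for c g
  proof
    show "adjoin K g \<subseteq> c" using adjoin_least c by simp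
    show "c \<subseteq> adjoin K g"
    proof
      fix x assume x: "x \<in> c"
      have gG: "g \<in> carrier G" "x \<in> carrier G" using subgroup.mem_carrier[OF c(1)] c(4) x by auto
      then obtain h i where h: "h \<in> a" "x = h \<otimes> g [^] (i :: nat)" using decompose[of g x] c by auto
      have "h \<in> carrier G" using subgroup.mem_carrier[OF a(1)] h by auto
      then have "h = x \<otimes> inv (g [^] i)" using h gG by (simp add: m_assoc)
      moreover have "inv (g [^] i) \<in> c" using subgroup.m_inv_closed[OF c(1) subgroup_nat_pow[OF c(1,4)]] .
      ultimately have "h \<in> c" using x subgroup.m_closed[OF c(1)] by simp
      then show "x \<in> adjoin K g" using h c(3) by (auto intro: adjoinI)
    qed
  qed
  \<comment> \<open>A power of \<open>g\<close> that lies in \<open>a\<close> has exponent divisible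
    by p, hence is trivial; so adjoining \<open>g\<close> does not enlarge the meet with
    \<open>a\<close>.\<close>
  have adjoin_complement: "adjoin K g \<in> complements a" if g: "g \<in> carrier G - a" for g
  proof -
    have gG: "g \<in> carrier G" using g by simp
    have "adjoin K g \<inter> a = K"
    proof
      show "K \<subseteq> adjoin K g \<inter> a" using subset_adjoin[OF K gG] a by simp
      show "adjoin K g \<inter> a \<subseteq> K"
      proof
        fix x assume x: "x \<in> adjoin K g \<inter> a"
        then obtain h i where h: "h \<in> K" "x = h \<otimes> g [^] (i :: nat)" by (auto simp: adjoin_def)
        have "h \<in> carrier G" using subgroup.mem_carrier[OF K] h by auto
        then have "g [^] i = inv h \<otimes> x" using h gG by (simp add: m_assoc[symmetric])
        moreover have "h \<in> a" using h a(2) by auto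
        ultimately have "g [^] i \<in> a" using x subgroup.m_closed[OF a(1)] subgroup.m_inv_closed[OF a(1)] by simp
        then have "p dvd i" using power_mem_imp_mem[OF a(1) gG] g by blast
        then have "g [^] i = \<one>" using exponent[OF gG] gG by (auto simp flip: nat_pow_pow)
        then show "x \<in> K" using h \<open>h \<in> carrier G\<close> by simp
      qed
    qed
    moreover have "carrier G \<subseteq> join (adjoin K g) a"
    proof -
      have "carrier G \<subseteq> z" if "subgroup z G" "adjoin K g \<subseteq> z" "a \<subseteq> z" for z
      proof -
        have "g \<in> z" using mem_adjoin[OF K gG] that(2) by blast
        then show ?thesis using adjoin_least[OF that(1,3)] full[OF g] by blast
      qed
      then show ?thesis unfolding join_def by blast
    qed
    moreover have gL: "adjoin K g \<in> ?L" using subgroup_adjoin[OF K gG] subset_adjoin[OF K gG] by simp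
    moreover have "join (adjoin K g) a \<subseteq> carrier G"
      using a by (intro top(2) join_closed gL) simp
    ultimately show ?thesis unfolding complements_def by simp
  qed
  have complementD: "subgroup c G \<and> K \<subseteq> c \<and> c \<inter> a = K \<and> (\<exists>g. g \<in> c \<and> g \<notin> a)" if c: "c \<in> complements a" for c
  proof -
    have "\<not> c \<subseteq> a"
    proof
      assume "c \<subseteq> a"
      then have "join c a \<subseteq> a" using a by (auto simp: join_def)
      then show False using c aG subgroup.subset[OF a(1)] by (auto simp: complements_def)
    qed
    then show ?thesis using c by (auto simp: complements_def)
  qed
  have complement_eq: "c = adjoin K g" if "c \<in> complements a" "g \<in> c" "g \<notin> a" for c g
    using is_adjoin complementD that by blast
  have card_complement: "card c = p * card K" if c: "c \<in> complements a" for c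
  proof -
    obtain g where g: "subgroup c G" "g \<in> c" "g \<notin> a" using complementD[OF c] by blast
    have "card (adjoin K g) = p * card K"
      using g subgroup.mem_carrier[OF g(1)] a(2) by (intro card_adjoin[OF K]) auto
    then show ?thesis using complement_eq[OF c g(2,3)] by simp
  qed
  have "spherical (subset_chains {x \<in> ?L. K \<subset> x \<and> x \<subset> carrier G}) (card (complements a) * p ^ (Suc j choose 2)) (Suc j)"
  proof (rule spherical_complements)
    show "a \<in> ?L" "a \<noteq> K" "a \<noteq> carrier G" using a aK aG by auto
    show "\<not> x \<subset> c" if c: "c \<in> complements a" and x: "x \<in> ?L" "K \<subset> x" for c x
    proof
      assume "x \<subset> c"
      obtain g where g: "g \<in> x" "g \<notin> K" using x by blast
      then have "g \<in> c" "g \<notin> a" using \<open>x \<subset> c\<close> complementD[OF c] by auto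
      then have "c = adjoin K g" by (rule complement_eq[OF c])
      then have "c \<subseteq> x" using adjoin_least[of x K g] x g by simp
      then show False using \<open>x \<subset> c\<close> by simp
    qed
    show "x \<inter> a \<noteq> K" if c: "c \<in> complements a" and x: "x \<in> ?L" "c \<subset> x" for c x
    proof
      assume xa: "x \<inter> a = K"
      obtain g where g: "g \<in> c" "g \<notin> a" using complementD[OF c] by blast
      then have "x = adjoin K g" using is_adjoin[of x g] x xa by auto
      then show False using complement_eq[OF c g] x by simp
    qed
    show "spherical (subset_chains {x \<in> ?L. c \<subset> x \<and> x \<subset> carrier G}) (p ^ (Suc j choose 2)) j"
      if c: "c \<in> complements a" for c
    proof -
      have "{x \<in> ?L. c \<subset> x \<and> x \<subset> carrier G} = {x. subgroup x G \<and> c \<subset> x \<and> x \<subset> carrier G}"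
        using complementD[OF c] by auto
      moreover have "card (carrier G) = p ^ Suc j * card c"
        using card_complement[OF c] Suc.prems(2) by simp
      ultimately show ?thesis using Suc.IH[of c] complementD[OF c] by simp
    qed
  qed
  moreover have "card (complements a) = p ^ Suc j"
  proof -
    have fin: "finite (complements a)" using finite_L by (rule finite_subset[rotated]) (auto simp: complements_def)
    \<comment> \<open>Double counting: each \<open>g\<close> outside \<open>a\<close> lies in
      exactly one complement, namely \<open>adjoin K g\<close>, so the sets \<open>c - K\<close>
      partition what is outside \<open>a\<close>.\<close>
    have "card (carrier G - a) = (\<Sum>c\<in>complements a. card (c - K))"
    proof -
      have eq: "carrier G - a = (\<Union>c\<in>complements a. c - K)"
      proof (intro equalityI subsetI)
        fix g assume g: "g \<in> carrier G - a"
        then have "g \<in> adjoin K g - K" using mem_adjoin[OF K] a by auto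
        then show "g \<in> (\<Union>c\<in>complements a. c - K)" using adjoin_complement[OF g] by blast
      next
        fix g assume "g \<in> (\<Union>c\<in>complements a. c - K)"
        then obtain c where c: "c \<in> complements a" "g \<in> c" "g \<notin> K" by blast
        have "subgroup c G" "c \<inter> a = K" using complementD[OF c(1)] by auto
        then show "g \<in> carrier G - a" using subgroup.mem_carrier[of c G g] c(2,3) by auto
      qed
      have "(c - K) \<inter> (c' - K) = {}" if "c \<in> complements a" "c' \<in> complements a" "c \<noteq> c'" for c c'
      proof (rule ccontr)
        assume "(c - K) \<inter> (c' - K) \<noteq> {}"
        then obtain g where "g \<in> c" "g \<in> c'" "g \<notin> K" by blast
        moreover from this have "g \<notin> a" using complementD[OF that(1)] by auto
        ultimately show False using complement_eq that by metis
      qed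
      moreover have "finite (c - K)" if "c \<in> complements a" for c
        using finite_subgroup complementD[OF that] by auto
      ultimately show ?thesis unfolding eq using fin by (intro card_UN_disjoint) blast+
    qed
    also have "\<dots> = (\<Sum>c\<in>complements a. (p - 1) * card K)"
    proof (rule sum.cong)
      fix c assume c: "c \<in> complements a"
      have "card (c - K) = card c - card K"
        using complementD[OF c] finite_subgroup[OF K] by (simp add: card_Diff_subset)
      then show "card (c - K) = (p - 1) * card K" using card_complement[OF c] by (simp add: diff_mult_distrib)
    qed simp
    also have "\<dots> = card (complements a) * ((p - 1) * card K)" by simp
    finally have "card (carrier G - a) = card (complements a) * ((p - 1) * card K)" .
    moreover have "card (carrier G - a) = p * card a - card a"
      using a finite_subgroup[OF a(1)] subgroup.subset[OF a(1)] by (simp add: card_Diff_subset)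
    then have "card (carrier G - a) = p ^ Suc j * ((p - 1) * card K)"
      by (simp add: carda diff_mult_distrib diff_mult_distrib2 algebra_simps)
    ultimately show ?thesis using p1 Kpos by simp
  qed
  moreover have "{x \<in> ?L. K \<subset> x \<and> x \<subset> carrier G} = {H. subgroup H G \<and> K \<subset> H \<and> H \<subset> carrier G}" by auto
  \<comment> \<open>Pascal's rule: (j+2 choose 2) = (j+1) + (j+1 choose 2).\<close>
  moreover have "p ^ Suc j * p ^ (Suc j choose 2) = p ^ (Suc (Suc j) choose 2)"
    by (simp add: numeral_2_eq_2 flip: power_add)
  ultimately show ?case by simp
qed

end

section \<open>Invariant equivalence relations\<close>

definition kernel_on :: "'e set \<Rightarrow> ('e \<Rightarrow> 'b) \<Rightarrow> ('e \<times> 'e) set" where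
  "kernel_on E \<theta> = {(u, v). u \<in> E \<and> v \<in> E \<and> \<theta> u = \<theta> v}"

context group_action
begin

definition invariant_equivs :: "('c \<times> 'c) set set" where
  "invariant_equivs = {x. equiv E x \<and> (\<forall>g\<in>carrier G. \<forall>(u, v)\<in>x. (\<phi> g u, \<phi> g v) \<in> x)}"

lemma invariant_equivsD:
  assumes "x \<in> invariant_equivs"
  shows "x \<subseteq> E \<times> E" "u \<in> E \<Longrightarrow> (u, u) \<in> x" "(u, v) \<in> x \<Longrightarrow> (v, u) \<in> x"
    "(u, v) \<in> x \<Longrightarrow> (v, w) \<in> x \<Longrightarrow> (u, w) \<in> x" "g \<in> carrier G \<Longrightarrow> (u, v) \<in> x \<Longrightarrow> (\<phi> g u, \<phi> g v) \<in> x"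
  using assms unfolding invariant_equivs_def
  by (auto elim!: equivE simp: refl_on_def dest: symD transD)

lemma invariant_equivsI:
  assumes "x \<subseteq> E \<times> E" "\<And>u. u \<in> E \<Longrightarrow> (u, u) \<in> x" "\<And>u v. (u, v) \<in> x \<Longrightarrow> (v, u) \<in> x"
    "\<And>u v w. (u, v) \<in> x \<Longrightarrow> (v, w) \<in> x \<Longrightarrow> (u, w) \<in> x"
    "\<And>g u v. g \<in> carrier G \<Longrightarrow> (u, v) \<in> x \<Longrightarrow> (\<phi> g u, \<phi> g v) \<in> x"
  shows "x \<in> invariant_equivs"
proof -
  have "equiv E x" using assms(1-4) by (intro equivI refl_onI symI transI) blast+
  then show ?thesis using assms(5) by (auto simp: invariant_equivs_def)
qed

lemma finite_invariant_equivs: "finite E \<Longrightarrow> finite invariant_equivs"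
proof -
  assume "finite E"
  then have "finite (Pow (E \<times> E))" by simp
  moreover have "invariant_equivs \<subseteq> Pow (E \<times> E)" using invariant_equivsD(1) by auto
  ultimately show ?thesis by (rule finite_subset[rotated])
qed

lemma Int_invariant_equivs:
  "x \<in> invariant_equivs \<Longrightarrow> y \<in> invariant_equivs \<Longrightarrow> x \<inter> y \<in> invariant_equivs"
  by (rule invariant_equivsI) (auto dest: invariant_equivsD)

lemma top_invariant_equivs: "E \<times> E \<in> invariant_equivs"
  by (rule invariant_equivsI) (auto simp: element_image)

end

text \<open>The invariant equivalence relations with free quotient are encoded by equivariant surjections onto
  free \<open>G\<close>-sets of the form \<open>carrier G \<times> S\<close>.\<close>

locale equivariant_coordinates = group_action G E \<phi> for G (structure) and E and \<phi> +
  fixes \<theta> :: "'c \<Rightarrow> 'a \<times> 's" and S :: "'s set"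
  assumes finite_E: "finite E" and coordinates: "\<theta> ` E = carrier G \<times> S"
    and equivariant: "g \<in> carrier G \<Longrightarrow> u \<in> E \<Longrightarrow> \<theta> (\<phi> g u) = (g \<otimes> fst (\<theta> u), snd (\<theta> u))"
begin

sublocale group G
  using group_hom by (simp add: group_hom_def)

lemma coordinate_mem: "u \<in> E \<Longrightarrow> fst (\<theta> u) \<in> carrier G" "u \<in> E \<Longrightarrow> snd (\<theta> u) \<in> S"
  using coordinates by (metis imageI mem_Sigma_iff prod.collapse)+

lemma ex_coordinate:
  assumes "g \<in> carrier G" "s \<in> S"
  obtains u where "u \<in> E" "\<theta> u = (g, s)"
proof -
  have "(g, s) \<in> \<theta> ` E" using assms coordinates by simp
  then show ?thesis using that by auto
qed

lemma kernel_invariant: "kernel_on E \<theta> \<in> invariant_equivs"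
  by (rule invariant_equivsI) (auto simp: kernel_on_def element_image equivariant)

lemma closure_system_equivs:
  "closure_system {x \<in> invariant_equivs. kernel_on E \<theta> \<subseteq> x} (kernel_on E \<theta>) (E \<times> E)"
proof
  show "finite {x \<in> invariant_equivs. kernel_on E \<theta> \<subseteq> x}" using finite_invariant_equivs[OF finite_E] by simp
  show "finite (E \<times> E)" using finite_E by simp
qed (use kernel_invariant top_invariant_equivs Int_invariant_equivs invariant_equivsD(1) in \<open>auto simp: kernel_on_def\<close>)

text \<open>Right multiplication by \<open>h\<close> commutes with the left action, and every
  equivariant bijection from the orbit \<open>b\<close> to the orbit \<open>s\<close> has this form.
  The result is again a coordinate map, with \<open>b\<close> dropped, so that the construction can
  be iterated.\<close>

definition merge :: "'s \<Rightarrow> 's \<Rightarrow> 'a \<Rightarrow> 'c \<Rightarrow> 'a \<times> 's" where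
  "merge b s h u = (if snd (\<theta> u) = b then (fst (\<theta> u) \<otimes> h, s) else \<theta> u)"

lemma merge_coordinates:
  assumes "s \<in> S - {b}" "h \<in> carrier G"
  shows "equivariant_coordinates G E \<phi> (merge b s h) (S - {b})"
proof
  show "finite E" by (rule finite_E)
  show "merge b s h (\<phi> g u) = (g \<otimes> fst (merge b s h u), snd (merge b s h u))" if "g \<in> carrier G" "u \<in> E" for g u
    using that assms coordinate_mem[of u] by (simp add: merge_def equivariant m_assoc)
  show "merge b s h ` E = carrier G \<times> (S - {b})"
  proof (intro equalityI subsetI)
    fix x assume "x \<in> merge b s h ` E"
    then obtain u where "u \<in> E" "x = merge b s h u" by blast
    then show "x \<in> carrier G \<times> (S - {b})"
      using assms coordinate_mem[of u] by (cases "\<theta> u") (auto simp: merge_def)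
  next
    fix x assume "x \<in> carrier G \<times> (S - {b})"
    then obtain g t where x: "x = (g, t)" "g \<in> carrier G" "t \<in> S" "t \<noteq> b" by auto
    then obtain u where "u \<in> E" "\<theta> u = (g, t)" using ex_coordinate by blast
    then show "x \<in> merge b s h ` E" using x by (auto simp: merge_def intro!: image_eqI[of _ _ u])
  qed
qed

definition split_off :: "'s \<Rightarrow> ('c \<times> 'c) set" where
  "split_off b = {(u, v). u \<in> E \<and> v \<in> E \<and> (snd (\<theta> u) = b \<longleftrightarrow> snd (\<theta> v) = b)}"

lemma split_off_invariant: "split_off b \<in> invariant_equivs"
  by (rule invariant_equivsI) (auto simp: split_off_def element_image equivariant)

lemma kernel_le_split_off: "kernel_on E \<theta> \<subseteq> split_off b"
  by (auto simp: kernel_on_def split_off_def)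

lemma kernel_le_merge: "kernel_on E \<theta> \<subseteq> kernel_on E (merge b s h)"
  by (auto simp: kernel_on_def merge_def)

text \<open>The identifications added by a merge run between the orbits \<open>b\<close> and
  \<open>s\<close>, which \<open>split_off b\<close> keeps apart; within the orbit \<open>b\<close>
  right multiplication by \<open>h\<close> is injective and adds none.\<close>

lemma merge_Int_split_off:
  assumes "s \<noteq> b" "h \<in> carrier G"
  shows "kernel_on E (merge b s h) \<inter> split_off b = kernel_on E \<theta>"
proof
  show "kernel_on E \<theta> \<subseteq> kernel_on E (merge b s h) \<inter> split_off b"
    using kernel_le_merge kernel_le_split_off by blast
  show "kernel_on E (merge b s h) \<inter> split_off b \<subseteq> kernel_on E \<theta>"
  proof (rule subrelI)
    fix u v assume uv: "(u, v) \<in> kernel_on E (merge b s h) \<inter> split_off b"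
    then have E: "u \<in> E" "v \<in> E" by (auto simp: kernel_on_def)
    have "\<theta> u = \<theta> v"
      using uv assms coordinate_mem(1)[OF E(1)] coordinate_mem(1)[OF E(2)]
      by (auto simp: kernel_on_def split_off_def merge_def prod_eq_iff right_cancel split: if_splits)
    then show "(u, v) \<in> kernel_on E \<theta>" using E by (simp add: kernel_on_def)
  qed
qed

text \<open>The class of the point with coordinates (1, b) contains the one with coordinates (h, s),
  so the relation remembers \<open>s\<close> and \<open>h\<close>. Hence merges form an antichain
  and are counted by the pairs (s, h).\<close>

lemma merge_le_imp_eq:
  assumes "b \<in> S" "s \<in> S - {b}" "h \<in> carrier G" "t \<in> S - {b}" "k \<in> carrier G"
    and le: "kernel_on E (merge b s h) \<subseteq> kernel_on E (merge b t k)"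
  shows "s = t \<and> h = k"
proof -
  obtain u where u: "u \<in> E" "\<theta> u = (\<one>, b)" using ex_coordinate[of \<one> b] assms by auto
  obtain w where w: "w \<in> E" "\<theta> w = (h, s)" using ex_coordinate[of h s] assms by auto
  have "(u, w) \<in> kernel_on E (merge b s h)" using u w assms by (auto simp: kernel_on_def merge_def)
  then have "(u, w) \<in> kernel_on E (merge b t k)" using le by blast
  then show ?thesis using u w assms by (auto simp: kernel_on_def merge_def)
qed

text \<open>One pair of \<open>c\<close> between \<open>b\<close> and another orbit determines
  \<open>s\<close> and \<open>h\<close>, and invariance spreads it over the whole orbit
  \<open>b\<close>. Any further identification would compose with it to a pair inside
  \<open>split_off b\<close>, where \<open>c\<close> agrees with the kernel.\<close>

lemma complement_is_merge:
  assumes "b \<in> S" and c: "c \<in> invariant_equivs" "c \<inter> split_off b = kernel_on E \<theta>" "\<not> c \<subseteq> split_off b"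
  obtains s h where "s \<in> S - {b}" "h \<in> carrier G" "c = kernel_on E (merge b s h)"
proof -
  note cD = invariant_equivsD[OF c(1)]
  have "\<exists>u v. (u, v) \<in> c \<and> snd (\<theta> u) = b \<and> snd (\<theta> v) \<noteq> b"
  proof -
    obtain u v where "(u, v) \<in> c" "(u, v) \<notin> split_off b" using c(3) by auto
    moreover from this have "u \<in> E" "v \<in> E" using cD(1) by auto
    ultimately show ?thesis using cD(3) by (auto simp: split_off_def)
  qed
  then obtain u v where uv: "(u, v) \<in> c" "snd (\<theta> u) = b" "snd (\<theta> v) \<noteq> b" by blast
  then have E: "u \<in> E" "v \<in> E" using cD(1) by auto
  define s where "s = snd (\<theta> v)"
  define h where "h = inv (fst (\<theta> u)) \<otimes> fst (\<theta> v)"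
  have s: "s \<in> S - {b}" and h: "h \<in> carrier G" using coordinate_mem E uv by (auto simp: s_def h_def)
  have ker: "kernel_on E \<theta> \<subseteq> c" using c(2) by blast
  have across: "(u', v') \<in> c" if "u' \<in> E" "v' \<in> E" "snd (\<theta> u') = b" "\<theta> v' = (fst (\<theta> u') \<otimes> h, s)" for u' v'
  proof -
    \<comment> \<open>Translation by \<open>g\<close> carries the known pair to one with the same
      coordinates as u' and v'.\<close>
    define g where "g = fst (\<theta> u') \<otimes> inv (fst (\<theta> u))"
    have gG: "g \<in> carrier G" using coordinate_mem E that by (simp add: g_def)
    have "\<theta> (\<phi> g u) = \<theta> u'"
      using equivariant[OF gG E(1)] coordinate_mem E that uv by (simp add: g_def m_assoc prod_eq_iff)
    moreover have "\<theta> (\<phi> g v) = \<theta> v'"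
      using equivariant[OF gG E(2)] coordinate_mem E that uv by (simp add: g_def h_def s_def m_assoc prod_eq_iff)
    ultimately have "(u', \<phi> g u) \<in> kernel_on E \<theta>" "(\<phi> g v, v') \<in> kernel_on E \<theta>"
      using that E element_image gG by (auto simp: kernel_on_def)
    then show ?thesis using ker cD(5)[OF gG uv(1)] cD(4) by blast
  qed
  have "kernel_on E (merge b s h) \<subseteq> c"
  proof (rule subrelI)
    fix u' v' assume m: "(u', v') \<in> kernel_on E (merge b s h)"
    then have E': "u' \<in> E" "v' \<in> E" "merge b s h u' = merge b s h v'" by (auto simp: kernel_on_def)
    consider "(u', v') \<in> split_off b" | "snd (\<theta> u') = b" "snd (\<theta> v') \<noteq> b" | "snd (\<theta> u') \<noteq> b" "snd (\<theta> v') = b"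
      using E' by (auto simp: split_off_def)
    then show "(u', v') \<in> c"
    proof cases
      case 1
      then show ?thesis using merge_Int_split_off[of s b h] s h m ker by auto
    next
      case 2
      then show ?thesis using across[of u' v'] E' by (simp add: merge_def)
    next
      case 3
      then show ?thesis using across[of v' u'] E' cD(3) by (simp add: merge_def)
    qed
  qed
  moreover have "c \<subseteq> kernel_on E (merge b s h)"
  proof -
    have ac: "merge b s h u' = merge b s h v'" if c': "(u', v') \<in> c" "snd (\<theta> u') = b" "snd (\<theta> v') \<noteq> b" for u' v'
    proof -
      have E': "u' \<in> E" "v' \<in> E" using cD(1) c' by auto
      \<comment> \<open>\<open>w\<close> is a point to which the merge attaches u'. As
        \<open>c\<close> relates it to v' and both lie off \<open>b\<close>, their coordinates
        agree.\<close>
      obtain w where w: "w \<in> E" "\<theta> w = (fst (\<theta> u') \<otimes> h, s)"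
        using ex_coordinate[of "fst (\<theta> u') \<otimes> h" s] s h coordinate_mem(1)[OF E'(1)] by auto
      have "(w, v') \<in> c" using across[OF E'(1) w(1) c'(2) w(2)] c'(1) cD(3,4) by blast
      moreover have "(w, v') \<in> split_off b" using w E' c' s by (simp add: split_off_def)
      ultimately have "\<theta> w = \<theta> v'" using c(2) by (auto simp: kernel_on_def)
      then show ?thesis using w c' by (simp add: merge_def)
    qed
    show ?thesis
    proof (rule subrelI)
      fix u' v' assume c': "(u', v') \<in> c"
      then have E': "u' \<in> E" "v' \<in> E" using cD(1) by auto
      consider "(u', v') \<in> split_off b" | "snd (\<theta> u') = b" "snd (\<theta> v') \<noteq> b" | "snd (\<theta> u') \<noteq> b" "snd (\<theta> v') = b"
        using E' by (auto simp: split_off_def)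
      then show "(u', v') \<in> kernel_on E (merge b s h)"
      proof cases
        case 1
        then show ?thesis using c(2) c' kernel_le_merge[of b s h] by blast
      next
        case 2
        then show ?thesis using ac[OF c'] E' by (simp add: kernel_on_def)
      next
        case 3
        then show ?thesis using ac[OF cD(3)[OF c']] E' by (simp add: kernel_on_def)
      qed
    qed
  qed
  ultimately show ?thesis using that s h by blast
qed

text \<open>The complements of \<open>split_off b\<close> are the merges of \<open>b\<close> into
  another orbit, one for each pair (s, h). The hypothesis \<open>big\<close> says that at least two
  points of the quotient lie off \<open>b\<close>; otherwise \<open>split_off b\<close> would be the
  bottom.\<close>

lemma spherical_step:
  assumes b: "b \<in> S" "S - {b} \<noteq> {}" and big: "1 < order G * card (S - {b})"
    and sph: "\<And>s h. s \<in> S - {b} \<Longrightarrow> h \<in> carrier G \<Longrightarrow>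
      spherical (subset_chains {x \<in> invariant_equivs. kernel_on E (merge b s h) \<subset> x \<and> x \<subset> E \<times> E}) n d"
  shows "spherical (subset_chains {x \<in> invariant_equivs. kernel_on E \<theta> \<subset> x \<and> x \<subset> E \<times> E})
    (card (S - {b}) * order G * n) (Suc d)"
proof -
  let ?L = "{x \<in> invariant_equivs. kernel_on E \<theta> \<subseteq> x}"
  interpret L: closure_system ?L "kernel_on E \<theta>" "E \<times> E" by (rule closure_system_equivs)
  let ?a = "split_off b" and ?C = "(\<lambda>(s, h). kernel_on E (merge b s h)) ` ((S - {b}) \<times> carrier G)"
  have aT: "?a \<noteq> E \<times> E"
  proof -
    obtain s where s: "s \<in> S" "s \<noteq> b" using b by blast
    obtain u v where "u \<in> E" "\<theta> u = (\<one>, b)" "v \<in> E" "\<theta> v = (\<one>, s)"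
      using ex_coordinate[of \<one> b] ex_coordinate[of \<one> s] b s by (metis one_closed)
    then have "(u, v) \<in> E \<times> E - ?a" using s by (auto simp: split_off_def)
    then show ?thesis by blast
  qed
  have aR: "?a \<noteq> kernel_on E \<theta>"
  proof -
    have "1 < card (carrier G \<times> (S - {b}))" using big by (simp add: card_cartesian_product order_def)
    then obtain x y where xy: "x \<in> carrier G \<times> (S - {b})" "y \<in> carrier G \<times> (S - {b})" "x \<noteq> y"
      by (metis One_nat_def card_le_Suc0_iff_eq card.infinite not_less not_one_less_zero zero_less_one le_zero_eq less_or_eq_imp_le)
    then obtain u v where "u \<in> E" "\<theta> u = x" "v \<in> E" "\<theta> v = y"
      using ex_coordinate by (metis DiffD1 SigmaE)
    then have "(u, v) \<in> ?a - kernel_on E \<theta>" using xy by (auto simp: split_off_def kernel_on_def)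
    then show ?thesis by blast
  qed
  have complement_iff: "c \<in> L.complements ?a \<longleftrightarrow> c \<in> ?C" for c
  proof
    assume c: "c \<in> L.complements ?a"
    have "\<not> c \<subseteq> ?a"
    proof
      assume "c \<subseteq> ?a"
      then have "L.join c ?a \<subseteq> ?a" using split_off_invariant kernel_le_split_off by (auto simp: L.join_def)
      then show False using c aT by (auto simp: L.complements_def split_off_def)
    qed
    then obtain s h where "s \<in> S - {b}" "h \<in> carrier G" "c = kernel_on E (merge b s h)"
      using complement_is_merge[OF b(1), of c] c by (auto simp: L.complements_def)
    then show "c \<in> ?C" by blast
  next
    assume "c \<in> ?C"
    then obtain s h where sh: "s \<in> S - {b}" "h \<in> carrier G" "c = kernel_on E (merge b s h)" by blast
    have cL: "c \<in> ?L"
      using equivariant_coordinates.kernel_invariant[OF merge_coordinates[OF sh(1,2)]] kernel_le_merge sh(3) by simp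
    have aL: "?a \<in> ?L" using split_off_invariant kernel_le_split_off by simp
    \<comment> \<open>From a point over \<open>b\<close> the relation \<open>c\<close> leads to some
      point off \<open>b\<close>, and \<open>split_off b\<close> leads from there to every other
      point off \<open>b\<close>.\<close>
    have "E \<times> E \<subseteq> z" if z: "z \<in> invariant_equivs" "c \<subseteq> z" "?a \<subseteq> z" for z
    proof (rule subrelI)
      note zD = invariant_equivsD[OF z(1)]
      have across: "(u, v) \<in> z" if uv: "u \<in> E" "v \<in> E" "snd (\<theta> u) = b" "snd (\<theta> v) \<noteq> b" for u v
      proof -
        obtain w where w: "w \<in> E" "\<theta> w = (fst (\<theta> u) \<otimes> h, s)"
          using ex_coordinate[of "fst (\<theta> u) \<otimes> h" s] sh coordinate_mem(1)[OF uv(1)] by auto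
        have "(u, w) \<in> c" using uv w sh by (auto simp: kernel_on_def merge_def)
        moreover have "(w, v) \<in> ?a" using uv w sh by (auto simp: split_off_def)
        ultimately show ?thesis using z zD(4) by blast
      qed
      fix u v assume "(u, v) \<in> E \<times> E"
      then have uv: "u \<in> E" "v \<in> E" by auto
      consider "(u, v) \<in> ?a" | "snd (\<theta> u) = b" "snd (\<theta> v) \<noteq> b" | "snd (\<theta> u) \<noteq> b" "snd (\<theta> v) = b"
        using uv by (auto simp: split_off_def)
      then show "(u, v) \<in> z" using across uv zD(3) z(3) by cases auto
    qed
    then have "E \<times> E \<subseteq> L.join c ?a" unfolding L.join_def by blast
    moreover have "L.join c ?a \<subseteq> E \<times> E" using L.top(2)[OF L.join_closed[OF cL aL]] .
    moreover have "c \<inter> ?a = kernel_on E \<theta>" using merge_Int_split_off[of s b h] sh by auto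
    ultimately show "c \<in> L.complements ?a"
      unfolding L.complements_def using cL by (intro CollectI conjI) simp_all
  qed
  have L_merge: "\<exists>s h. s \<in> S - {b} \<and> h \<in> carrier G \<and> x = kernel_on E (merge b s h)"
    if "x \<in> ?L" "x \<inter> ?a = kernel_on E \<theta>" "\<not> x \<subseteq> ?a" for x
  proof -
    have x: "x \<in> invariant_equivs" using that by simp
    show ?thesis by (rule complement_is_merge[OF b(1) x that(2,3)]) blast
  qed
  have "spherical (subset_chains {x \<in> ?L. kernel_on E \<theta> \<subset> x \<and> x \<subset> E \<times> E}) (card (L.complements ?a) * n) (Suc d)"
  proof (rule L.spherical_complements)
    show "?a \<in> ?L" "?a \<noteq> kernel_on E \<theta>" "?a \<noteq> E \<times> E"
      using split_off_invariant kernel_le_split_off aR aT by auto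
    fix c assume c: "c \<in> L.complements ?a"
    then obtain s h where sh: "s \<in> S - {b}" "h \<in> carrier G" "c = kernel_on E (merge b s h)"
      using complement_iff by auto
    have c_a: "c \<inter> ?a = kernel_on E \<theta>" using merge_Int_split_off[of s b h] sh by auto
    show "\<not> x \<subset> c" if x: "x \<in> ?L" "kernel_on E \<theta> \<subset> x" for x
    proof
      assume xc: "x \<subset> c"
      then have xa: "x \<inter> ?a = kernel_on E \<theta>" using c_a x kernel_le_split_off by blast
      then have "\<not> x \<subseteq> ?a" using x by blast
      then obtain t k where "t \<in> S - {b}" "k \<in> carrier G" "x = kernel_on E (merge b t k)"
        using L_merge[OF x(1) xa] by blast
      then show False using merge_le_imp_eq[OF b(1), of t k s h] xc sh by auto
    qed
    show "x \<inter> ?a \<noteq> kernel_on E \<theta>" if x: "x \<in> ?L" "c \<subset> x" for x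
    proof
      assume xa: "x \<inter> ?a = kernel_on E \<theta>"
      have "\<not> x \<subseteq> ?a"
      proof
        assume "x \<subseteq> ?a"
        then have "x = kernel_on E \<theta>" using xa by blast
        then show False using x(2) sh(3) kernel_le_merge by blast
      qed
      then obtain t k where "t \<in> S - {b}" "k \<in> carrier G" "x = kernel_on E (merge b t k)"
        using L_merge[OF x(1) xa] by blast
      then show False using merge_le_imp_eq[OF b(1), of s h t k] x sh by auto
    qed
    show "spherical (subset_chains {x \<in> ?L. c \<subset> x \<and> x \<subset> E \<times> E}) n d"
    proof -
      have "{x \<in> ?L. c \<subset> x \<and> x \<subset> E \<times> E} = {x \<in> invariant_equivs. kernel_on E (merge b s h) \<subset> x \<and> x \<subset> E \<times> E}"
        using order_trans[OF kernel_le_merge[of b s h] psubset_imp_subset] unfolding sh(3)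
        by (intro Collect_cong) auto
      then show ?thesis using sph[OF sh(1,2)] by simp
    qed
  qed
  moreover have "card (L.complements ?a) = card (S - {b}) * order G"
  proof -
    have "L.complements ?a = ?C" using complement_iff by blast
    moreover have "inj_on (\<lambda>(s, h). kernel_on E (merge b s h)) ((S - {b}) \<times> carrier G)"
      by (rule inj_onI) (use merge_le_imp_eq[OF b(1)] in auto)
    ultimately show ?thesis by (simp add: card_image card_cartesian_product order_def)
  qed
  moreover have "{x \<in> ?L. kernel_on E \<theta> \<subset> x \<and> x \<subset> E \<times> E} = {x \<in> invariant_equivs. kernel_on E \<theta> \<subset> x \<and> x \<subset> E \<times> E}"
    by auto
  ultimately show ?thesis by simp
qed

text \<open>With one orbit, the quotient by the kernel is a copy of \<open>G\<close> under left
  translation, and its invariant equivalence relations are the partitions into left cosets of a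
  subgroup.\<close>

lemma spherical_transitive:
  assumes S: "S = {s}" and sph: "spherical (subset_chains {H. subgroup H G \<and> {\<one>} \<subset> H \<and> H \<subset> carrier G}) N d"
  shows "spherical (subset_chains {x \<in> invariant_equivs. kernel_on E \<theta> \<subset> x \<and> x \<subset> E \<times> E}) N d"
proof -
  define X where "X = (\<lambda>H. {(u, v). u \<in> E \<and> v \<in> E \<and> inv (fst (\<theta> u)) \<otimes> fst (\<theta> v) \<in> H})"
  obtain e where e: "e \<in> E" "\<theta> e = (\<one>, s)" using ex_coordinate[of \<one> s] S by auto
  note mem = coordinate_mem(1)
  have snd: "snd (\<theta> u) = s" if "u \<in> E" for u using coordinate_mem(2)[OF that] S by simp
  have X_inv: "X H \<in> invariant_equivs" if H: "subgroup H G" for H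
  proof (rule invariant_equivsI)
    show "(u, u) \<in> X H" if "u \<in> E" for u using that mem subgroup.one_closed[OF H] by (simp add: X_def)
    show "(v, u) \<in> X H" if "(u, v) \<in> X H" for u v
    proof -
      have "inv (inv (fst (\<theta> u)) \<otimes> fst (\<theta> v)) \<in> H" "u \<in> E" "v \<in> E"
        using that subgroup.m_inv_closed[OF H] by (auto simp: X_def)
      then show ?thesis using mem by (simp add: X_def inv_mult_group)
    qed
    show "(u, w) \<in> X H" if "(u, v) \<in> X H" "(v, w) \<in> X H" for u v w
    proof -
      have E: "u \<in> E" "v \<in> E" "w \<in> E" using that by (auto simp: X_def)
      have "(inv (fst (\<theta> u)) \<otimes> fst (\<theta> v)) \<otimes> (inv (fst (\<theta> v)) \<otimes> fst (\<theta> w)) \<in> H"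
        using that subgroup.m_closed[OF H] by (auto simp: X_def)
      also have "(inv (fst (\<theta> u)) \<otimes> fst (\<theta> v)) \<otimes> (inv (fst (\<theta> v)) \<otimes> fst (\<theta> w)) = inv (fst (\<theta> u)) \<otimes> fst (\<theta> w)"
        using mem[OF E(1)] mem[OF E(2)] mem[OF E(3)] by (metis inv_closed inv_solve_left m_assoc m_closed)
      finally show ?thesis using E by (simp add: X_def)
    qed
    show "(\<phi> g u, \<phi> g v) \<in> X H" if g: "g \<in> carrier G" and uv: "(u, v) \<in> X H" for g u v
    proof -
      have E: "u \<in> E" "v \<in> E" using uv by (auto simp: X_def)
      have "inv (g \<otimes> fst (\<theta> u)) \<otimes> (g \<otimes> fst (\<theta> v)) = inv (fst (\<theta> u)) \<otimes> fst (\<theta> v)"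
        using g mem[OF E(1)] mem[OF E(2)] by (simp add: inv_mult_group m_assoc inv_solve_left')
      then show ?thesis using uv E g by (auto simp: X_def equivariant element_image)
    qed
  qed (auto simp: X_def)
  have X_mono: "X H \<subseteq> X K \<longleftrightarrow> H \<subseteq> K" if "subgroup H G" for H K
  proof
    assume le: "X H \<subseteq> X K"
    show "H \<subseteq> K"
    proof
      fix g assume g: "g \<in> H"
      then have gG: "g \<in> carrier G" by (rule subgroup.mem_carrier[OF \<open>subgroup H G\<close>])
      then obtain u where u: "u \<in> E" "\<theta> u = (g, s)" using ex_coordinate[of g s] S by auto
      then have "(e, u) \<in> X H" using e g gG by (simp add: X_def)
      then have "(e, u) \<in> X K" using le by blast
      then show "g \<in> K" using e u gG by (simp add: X_def)
    qed
  qed (auto simp: X_def)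
  have X_one: "X {\<one>} = kernel_on E \<theta>"
  proof -
    have "inv (fst (\<theta> u)) \<otimes> fst (\<theta> v) = \<one> \<longleftrightarrow> \<theta> u = \<theta> v" if "u \<in> E" "v \<in> E" for u v
      using that mem[OF that(1)] mem[OF that(2)] snd[OF that(1)] snd[OF that(2)]
      by (metis inv_closed inv_equality inv_inv l_inv prod_eq_iff)
    then show ?thesis unfolding X_def kernel_on_def by auto
  qed
  have X_top: "X (carrier G) = E \<times> E" using mem by (auto simp: X_def)
  have X_surj: "\<exists>H. subgroup H G \<and> x = X H" if x: "x \<in> invariant_equivs" "kernel_on E \<theta> \<subseteq> x" for x
  proof -
    note xD = invariant_equivsD[OF x(1)]
    \<comment> \<open>The subgroup is recovered as the set of elements that keep the base point
      \<open>e\<close> within its class.\<close>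
    define H where "H = {g \<in> carrier G. (e, \<phi> g e) \<in> x}"
    have one: "\<phi> \<one> u = u" if "u \<in> E" for u using id_eq_one that by (metis restrict_apply')
    have comp: "\<phi> (g \<otimes> h) u = \<phi> g (\<phi> h u)" if "g \<in> carrier G" "h \<in> carrier G" "u \<in> E" for g h u
      using composition_rule that by simp
    have shift: "(\<phi> a e, \<phi> b e) \<in> x \<longleftrightarrow> (e, \<phi> (inv a \<otimes> b) e) \<in> x" if "a \<in> carrier G" "b \<in> carrier G" for a b
    proof
      assume "(\<phi> a e, \<phi> b e) \<in> x"
      then have "(\<phi> (inv a) (\<phi> a e), \<phi> (inv a) (\<phi> b e)) \<in> x" using xD(5) that by simp
      then show "(e, \<phi> (inv a \<otimes> b) e) \<in> x" using that e one comp[of "inv a" a e] comp[of "inv a" b e] by simp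
    next
      assume "(e, \<phi> (inv a \<otimes> b) e) \<in> x"
      then have "(\<phi> a e, \<phi> a (\<phi> (inv a \<otimes> b) e)) \<in> x" using xD(5) that by simp
      moreover have "a \<otimes> (inv a \<otimes> b) = b" using that by (simp add: m_assoc[symmetric])
      ultimately show "(\<phi> a e, \<phi> b e) \<in> x" using that e comp[of a "inv a \<otimes> b" e] by simp
    qed
    have "subgroup H G"
    proof (rule subgroupI)
      have "\<one> \<in> H" using one xD(2) e by (simp add: H_def)
      then show "H \<noteq> {}" by blast
      show "inv a \<in> H" if "a \<in> H" for a
        using that shift[of a \<one>] one e xD(3) by (simp add: H_def)
      show "a \<otimes> b \<in> H" if "a \<in> H" "b \<in> H" for a b
      proof -
        have ab: "a \<in> carrier G" "b \<in> carrier G" "(e, \<phi> a e) \<in> x" "(e, \<phi> b e) \<in> x" using that by (auto simp: H_def)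
        then have "(\<phi> a e, \<phi> a (\<phi> b e)) \<in> x" using xD(5) by simp
        then have "(e, \<phi> (a \<otimes> b) e) \<in> x" using xD(4)[OF ab(3)] comp ab e by simp
        then show ?thesis using ab by (simp add: H_def)
      qed
    qed (auto simp: H_def)
    moreover have "x = X H"
    proof -
      have "(u, v) \<in> x \<longleftrightarrow> (u, v) \<in> X H" if E: "u \<in> E" "v \<in> E" for u v
      proof -
        have ker: "(w, \<phi> (fst (\<theta> w)) e) \<in> x" if "w \<in> E" for w
        proof -
          have "\<theta> (\<phi> (fst (\<theta> w)) e) = \<theta> w"
            using equivariant[of "fst (\<theta> w)" e] mem[OF that] e snd[OF that] by (simp add: prod_eq_iff)
          then have "(w, \<phi> (fst (\<theta> w)) e) \<in> kernel_on E \<theta>"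
            using that e element_image mem[OF that] by (simp add: kernel_on_def)
          then show ?thesis using x(2) by blast
        qed
        have "(u, v) \<in> x \<longleftrightarrow> (\<phi> (fst (\<theta> u)) e, \<phi> (fst (\<theta> v)) e) \<in> x"
          using ker[OF E(1)] ker[OF E(2)] xD(3,4) by meson
        also have "\<dots> \<longleftrightarrow> (u, v) \<in> X H"
          using shift[OF mem[OF E(1)] mem[OF E(2)]] mem[OF E(1)] mem[OF E(2)] E by (simp add: X_def H_def)
        finally show ?thesis .
      qed
      moreover have "x \<subseteq> E \<times> E" "X H \<subseteq> E \<times> E" using xD(1) by (auto simp: X_def)
      ultimately show ?thesis by auto
    qed
    ultimately show ?thesis by blast
  qed
  have strict: "X H \<subset> X K \<longleftrightarrow> H \<subset> K" if "subgroup H G" "subgroup K G" for H K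
    using X_mono that by (simp add: less_le_not_le)
  have one_sub: "subgroup {\<one>} G" by (rule triv_subgroup)
  have bij: "bij_betw X {H. subgroup H G \<and> {\<one>} \<subset> H \<and> H \<subset> carrier G}
      {x \<in> invariant_equivs. kernel_on E \<theta> \<subset> x \<and> x \<subset> E \<times> E}"
  proof (rule bij_betwI')
    show "(X H = X K) = (H = K)" if "H \<in> {H. subgroup H G \<and> {\<one>} \<subset> H \<and> H \<subset> carrier G}"
       "K \<in> {H. subgroup H G \<and> {\<one>} \<subset> H \<and> H \<subset> carrier G}" for H K
      using X_mono[of H K] X_mono[of K H] that by auto
    show "X H \<in> {x \<in> invariant_equivs. kernel_on E \<theta> \<subset> x \<and> x \<subset> E \<times> E}"
      if "H \<in> {H. subgroup H G \<and> {\<one>} \<subset> H \<and> H \<subset> carrier G}" for H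
      using strict[OF one_sub, of H] strict[OF _ subgroup_self, of H] X_inv that X_one X_top by simp
    show "\<exists>H\<in>{H. subgroup H G \<and> {\<one>} \<subset> H \<and> H \<subset> carrier G}. x = X H"
      if x: "x \<in> {x \<in> invariant_equivs. kernel_on E \<theta> \<subset> x \<and> x \<subset> E \<times> E}" for x
    proof -
      obtain H where H: "subgroup H G" "x = X H" using X_surj[of x] x by auto
      then have "{\<one>} \<subset> H" "H \<subset> carrier G"
        using strict[OF one_sub H(1)] strict[OF H(1) subgroup_self] x X_one X_top by simp_all
      then show ?thesis using H by blast
    qed
  qed
  show ?thesis
    by (rule spherical_rel_chains_iso[OF sph bij]) (use X_mono in auto)
qed

end

text \<open>Each step contributes the number of remaining orbits times p^(j+1), so m + 1 orbits
  yield \<open>fact m\<close> times p^((j+1)m), and one more vertex each time. The last orbit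
  contributes the subgroup complex.\<close>

lemma (in elementary_abelian_group) spherical_invariant_equivs:
  assumes "equivariant_coordinates G E \<phi> \<theta> S" "card S = Suc m" "order G = p ^ Suc j"
  shows "spherical (subset_chains {x \<in> group_action.invariant_equivs G E \<phi>. kernel_on E \<theta> \<subset> x \<and> x \<subset> E \<times> E})
    (fact m * p ^ (Suc j * m) * p ^ (Suc j choose 2)) (m + j)"
  using assms(1,2)
proof (induction m arbitrary: \<theta> S)
  case 0
  interpret equivariant_coordinates G E \<phi> \<theta> S by (rule 0)
  obtain s where s: "S = {s}" using 0 by (auto simp: card_Suc_eq)
  have "spherical (subset_chains {H. subgroup H G \<and> {\<one>} \<subset> H \<and> H \<subset> carrier G}) (p ^ (Suc j choose 2)) j"
    using assms(3) triv_subgroup by (intro spherical_subgroups) (auto simp: order_def)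
  then show ?case using spherical_transitive[OF s] by simp
next
  case (Suc m)
  interpret equivariant_coordinates G E \<phi> \<theta> S by (rule Suc)
  obtain b where b: "b \<in> S" using Suc.prems by fastforce
  have fin: "finite S" using Suc.prems by (simp add: card_ge_0_finite)
  have c: "card (S - {b}) = Suc m" using Suc.prems b fin by simp
  have "1 < p ^ Suc j" using prime_gt_1_nat[OF prime_p] by (intro one_less_power) auto
  then have big: "1 < order G * card (S - {b})" using assms(3) c by (simp add: less_le_trans)
  have ne: "S - {b} \<noteq> {}" using c by force
  have "spherical (subset_chains {x \<in> invariant_equivs. kernel_on E \<theta> \<subset> x \<and> x \<subset> E \<times> E})
      (card (S - {b}) * order G * (fact m * p ^ (Suc j * m) * p ^ (Suc j choose 2))) (Suc (m + j))"
    by (rule spherical_step[OF b ne big]) (rule Suc.IH[OF merge_coordinates c])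
  moreover have "card (S - {b}) * order G * (fact m * p ^ (Suc j * m) * p ^ (Suc j choose 2)) =
      fact (Suc m) * p ^ (Suc j * Suc m) * p ^ (Suc j choose 2)"
    using c assms(3) by (simp add: power_add algebra_simps)
  ultimately show ?case by (metis add_Suc)
qed

text \<open>The partition lattice itself, from the trivial group. The induction starts at two
  orbits: with one orbit, top and bottom coincide, and with two, \<open>split_off b\<close> is the
  bottom, so complementation does not apply yet.\<close>

lemma spherical_equivs:
  assumes "equivariant_coordinates G E \<phi> \<theta> S" "card S = Suc (Suc m)" "order G = 1"
  shows "spherical (subset_chains {x \<in> group_action.invariant_equivs G E \<phi>. kernel_on E \<theta> \<subset> x \<and> x \<subset> E \<times> E})
    (fact (Suc m)) m"
  using assms(1,2)
proof (induction m arbitrary: \<theta> S)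
  case 0
  interpret equivariant_coordinates G E \<phi> \<theta> S by (rule 0)
  have "card (carrier G \<times> S) = 2" using 0 assms(3) by (simp add: card_cartesian_product order_def)
  then obtain y z where yz: "carrier G \<times> S = {y, z}" by (auto simp: card_2_iff)
  have "\<not> (x \<in> invariant_equivs \<and> kernel_on E \<theta> \<subset> x \<and> x \<subset> E \<times> E)" for x
  proof
    assume x: "x \<in> invariant_equivs \<and> kernel_on E \<theta> \<subset> x \<and> x \<subset> E \<times> E"
    note xD = invariant_equivsD[OF conjunct1[OF x]]
    obtain u v where uv: "(u, v) \<in> x" "(u, v) \<notin> kernel_on E \<theta>" using x by auto
    then have E: "u \<in> E" "v \<in> E" "\<theta> u \<noteq> \<theta> v" using xD(1) by (auto simp: kernel_on_def)
    have two: "\<theta> w \<in> {\<theta> u, \<theta> v}" if "w \<in> E" for w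
    proof -
      have "\<theta> w \<in> {y, z}" "\<theta> u \<in> {y, z}" "\<theta> v \<in> {y, z}" using coordinates yz E that by blast+
      then show ?thesis using E(3) by auto
    qed
    have "(u, w) \<in> x" if w: "w \<in> E" for w
    proof -
      \<comment> \<open>The quotient has only two points, and \<open>x\<close> already identifies
        them.\<close>
      have "(u, w) \<in> kernel_on E \<theta> \<or> (v, w) \<in> kernel_on E \<theta>"
        using two[OF w] E w by (auto simp: kernel_on_def)
      then show ?thesis using x uv(1) xD(4) by blast
    qed
    then have "(w, w') \<in> x" if "w \<in> E" "w' \<in> E" for w w'
      using that xD(3)[of u w] xD(4)[of w u w'] by simp
    then have "E \<times> E \<subseteq> x" by auto
    then show False using x by (meson leD)
  qed
  then have *: "{x \<in> invariant_equivs. kernel_on E \<theta> \<subset> x \<and> x \<subset> E \<times> E} = {}"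
    by (intro Collect_empty_eq[THEN iffD2] allI)
  show ?case unfolding * using spherical_singleton[of "{}"] by simp
next
  case (Suc m)
  interpret equivariant_coordinates G E \<phi> \<theta> S by (rule Suc)
  obtain b where b: "b \<in> S" using Suc.prems by fastforce
  have fin: "finite S" using Suc.prems by (simp add: card_ge_0_finite)
  have c: "card (S - {b}) = Suc (Suc m)" using Suc.prems b fin by simp
  have big: "1 < order G * card (S - {b})" using assms(3) c by simp
  have ne: "S - {b} \<noteq> {}" using c by force
  have "spherical (subset_chains {x \<in> invariant_equivs. kernel_on E \<theta> \<subset> x \<and> x \<subset> E \<times> E})
      (card (S - {b}) * order G * fact (Suc m)) (Suc m)"
    by (rule spherical_step[OF b ne big]) (rule Suc.IH[OF merge_coordinates c])
  then show ?case using c assms(3) by simp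
qed

section \<open>Joins, spheres and wedges\<close>

definition vertex :: "'a \<Rightarrow> 'a \<Rightarrow> real" where
  "vertex a = (\<lambda>b. if b = a then 1 else 0)"

text \<open>A finite union of closed simplices, each a closed part of a product of compact
  intervals. Compactness of the source makes continuous bijections onto Hausdorff realizations
  homeomorphisms, and continuous surjections quotient maps.\<close>

lemma compact_space_realization:
  assumes K: "simplicial_complex K"
  shows "compact_space (realization K)"
proof -
  let ?U = "powertop_real (UNIV :: 'a set)"
  define P where "P = (\<lambda>\<sigma> :: 'a set. PiE UNIV (\<lambda>a. if a \<in> \<sigma> then {0..1} else {0}) \<inter> {t \<in> topspace ?U. sum t \<sigma> \<in> {1 :: real}})"
  have "realization_points K = \<Union>(P ` K)"
  proof (intro equalityI subsetI)
    fix t assume t: "t \<in> realization_points K"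
    let ?\<sigma> = "{a. t a \<noteq> 0}"
    have fin: "finite ?\<sigma>" using realization_pointsD(2)[OF t] simplicial_complexD(2)[OF K] by blast
    have one: "sum t ?\<sigma> = 1" using t by (simp add: realization_points_def)
    have "t a \<le> 1" for a
    proof (cases "a \<in> ?\<sigma>")
      case True
      then show ?thesis using member_le_sum[of a ?\<sigma> t] realization_pointsD(1)[OF t] fin one by simp
    qed simp
    then have "t \<in> P ?\<sigma>" using one realization_pointsD(1)[OF t] by (auto simp: P_def)
    then show "t \<in> \<Union>(P ` K)" using realization_pointsD(2)[OF t] by blast
  next
    fix t assume "t \<in> \<Union>(P ` K)"
    then obtain \<sigma> where \<sigma>: "\<sigma> \<in> K" "t \<in> P \<sigma>" by blast
    have t: "t a \<in> (if a \<in> \<sigma> then {0..1} else {0})" for a using \<sigma>(2) by (auto simp: P_def PiE_iff)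
    then have sub: "{a. t a \<noteq> 0} \<subseteq> \<sigma>" using t by (auto split: if_splits) (metis singletonD)
    show "t \<in> realization_points K"
    proof (rule realization_pointsI[of _ _ \<sigma>])
      show "0 \<le> t a" for a using t[of a] by (auto split: if_splits)
      show "{a. t a \<noteq> 0} \<in> K" using simplicial_complexD(3)[OF K \<sigma>(1) sub] .
      show "finite \<sigma>" using simplicial_complexD(2)[OF K \<sigma>(1)] .
      show "sum t \<sigma> = 1" using \<sigma>(2) by (simp add: P_def)
    qed (rule sub)
  qed
  moreover have "compactin ?U (P \<sigma>)" if "\<sigma> \<in> K" for \<sigma>
  proof -
    have fin: "finite \<sigma>" using simplicial_complexD(2)[OF K that] .
    have "compactin ?U (PiE UNIV (\<lambda>a. if a \<in> \<sigma> then {0..1} else {0}))"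
      by (subst compactin_PiE) auto
    moreover have "continuous_map ?U euclideanreal (\<lambda>t. sum t \<sigma>)"
      by (intro continuous_map_sum fin continuous_map_product_projection) simp
    then have "closedin ?U {t \<in> topspace ?U. sum t \<sigma> \<in> {1}}"
      by (rule closedin_continuous_map_preimage) simp
    ultimately show ?thesis unfolding P_def by (rule compact_Int_closedin)
  qed
  ultimately have "compactin ?U (realization_points K)"
    using simplicial_complexD(1)[OF K] by (auto intro!: compactin_Union)
  then show ?thesis unfolding realization_def by (rule compact_space_subtopology)
qed

text \<open>Both targets carry the quotient topology for the same fibres, so each map factors
  through the other.\<close>

lemma quotient_maps_homeomorphic:
  assumes q: "quotient_map Z Y q" and r: "quotient_map Z W r"
    and same: "\<And>x y. x \<in> topspace Z \<Longrightarrow> y \<in> topspace Z \<Longrightarrow> q x = q y \<longleftrightarrow> r x = r y"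
  shows "Y homeomorphic_space W"
proof -
  note cq = quotient_imp_continuous_map[OF q] and cr = quotient_imp_continuous_map[OF r]
  obtain g where g: "continuous_map Y W g" "\<And>x. x \<in> topspace Z \<Longrightarrow> g (q x) = r x"
    using quotient_map_lift_exists[OF q cr] same by metis
  obtain h where h: "continuous_map W Y h" "\<And>x. x \<in> topspace Z \<Longrightarrow> h (r x) = q x"
    using quotient_map_lift_exists[OF r cq] same by metis
  have "homeomorphic_maps Y W g h"
    unfolding homeomorphic_maps_def
    using g h quotient_imp_surjective_map[OF q] quotient_imp_surjective_map[OF r]
    by (metis (no_types, lifting) imageE)
  then show ?thesis by (auto simp: homeomorphic_space_def)
qed

section \<open>Spheres as boundaries of cross-polytopes, with (i, True) and (i, False) as opposite
  vertices\<close>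

definition cross_polytope :: "nat \<Rightarrow> (nat \<times> bool) set set" where
  "cross_polytope d = {\<sigma>. \<sigma> \<subseteq> {..d} \<times> UNIV \<and> (\<forall>i. (i, True) \<in> \<sigma> \<longrightarrow> (i, False) \<notin> \<sigma>)}"

lemma simplicial_complex_cross_polytope: "simplicial_complex (cross_polytope d)"
proof (rule simplicial_complexI)
  have "finite (Pow ({..d} \<times> (UNIV :: bool set)))" by simp
  then show "finite (cross_polytope d)" by (rule finite_subset[rotated]) (auto simp: cross_polytope_def)
  show "finite \<sigma>" if "\<sigma> \<in> cross_polytope d" for \<sigma>
    using that finite_subset[of \<sigma> "{..d} \<times> UNIV"] by (simp add: cross_polytope_def)
  show "\<rho> \<in> cross_polytope d" if "\<sigma> \<in> cross_polytope d" "\<rho> \<subseteq> \<sigma>" for \<sigma> \<rho>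
    using that unfolding cross_polytope_def by blast
qed

text \<open>The signed coordinates of a point of the sphere, scaled to \<open>l\<^sup>1\<close>-norm \<open>1\<close>, are barycentric
  coordinates in the boundary of the cross-polytope.\<close>

lemma sphere_homeomorphic_cross_polytope:
  obtains f where "homeomorphic_map (nsphere d) (realization (cross_polytope d)) f"
    "f sphere_pole = vertex (0, True)"
proof -
  let ?V = "{..d} \<times> (UNIV :: bool set)"
  define f where "f = (\<lambda>x (i, s). if i \<le> d then max 0 (if s then x i else - x i) / (\<Sum>j\<le>d. \<bar>x j\<bar>) else 0 :: real)"
  define y where "y = (\<lambda>(t :: nat \<times> bool \<Rightarrow> real) i. t (i, True) - t (i, False))"
  \<comment> \<open>The inverse: the weights of opposite vertices are subtracted and the vector is
    normalised to Euclidean length 1.\<close>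
  define g where "g = (\<lambda>t i. y t i / sqrt (\<Sum>j\<le>d. (y t j)\<^sup>2))"
  have ts: "topspace (nsphere d) = {x. (\<Sum>i\<le>d. x i ^ 2) = 1 \<and> (\<forall>i>d. x i = 0)}"
    by (simp add: nsphere)
  have sum_V: "sum h ?V = (\<Sum>i\<le>d. h (i, True) + h (i, False))" for h :: "nat \<times> bool \<Rightarrow> real"
  proof -
    have "sum h ?V = (\<Sum>(i, s)\<in>?V. h (i, s))" by (simp add: case_prod_unfold)
    also have "\<dots> = (\<Sum>i\<le>d. \<Sum>s\<in>UNIV. h (i, s))" by (rule sum.cartesian_product[symmetric])
    finally show ?thesis by (simp add: UNIV_bool add.commute)
  qed
  have l1_pos: "0 < (\<Sum>j\<le>d. \<bar>x j\<bar>)" if x: "x \<in> topspace (nsphere d)" for x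
  proof -
    have "\<exists>j\<le>d. x j \<noteq> 0"
    proof (rule ccontr)
      assume "\<not> (\<exists>j\<le>d. x j \<noteq> 0)"
      then have "(\<Sum>i\<le>d. x i ^ 2) = 0" by simp
      then show False using x ts by simp
    qed
    then obtain j where "j \<le> d" "x j \<noteq> 0" by blast
    then show ?thesis by (intro sum_pos2[of _ j]) auto
  qed
  have f_in: "f x \<in> realization_points (cross_polytope d)" if x: "x \<in> topspace (nsphere d)" for x
  proof (rule realization_pointsI[of _ _ ?V])
    note N = l1_pos[OF x]
    show "0 \<le> f x a" for a using N by (cases a) (simp add: f_def)
    show sub: "{a. f x a \<noteq> 0} \<subseteq> ?V" by (auto simp: f_def split: if_splits)
    have "f x (i, True) = 0 \<or> f x (i, False) = 0" for i by (auto simp: f_def max_def)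
    then show "{a. f x a \<noteq> 0} \<in> cross_polytope d" using sub by (auto simp: cross_polytope_def)
    have "sum (f x) ?V = (\<Sum>i\<le>d. \<bar>x i\<bar> / (\<Sum>j\<le>d. \<bar>x j\<bar>))"
      unfolding sum_V by (intro sum.cong) (auto simp: f_def max_def abs_if)
    also have "\<dots> = 1" using N by (simp flip: sum_divide_distrib)
    finally show "sum (f x) ?V = 1" .
  qed simp
  have t_zero: "t (i, True) = 0 \<or> t (i, False) = 0" "0 \<le> t a" "i > d \<Longrightarrow> t (i, s) = 0"
    if t: "t \<in> realization_points (cross_polytope d)" for t i s a
  proof -
    note T = realization_pointsD[OF t]
    show "t (i, True) = 0 \<or> t (i, False) = 0" using T(2) by (auto simp: cross_polytope_def)
    show "0 \<le> t a" by (rule T)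
    show "t (i, s) = 0" if "i > d"
      using T(2) that by (force simp: cross_polytope_def)
  qed
  have q_pos: "0 < (\<Sum>j\<le>d. (y t j)\<^sup>2)" if t: "t \<in> realization_points (cross_polytope d)" for t
  proof -
    obtain a where a: "t a \<noteq> 0" using realization_pointsD(3)[OF t] by blast
    obtain i s where a_eq: "a = (i, s)" by (cases a)
    have "i \<le> d" using t_zero(3)[OF t, of i s] a a_eq by (meson not_le)
    moreover have "y t i \<noteq> 0" using t_zero(1)[OF t, of i] a a_eq by (cases s) (auto simp: y_def)
    ultimately show ?thesis by (intro sum_pos2[of _ i]) auto
  qed
  have abs_y: "\<bar>y t i\<bar> = t (i, True) + t (i, False)" if t: "t \<in> realization_points (cross_polytope d)" for t i
    using t_zero(1)[OF t, of i] t_zero(2)[OF t, of "(i, True)"] t_zero(2)[OF t, of "(i, False)"] by (auto simp: y_def)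
  have sum_y: "(\<Sum>i\<le>d. \<bar>y t i\<bar>) = 1" if t: "t \<in> realization_points (cross_polytope d)" for t
  proof -
    have "{a. t a \<noteq> 0} \<subseteq> ?V" using realization_pointsD(2)[OF t] by (auto simp: cross_polytope_def)
    then have "sum t ?V = 1" by (intro realization_points_sum[OF t]) auto
    then show ?thesis using abs_y[OF t] by (simp add: sum_V)
  qed
  have g_in: "g t \<in> topspace (nsphere d)" if t: "t \<in> realization_points (cross_polytope d)" for t
  proof -
    have "(\<Sum>i\<le>d. g t i ^ 2) = (\<Sum>i\<le>d. (y t i)\<^sup>2 / (\<Sum>j\<le>d. (y t j)\<^sup>2))"
      using q_pos[OF t] by (simp add: g_def power_divide)
    also have "\<dots> = 1" using q_pos[OF t] by (simp flip: sum_divide_distrib)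
    finally show ?thesis using t_zero(3)[OF t] by (simp add: ts g_def y_def)
  qed
  have gf: "g (f x) = x" if x: "x \<in> topspace (nsphere d)" for x
  proof
    fix i
    let ?N = "\<Sum>j\<le>d. \<bar>x j\<bar>"
    have yf: "y (f x) j = (if j \<le> d then x j / ?N else 0)" for j
      by (simp add: y_def f_def max_def)
    have "(\<Sum>j\<le>d. (y (f x) j)\<^sup>2) = (\<Sum>j\<le>d. (x j)\<^sup>2) / ?N\<^sup>2"
      by (simp add: yf power_divide sum_divide_distrib)
    also have "\<dots> = (1 / ?N)\<^sup>2" using x ts by (simp add: power_divide)
    finally have "sqrt (\<Sum>j\<le>d. (y (f x) j)\<^sup>2) = 1 / ?N" using l1_pos[OF x] by simp
    then show "g (f x) i = x i" using l1_pos[OF x] x ts by (simp add: g_def yf)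
  qed
  have fg: "f (g t) = t" if t: "t \<in> realization_points (cross_polytope d)" for t
  proof
    fix a :: "nat \<times> bool"
    obtain i s where a: "a = (i, s)" by (cases a)
    let ?Q = "sqrt (\<Sum>j\<le>d. (y t j)\<^sup>2)"
    have Q: "0 < ?Q" using q_pos[OF t] by simp
    have "(\<Sum>j\<le>d. \<bar>g t j\<bar>) = 1 / ?Q"
      using sum_y[OF t] Q by (simp add: g_def flip: sum_divide_distrib)
    then have "f (g t) a = (if i \<le> d then max 0 (if s then y t i / ?Q else - (y t i / ?Q)) * ?Q else 0)"
      by (simp add: f_def a g_def)
    also have "\<dots> = (if i \<le> d then max 0 (if s then y t i else - y t i) else 0)"
      using Q by (auto simp: max_def field_simps zero_le_divide_iff divide_le_0_iff)
    also have "\<dots> = t a"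
      using t_zero(1)[OF t, of i] t_zero(2)[OF t, of "(i, True)"] t_zero(2)[OF t, of "(i, False)"] t_zero(3)[OF t, of i s] a
      by (cases s) (auto simp: y_def max_def)
    finally show "f (g t) a = t a" .
  qed
  have contf: "continuous_map (nsphere d) (realization (cross_polytope d)) f"
    unfolding continuous_map_into_realization
  proof (intro conjI allI)
    fix a :: "nat \<times> bool"
    obtain i s where a: "a = (i, s)" by (cases a)
    have c: "continuous_map (nsphere d) euclideanreal (\<lambda>x. x j)" for j
      by (rule continuous_map_nsphere_projection)
    have "continuous_map (nsphere d) euclideanreal (\<lambda>x. max 0 (if s then x i else - x i) / (\<Sum>j\<le>d. \<bar>x j\<bar>))"
    proof (intro continuous_map_real_divide continuous_map_real_max continuous_map_sum continuous_map_real_abs c)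
      show "continuous_map (nsphere d) euclideanreal (\<lambda>x. if s then x i else - x i)"
        using c[of i] continuous_map_minus[OF c[of i]] by (cases s) auto
      show "(\<Sum>j\<le>d. \<bar>x j\<bar>) \<noteq> 0" if "x \<in> topspace (nsphere d)" for x using l1_pos[OF that] by simp
    qed auto
    then show "continuous_map (nsphere d) euclideanreal (\<lambda>x. f x a)"
      by (cases "i \<le> d") (simp_all add: f_def a)
  qed (use f_in in auto)
  have contg: "continuous_map (realization (cross_polytope d)) (nsphere d) g"
  proof -
    have cy: "continuous_map (realization (cross_polytope d)) euclideanreal (\<lambda>t. y t i)" for i
      unfolding y_def by (intro continuous_map_diff continuous_map_realization_component)
    have "continuous_map (realization (cross_polytope d)) euclideanreal (\<lambda>t. g t i)" for i
      unfolding g_def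
      by (intro continuous_map_real_divide continuous_map_sqrt continuous_map_sum continuous_map_real_pow cy)
        (use q_pos in \<open>force+\<close>)
    then show ?thesis using g_in ts
      by (auto simp: nsphere continuous_map_in_subtopology continuous_map_componentwise_UNIV)
  qed
  have hm: "homeomorphic_maps (nsphere d) (realization (cross_polytope d)) f g"
    using contf contg gf fg by (simp add: homeomorphic_maps_def)
  have "(\<Sum>j\<le>d. \<bar>sphere_pole j\<bar>) = 1" by (simp add: sphere_pole_def if_distrib cong: if_cong)
  then have "f sphere_pole = vertex (0, True)"
    by (auto simp: fun_eq_iff f_def vertex_def sphere_pole_def)
  then show ?thesis using that homeomorphic_maps_map[of "nsphere d" _ f g] hm by blast
qed

section \<open>Joins of realizations\<close>

lemma continuous_map_from_space_join:
  assumes "continuous_map X Z (\<lambda>x. h (JLeft x))" "continuous_map Y Z (\<lambda>y. h (JRight y))"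
    "continuous_map (join_cylinder X Y) Z (\<lambda>z. h (join_map z))"
  shows "continuous_map (space_join X Y) Z h"
  unfolding continuous_map_def
proof (intro conjI allI impI)
  show "h \<in> topspace (space_join X Y) \<rightarrow> topspace Z"
    using assms by (auto simp: join_points_def dest: continuous_map_funspace)
  fix U assume U: "openin Z U"
  have eq: "{x \<in> topspace X. JLeft x \<in> {p \<in> topspace (space_join X Y). h p \<in> U}} = {x \<in> topspace X. h (JLeft x) \<in> U}"
    "{y \<in> topspace Y. JRight y \<in> {p \<in> topspace (space_join X Y). h p \<in> U}} = {y \<in> topspace Y. h (JRight y) \<in> U}"
    "{z \<in> topspace (join_cylinder X Y). join_map z \<in> {p \<in> topspace (space_join X Y). h p \<in> U}} =
      {z \<in> topspace (join_cylinder X Y). h (join_map z) \<in> U}"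
    by (auto simp: join_points_def)
  show "openin (space_join X Y) {p \<in> topspace (space_join X Y). h p \<in> U}"
    unfolding openin_space_join eq
    using openin_continuous_map_preimage[OF assms(1) U] openin_continuous_map_preimage[OF assms(2) U]
      openin_continuous_map_preimage[OF assms(3) U] by simp
qed

lemma compact_space_join:
  assumes "compact_space X" "compact_space Y"
  shows "compact_space (space_join X Y)"
proof -
  let ?J = "space_join X Y"
  have L: "continuous_map X ?J JLeft" and R: "continuous_map Y ?J JRight"
    and M: "continuous_map (join_cylinder X Y) ?J join_map"
    unfolding continuous_map_def by (auto simp: openin_space_join join_points_def)
  have "compact_space (join_cylinder X Y)"
    unfolding join_cylinder_def using assms by (simp add: compact_space_prod_topology compact_space_subtopology)
  then have "compactin ?J (JLeft ` topspace X \<union> JRight ` topspace Y \<union> join_map ` topspace (join_cylinder X Y))"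
    using L R M assms by (intro compactin_Un) (auto intro: image_compactin simp: compact_space_def)
  then show ?thesis by (simp add: compact_space_def join_points_def)
qed

lemma simplicial_complex_join:
  assumes "simplicial_complex K" "simplicial_complex L"
  shows "simplicial_complex (join_complex K L)"
proof (rule simplicial_complexI)
  have "join_complex K L = (\<lambda>(\<sigma>, \<rho>). Inl ` \<sigma> \<union> Inr ` \<rho>) ` (K \<times> L)" by (auto simp: join_complex_def)
  then show "finite (join_complex K L)"
    using simplicial_complexD(1)[OF assms(1)] simplicial_complexD(1)[OF assms(2)] by simp
  show "finite \<sigma>" if "\<sigma> \<in> join_complex K L" for \<sigma>
    using that simplicial_complexD(2)[OF assms(1)] simplicial_complexD(2)[OF assms(2)] by (auto simp: join_complex_def)
  show "\<rho> \<in> join_complex K L" if "\<sigma> \<in> join_complex K L" "\<rho> \<subseteq> \<sigma>" for \<sigma> \<rho>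
    using that simplicial_complexD(3)[OF assms(1), of "Inl -` \<sigma>" "Inl -` \<rho>"]
      simplicial_complexD(3)[OF assms(2), of "Inr -` \<sigma>" "Inr -` \<rho>"]
    by (auto simp: join_complex_iff)
qed

primrec join_coordinates :: "('x \<Rightarrow> 'a \<Rightarrow> real) \<Rightarrow> ('y \<Rightarrow> 'b \<Rightarrow> real) \<Rightarrow> ('x, 'y) join_point \<Rightarrow> 'a + 'b \<Rightarrow> real" where
  "join_coordinates f g (JLeft x) = case_sum (f x) (\<lambda>b. 0)"
| "join_coordinates f g (JRight y) = case_sum (\<lambda>a. 0) (g y)"
| "join_coordinates f g (JMid x y s) = case_sum (\<lambda>a. (1 - s) * f x a) (\<lambda>b. s * g y b)"

text \<open>At s = 0 and s = 1 one factor has weight zero, so the affine formula stays valid at the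
  ends of the cylinder, where \<open>join_map\<close> forgets that factor. Continuity can thus be
  checked without cases on s.\<close>

lemma join_coordinates_join_map:
  "join_coordinates f g (join_map (x, y, s)) = case_sum (\<lambda>a. (1 - s) * f x a) (\<lambda>b. s * g y b)"
  by (auto simp: fun_eq_iff split: sum.split)

lemma sum_Plus_real: "finite A \<Longrightarrow> finite B \<Longrightarrow> sum h (A <+> B) = (\<Sum>a\<in>A. h (Inl a)) + (\<Sum>b\<in>B. h (Inr b) :: real)"
  by (simp add: sum.Plus)

text \<open>A continuous bijection from a compact space to a Hausdorff one. The total weight on the
  second summand recovers the join parameter, and rescaling both parts recovers the points. The
  empty faces of \<open>K\<close> and \<open>L\<close> make the faces of one factor alone faces of
  the join, also when the other factor is the empty space.\<close>

lemma space_join_homeomorphic: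
  fixes K :: "'a set set" and L :: "'b set set" and X :: "'x topology" and Y :: "'y topology"
  assumes K: "simplicial_complex K" "{} \<in> K" and L: "simplicial_complex L" "{} \<in> L"
    and f: "homeomorphic_map X (realization K) f" and g: "homeomorphic_map Y (realization L) g"
  shows "homeomorphic_map (space_join X Y) (realization (join_complex K L)) (join_coordinates f g)"
proof -
  let ?A = "\<Union>K" and ?B = "\<Union>L" and ?h = "join_coordinates f g" and ?KL = "join_complex K L"
  have finA: "finite ?A" and finB: "finite ?B" using simplicial_complexD(4) K L by auto
  have fX: "f ` topspace X = realization_points K" and fi: "inj_on f (topspace X)"
    and fc: "continuous_map X (realization K) f"
    using homeomorphic_imp_surjective_map[OF f] homeomorphic_imp_injective_map[OF f] homeomorphic_imp_continuous_map[OF f] by auto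
  have gY: "g ` topspace Y = realization_points L" and gi: "inj_on g (topspace Y)"
    and gc: "continuous_map Y (realization L) g"
    using homeomorphic_imp_surjective_map[OF g] homeomorphic_imp_injective_map[OF g] homeomorphic_imp_continuous_map[OF g] by auto
  have fpt: "f x \<in> realization_points K" if "x \<in> topspace X" for x using fX that by blast
  have gpt: "g y \<in> realization_points L" if "y \<in> topspace Y" for y using gY that by blast
  have supp: "{a. t a \<noteq> 0} \<subseteq> \<Union>M" if "t \<in> realization_points M" for t and M :: "'z set set"
    using realization_pointsD(2)[OF that] by auto
  have sf: "sum (f x) ?A = 1" if "x \<in> topspace X" for x by (rule realization_points_sum[OF fpt[OF that] finA supp[OF fpt[OF that]]])
  have sg: "sum (g y) ?B = 1" if "y \<in> topspace Y" for y by (rule realization_points_sum[OF gpt[OF that] finB supp[OF gpt[OF that]]])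
  have mid: "case_sum (\<lambda>a. (1 - s) * f x a) (\<lambda>b. s * g y b) \<in> realization_points ?KL" (is "?t \<in> _")
    if xy: "x \<in> topspace X" "y \<in> topspace Y" and s: "0 \<le> s" "s \<le> 1" for x y s
  proof (rule realization_pointsI[of _ _ "?A <+> ?B"])
    note F = realization_pointsD[OF fpt[OF xy(1)]] and G = realization_pointsD[OF gpt[OF xy(2)]]
    show "0 \<le> ?t v" for v using F(1) G(1) s by (cases v) auto
    have "Inl -` {v. ?t v \<noteq> 0} \<subseteq> {a. f x a \<noteq> 0}" "Inr -` {v. ?t v \<noteq> 0} \<subseteq> {b. g y b \<noteq> 0}" by auto
    then have *: "Inl -` {v. ?t v \<noteq> 0} \<in> K" "Inr -` {v. ?t v \<noteq> 0} \<in> L"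
      using simplicial_complexD(3)[OF K(1) F(2)] simplicial_complexD(3)[OF L(1) G(2)] by auto
    then show "{v. ?t v \<noteq> 0} \<in> ?KL" by (simp add: join_complex_iff)
    show "{v. ?t v \<noteq> 0} \<subseteq> ?A <+> ?B"
    proof
      fix v assume "v \<in> {v. ?t v \<noteq> 0}"
      then show "v \<in> ?A <+> ?B" using * by (cases v) auto
    qed
    show "sum ?t (?A <+> ?B) = 1"
      using sf[OF xy(1)] sg[OF xy(2)] by (simp add: sum_Plus_real finA finB flip: sum_distrib_left)
  qed (use finA finB in simp)
  have left: "case_sum (f x) (\<lambda>b. 0) \<in> realization_points ?KL" if x: "x \<in> topspace X" for x
  proof (rule realization_pointsI[of _ _ "?A <+> ?B"])
    note F = realization_pointsD[OF fpt[OF x]]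
    show "0 \<le> case_sum (f x) (\<lambda>b. 0) v" for v using F(1) by (cases v) auto
    have "Inl -` {v. case_sum (f x) (\<lambda>b. 0 :: real) v \<noteq> 0} = {a. f x a \<noteq> 0}" "Inr -` {v. case_sum (f x) (\<lambda>b :: 'b. 0 :: real) v \<noteq> 0} = {}" by auto
    then show "{v. case_sum (f x) (\<lambda>b. 0) v \<noteq> 0} \<in> ?KL" using F(2) L(2) by (simp add: join_complex_iff)
    show "{v. case_sum (f x) (\<lambda>b. 0) v \<noteq> 0} \<subseteq> ?A <+> ?B"
    proof
      fix v :: "'a + 'b" assume "v \<in> {v. case_sum (f x) (\<lambda>b. 0) v \<noteq> 0}"
      then show "v \<in> ?A <+> ?B" using supp[OF fpt[OF x]] by (cases v) auto
    qed
  qed (use sf[OF x] finA finB in \<open>simp_all add: sum_Plus_real\<close>)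
  have right: "case_sum (\<lambda>a. 0) (g y) \<in> realization_points ?KL" if y: "y \<in> topspace Y" for y
  proof (rule realization_pointsI[of _ _ "?A <+> ?B"])
    note G = realization_pointsD[OF gpt[OF y]]
    show "0 \<le> case_sum (\<lambda>a. 0) (g y) v" for v using G(1) by (cases v) auto
    have "Inl -` {v. case_sum (\<lambda>a :: 'a. 0 :: real) (g y) v \<noteq> 0} = {}" "Inr -` {v. case_sum (\<lambda>a. 0 :: real) (g y) v \<noteq> 0} = {b. g y b \<noteq> 0}" by auto
    then show "{v. case_sum (\<lambda>a. 0) (g y) v \<noteq> 0} \<in> ?KL" using G(2) K(2) by (simp add: join_complex_iff)
    show "{v. case_sum (\<lambda>a. 0) (g y) v \<noteq> 0} \<subseteq> ?A <+> ?B"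
    proof
      fix v :: "'a + 'b" assume "v \<in> {v. case_sum (\<lambda>a. 0) (g y) v \<noteq> 0}"
      then show "v \<in> ?A <+> ?B" using supp[OF gpt[OF y]] by (cases v) auto
    qed
  qed (use sg[OF y] finA finB in \<open>simp_all add: sum_Plus_real\<close>)
  have jp: "(\<exists>x\<in>topspace X. p = JLeft x) \<or> (\<exists>y\<in>topspace Y. p = JRight y) \<or>
      (\<exists>x\<in>topspace X. \<exists>y\<in>topspace Y. \<exists>s. 0 < s \<and> s < 1 \<and> p = JMid x y s)"
    if "p \<in> join_points X Y" for p
  proof -
    consider "p \<in> JLeft ` topspace X" | "p \<in> JRight ` topspace Y" | "p \<in> join_map ` topspace (join_cylinder X Y)"
      using \<open>p \<in> join_points X Y\<close> unfolding join_points_def by blast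
    then show ?thesis
    proof cases
      case 3
      then obtain x y s where "p = join_map (x, y, s)" "x \<in> topspace X" "y \<in> topspace Y" "0 \<le> s" "s \<le> 1"
        by (auto simp: join_cylinder_def simp del: join_map.simps)
      then show ?thesis by (cases "s = 0"; cases "s = 1") auto
    qed auto
  qed
  have contf: "continuous_map X euclideanreal (\<lambda>x. f x a)" for a using fc by (simp add: continuous_map_into_realization)
  have contg: "continuous_map Y euclideanreal (\<lambda>y. g y b)" for b using gc by (simp add: continuous_map_into_realization)
  have cont: "continuous_map (space_join X Y) (realization ?KL) ?h"
  proof (rule continuous_map_from_space_join)
    have "continuous_map X euclideanreal (\<lambda>x. case_sum (f x) (\<lambda>b. 0) v)" for v
      by (cases v) (simp_all add: contf)
    then show "continuous_map X (realization ?KL) (\<lambda>x. ?h (JLeft x))"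
      unfolding continuous_map_into_realization using left by auto
    have "continuous_map Y euclideanreal (\<lambda>y. case_sum (\<lambda>a. 0) (g y) v)" for v
      by (cases v) (simp_all add: contg)
    then show "continuous_map Y (realization ?KL) (\<lambda>y. ?h (JRight y))"
      unfolding continuous_map_into_realization using right by auto
    let ?C = "join_cylinder X Y"
    have cx: "continuous_map ?C X fst" and cy: "continuous_map ?C Y (\<lambda>z. fst (snd z))"
      and cs': "continuous_map ?C (top_of_set {0..1}) (\<lambda>z. snd (snd z))"
      unfolding join_cylinder_def
      using continuous_map_fst continuous_map_compose[OF continuous_map_snd continuous_map_fst]
        continuous_map_compose[OF continuous_map_snd continuous_map_snd] by (auto simp: o_def)
    have cs: "continuous_map ?C euclideanreal (\<lambda>z. snd (snd z))"
      using cs' continuous_map_into_fulltopology by blast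
    have cfx: "continuous_map ?C euclideanreal (\<lambda>z. f (fst z) a)" for a
      using continuous_map_compose[OF cx contf] by (simp add: o_def)
    have cgy: "continuous_map ?C euclideanreal (\<lambda>z. g (fst (snd z)) b)" for b
      using continuous_map_compose[OF cy contg] by (simp add: o_def)
    have eq: "?h (join_map z) = case_sum (\<lambda>a. (1 - snd (snd z)) * f (fst z) a) (\<lambda>b. snd (snd z) * g (fst (snd z)) b)" for z
      using join_coordinates_join_map[of f g "fst z" "fst (snd z)" "snd (snd z)"] by simp
    have "continuous_map ?C euclideanreal (\<lambda>z. ?h (join_map z) v)" for v
      unfolding eq by (cases v) (auto intro!: continuous_map_real_mult continuous_map_diff cs cfx cgy)
    moreover have "?h (join_map z) \<in> realization_points ?KL" if "z \<in> topspace ?C" for z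
      unfolding eq using that by (intro mid) (auto simp: join_cylinder_def)
    ultimately show "continuous_map ?C (realization ?KL) (\<lambda>z. ?h (join_map z))"
      unfolding continuous_map_into_realization by auto
  qed
  have compX: "compact_space X" and compY: "compact_space Y"
    using compact_space_realization K L f g homeomorphic_compact_space homeomorphic_map_imp_homeomorphic_space by metis+
  have inj: "inj_on ?h (join_points X Y)"
  proof (rule inj_onI)
    define m where "m = (\<lambda>t :: 'a + 'b \<Rightarrow> real. \<Sum>b\<in>?B. t (Inr b))"
    have mL: "m (?h (JLeft x)) = 0" for x by (simp add: m_def)
    have mR: "m (?h (JRight y)) = 1" if "y \<in> topspace Y" for y using sg[OF that] by (simp add: m_def)
    have mM: "m (?h (JMid x y s)) = s" if "y \<in> topspace Y" for x y s
      using sg[OF that] by (simp add: m_def flip: sum_distrib_left)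
    fix p p' assume pp: "p \<in> join_points X Y" "p' \<in> join_points X Y" and e: "?h p = ?h p'"
    have em: "m (?h p) = m (?h p')" using e by simp
    have eL: "?h p (Inl a) = ?h p' (Inl a)" and eR: "?h p (Inr b) = ?h p' (Inr b)" for a b using e by simp_all
    consider x where "x \<in> topspace X" "p = JLeft x" | y where "y \<in> topspace Y" "p = JRight y" |
      x y s where "x \<in> topspace X" "y \<in> topspace Y" "0 < s" "s < 1" "p = JMid x y s" using jp[OF pp(1)] by blast
    then show "p = p'"
    proof cases
      case 1
      then have "m (?h p') = 0" using em mL by simp
      then obtain x' where x': "x' \<in> topspace X" "p' = JLeft x'" using jp[OF pp(2)] mR mM by force
      then have "f x = f x'" using eL 1 by (intro ext) simp
      then show ?thesis using fi 1 x' by (auto dest: inj_onD)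
    next
      case 2
      then have "m (?h p') = 1" using em mR by simp
      then obtain y' where y': "y' \<in> topspace Y" "p' = JRight y'" using jp[OF pp(2)] mL mM by force
      then have "g y = g y'" using eR 2 by (intro ext) simp
      then show ?thesis using gi 2 y' by (auto dest: inj_onD)
    next
      case 3
      then have ms: "m (?h p') = s" using em mM by simp
      then obtain x' y' s' where p': "x' \<in> topspace X" "y' \<in> topspace Y" "p' = JMid x' y' s'"
        using jp[OF pp(2)] mL mR 3 by force
      then have "s' = s" using ms mM by simp
      then have "f x = f x'" "g y = g y'" using eL eR 3 p' by (auto intro!: ext)
      then show ?thesis using fi gi 3 p' \<open>s' = s\<close> by (auto dest: inj_onD)
    qed
  qed
  have surj: "realization_points ?KL \<subseteq> ?h ` join_points X Y"
  proof
    fix t assume t: "t \<in> realization_points ?KL"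
    note T = realization_pointsD[OF t]
    have KA: "{a. t (Inl a) \<noteq> 0} \<in> K" and LB: "{b. t (Inr b) \<noteq> 0} \<in> L"
      using T(2) by (auto simp: join_complex_iff vimage_def)
    define s where "s = (\<Sum>b\<in>?B. t (Inr b))"
    define r where "r = (\<Sum>a\<in>?A. t (Inl a))"
    have "{v. t v \<noteq> 0} \<subseteq> ?A <+> ?B"
    proof
      fix v assume "v \<in> {v. t v \<noteq> 0}"
      then show "v \<in> ?A <+> ?B" using KA LB by (cases v) auto
    qed
    then have rs: "r + s = 1"
      using realization_points_sum[OF t, of "?A <+> ?B"] finA finB by (simp add: sum_Plus_real r_def s_def)
    have r0: "0 \<le> r" and s0: "0 \<le> s" using T(1) by (auto simp: r_def s_def intro: sum_nonneg)
    have outA: "t (Inl a) = 0" if "a \<notin> ?A" for a using KA that by auto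
    have outB: "t (Inr b) = 0" if "b \<notin> ?B" for b using LB that by auto
    have A0: "t (Inl a) = 0" if "r = 0" for a
      using that outA[of a] sum_nonneg_eq_0_iff[OF finA, of "\<lambda>a. t (Inl a)"] T(1) by (auto simp: r_def)
    have B0: "t (Inr b) = 0" if "s = 0" for b
      using that outB[of b] sum_nonneg_eq_0_iff[OF finB, of "\<lambda>b. t (Inr b)"] T(1) by (auto simp: s_def)
    have ex_x: "\<exists>x\<in>topspace X. f x = (\<lambda>a. t (Inl a) / r)" if "r \<noteq> 0"
    proof -
      have "(\<lambda>a. t (Inl a) / r) \<in> realization_points K"
        by (rule realization_pointsI[of _ _ ?A])
          (use T(1) r0 KA finA that in \<open>auto simp: r_def simp flip: sum_divide_distrib\<close>)
      then show ?thesis using fX by (metis imageE)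
    qed
    have ex_y: "\<exists>y\<in>topspace Y. g y = (\<lambda>b. t (Inr b) / s)" if "s \<noteq> 0"
    proof -
      have "(\<lambda>b. t (Inr b) / s) \<in> realization_points L"
        by (rule realization_pointsI[of _ _ ?B])
          (use T(1) s0 LB finB that in \<open>auto simp: s_def simp flip: sum_divide_distrib\<close>)
      then show ?thesis using gY by (metis imageE)
    qed
    consider "s = 0" "r = 1" | "r = 0" "s = 1" | "0 < s" "s < 1" "0 < r" using rs r0 s0 by linarith
    then show "t \<in> ?h ` join_points X Y"
    proof cases
      case 1
      then obtain x where "x \<in> topspace X" "f x = (\<lambda>a. t (Inl a) / r)" using ex_x by auto
      then have "t = ?h (JLeft x)" "JLeft x \<in> join_points X Y"
        using B0 1 by (auto simp: fun_eq_iff join_points_def split: sum.split)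
      then show ?thesis by blast
    next
      case 2
      then obtain y where "y \<in> topspace Y" "g y = (\<lambda>b. t (Inr b) / s)" using ex_y by auto
      then have "t = ?h (JRight y)" "JRight y \<in> join_points X Y"
        using A0 2 by (auto simp: fun_eq_iff join_points_def split: sum.split)
      then show ?thesis by blast
    next
      case 3
      obtain x where x: "x \<in> topspace X" "f x = (\<lambda>a. t (Inl a) / r)" using ex_x 3 by auto
      obtain y where y: "y \<in> topspace Y" "g y = (\<lambda>b. t (Inr b) / s)" using ex_y 3 by auto
      have "1 - s = r" using rs by simp
      then have "t = ?h (JMid x y s)" using x y 3 by (auto simp: fun_eq_iff split: sum.split)
      moreover have "join_map (x, y, s) \<in> join_points X Y"
        using x y 3 unfolding join_points_def join_cylinder_def by (intro UnI2 imageI) auto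
      then have "JMid x y s \<in> join_points X Y" using 3 by simp
      ultimately show ?thesis by (rule image_eqI)
    qed
  qed
  have "?h ` join_points X Y = realization_points ?KL"
    using surj continuous_map_image_subset_topspace[OF cont] by auto
  then show ?thesis
    using cont inj by (intro continuous_imp_homeomorphic_map compact_space_join compX compY Hausdorff_realization) simp_all
qed

section \<open>Wedges of realizations\<close>

definition wedge_vertex :: "'v \<Rightarrow> 'i \<Rightarrow> 'v \<Rightarrow> ('i \<times> 'v) option" where
  "wedge_vertex b i v = (if v = b then None else Some (i, v))"

definition wedge_complex :: "'i set \<Rightarrow> 'v \<Rightarrow> 'v set set \<Rightarrow> ('i \<times> 'v) option set set" where
  "wedge_complex I b K = {wedge_vertex b i ` \<sigma> | i \<sigma>. i \<in> I \<and> \<sigma> \<in> K}"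

lemma wedge_vertex_inj: "inj (wedge_vertex b i)"
  by (rule injI) (auto simp: wedge_vertex_def split: if_splits)

lemma wedge_vertex_image_iff:
  "None \<in> wedge_vertex b i ` \<sigma> \<longleftrightarrow> b \<in> \<sigma>"
  "Some (j, v) \<in> wedge_vertex b i ` \<sigma> \<longleftrightarrow> j = i \<and> v \<noteq> b \<and> v \<in> \<sigma>"
  by (auto simp: wedge_vertex_def image_iff split: if_splits)

lemma simplicial_complex_wedge:
  assumes "finite I" and K: "simplicial_complex K"
  shows "simplicial_complex (wedge_complex I b K)"
proof (rule simplicial_complexI)
  have "wedge_complex I b K = (\<lambda>(i, \<sigma>). wedge_vertex b i ` \<sigma>) ` (I \<times> K)"
    by (auto simp: wedge_complex_def)
  then show "finite (wedge_complex I b K)" using assms simplicial_complexD(1)[OF K] by simp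
  show "finite \<sigma>" if "\<sigma> \<in> wedge_complex I b K" for \<sigma>
    using that simplicial_complexD(2)[OF K] by (auto simp: wedge_complex_def)
  show "\<rho> \<in> wedge_complex I b K" if \<sigma>: "\<sigma> \<in> wedge_complex I b K" and \<rho>: "\<rho> \<subseteq> \<sigma>" for \<sigma> \<rho>
  proof -
    obtain i \<tau> where i: "i \<in> I" "\<tau> \<in> K" "\<sigma> = wedge_vertex b i ` \<tau>" using \<sigma> by (auto simp: wedge_complex_def)
    then obtain \<upsilon> where "\<upsilon> \<subseteq> \<tau>" "\<rho> = wedge_vertex b i ` \<upsilon>" using \<rho> by (auto simp: subset_image_iff)
    then show ?thesis using i simplicial_complexD(3)[OF K] unfolding wedge_complex_def by blast
  qed
qed

text \<open>\<open>b\<close> and \<open>s\<close> act as opposite poles. The faces avoiding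
  \<open>s\<close> are closed under toggling \<open>b\<close>, so in the wedge they are erased by
  toggling the base vertex \<open>None\<close>. What is left is the disjoint union over
  \<open>I\<close> of the open stars of \<open>s\<close>, and each of them is closed under
  cofaces.\<close>

lemma spherical_wedge:
  fixes I :: "'i set" and K :: "'v set set"
  assumes "finite I" and K: "simplicial_complex K"
    and b: "\<And>\<sigma>. \<sigma> \<in> K \<Longrightarrow> s \<notin> \<sigma> \<Longrightarrow> insert b \<sigma> \<in> K" and sb: "\<And>\<sigma>. \<sigma> \<in> K \<Longrightarrow> s \<in> \<sigma> \<Longrightarrow> b \<notin> \<sigma>" "s \<noteq> b"
    and sph: "spherical {\<sigma> \<in> K. s \<in> \<sigma>} N d"
  shows "spherical (wedge_complex I b K) (card I * N) d"
proof -
  let ?W = "wedge_complex I b K" and ?R = "{\<sigma> \<in> K. s \<in> \<sigma>}"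
  \<comment> \<open>A face of the wedge lies in one copy, so at most one index i qualifies and
    \<open>THE\<close> is meaningful.\<close>
  define f where "f = (\<lambda>\<tau> :: ('i \<times> 'v) option set. if \<exists>i. Some (i, s) \<in> \<tau> then Some (THE i. Some (i, s) \<in> \<tau>) else None)"
  define n where "n = (\<lambda>j :: 'i option. case j of None \<Rightarrow> 0 | Some i \<Rightarrow> N)"
  have f_img: "f (wedge_vertex b i ` \<sigma>) = (if s \<in> \<sigma> then Some i else None)" for i \<sigma>
    by (simp add: f_def wedge_vertex_image_iff sb(2))
  have finW: "finite ?W" using simplicial_complexD(1)[OF simplicial_complex_wedge[OF assms(1) K]] .
  have up: "f \<rho> = f \<sigma>" if "\<sigma> \<in> ?W" "\<rho> \<in> ?W" "\<sigma> \<subseteq> \<rho>" "f \<sigma> \<noteq> None" for \<sigma> \<rho>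
  proof -
    obtain i \<sigma>' where i: "\<sigma> = wedge_vertex b i ` \<sigma>'" using \<open>\<sigma> \<in> ?W\<close> by (auto simp: wedge_complex_def)
    obtain j \<rho>' where j: "\<rho> = wedge_vertex b j ` \<rho>'" using \<open>\<rho> \<in> ?W\<close> by (auto simp: wedge_complex_def)
    have "s \<in> \<sigma>'" using \<open>f \<sigma> \<noteq> None\<close> i f_img by (auto split: if_splits)
    then have "Some (i, s) \<in> \<sigma>" using i sb(2) by (simp add: wedge_vertex_image_iff)
    then have "Some (i, s) \<in> \<rho>" using \<open>\<sigma> \<subseteq> \<rho>\<close> by blast
    then have "j = i" "s \<in> \<rho>'" using j by (simp_all add: wedge_vertex_image_iff)
    then show ?thesis using f_img i j \<open>s \<in> \<sigma>'\<close> by simp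
  qed
  have "spherical ?W (\<Sum>j\<in>f ` ?W. n j) d"
  proof (rule spherical_patchwork[where rank = "\<lambda>j. if j = None then 0 else 1", OF finW])
    show "f \<sigma> = f \<rho> \<or> (if f \<sigma> = None then 0 else 1 :: nat) < (if f \<rho> = None then 0 else 1)"
      if "\<sigma> \<in> ?W" "\<rho> \<in> ?W" "\<sigma> \<subseteq> \<rho>" for \<sigma> \<rho>
      using up[OF that] by (cases "f \<sigma>"; cases "f \<rho>") auto
    show "f \<rho> = f \<sigma>" if "\<sigma> \<in> ?W" "\<rho> \<in> ?W" "\<sigma> \<subseteq> \<rho>" "n (f \<sigma>) \<noteq> 0" for \<sigma> \<rho>
      using up[OF that(1-3)] that(4) by (cases "f \<sigma>") (auto simp: n_def)
    show "spherical {\<tau> \<in> ?W. f \<tau> = j} (n j) d" if j: "j \<in> f ` ?W" for j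
    proof (cases j)
      case None
      have "erasable {\<tau> \<in> ?W. f \<tau> = None}"
      proof (rule erasable_toggle[where v = None])
        fix \<tau> assume \<tau>: "\<tau> \<in> {\<tau> \<in> ?W. f \<tau> = None}"
        then obtain i \<sigma> where i: "i \<in> I" "\<sigma> \<in> K" "\<tau> = wedge_vertex b i ` \<sigma>" by (auto simp: wedge_complex_def)
        then have s: "s \<notin> \<sigma>" using \<tau> f_img by (auto split: if_splits)
        have eq: "insert None \<tau> = wedge_vertex b i ` insert b \<sigma>" "\<tau> - {None} = wedge_vertex b i ` (\<sigma> - {b})"
          using i by (auto simp: wedge_vertex_def split: if_splits)
        have "insert b \<sigma> \<in> K" "\<sigma> - {b} \<in> K"
          using b[OF i(2) s] simplicial_complexD(3)[OF K i(2)] by auto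
        then show "insert None \<tau> \<in> {\<tau> \<in> ?W. f \<tau> = None} \<and> \<tau> - {None} \<in> {\<tau> \<in> ?W. f \<tau> = None}"
        proof -
          have "s \<notin> insert b \<sigma>" "s \<notin> \<sigma> - {b}" using s sb(2) by auto
          then have "f (insert None \<tau>) = None" "f (\<tau> - {None}) = None"
            unfolding eq f_img by simp_all
          moreover have "insert None \<tau> \<in> ?W" "\<tau> - {None} \<in> ?W"
            unfolding eq wedge_complex_def using i(1) \<open>insert b \<sigma> \<in> K\<close> \<open>\<sigma> - {b} \<in> K\<close> by blast+
          ultimately show ?thesis by simp
        qed
      qed (use finW in simp)
      then show ?thesis using None finW by (auto simp: n_def intro: spherical_erasable)
    next
      case (Some i)
      have "i \<in> I" using j Some f_img by (auto simp: wedge_complex_def split: if_splits)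
      then have "{\<tau> \<in> ?W. f \<tau> = j} = (`) (wedge_vertex b i) ` ?R"
      proof (intro equalityI subsetI)
        fix \<tau> assume \<tau>: "\<tau> \<in> {\<tau> \<in> ?W. f \<tau> = j}"
        then obtain k \<sigma> where k: "k \<in> I" "\<sigma> \<in> K" "\<tau> = wedge_vertex b k ` \<sigma>" by (auto simp: wedge_complex_def)
        then have "(if s \<in> \<sigma> then Some k else None) = Some i" using \<tau> Some f_img[of k \<sigma>] by simp
        then have "k = i" "s \<in> \<sigma>" by (auto split: if_splits)
        then show "\<tau> \<in> (`) (wedge_vertex b i) ` ?R" using k by blast
      next
        fix \<tau> assume "\<tau> \<in> (`) (wedge_vertex b i) ` ?R"
        then obtain \<sigma> where \<sigma>: "\<sigma> \<in> K" "s \<in> \<sigma>" "\<tau> = wedge_vertex b i ` \<sigma>" by blast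
        then show "\<tau> \<in> {\<tau> \<in> ?W. f \<tau> = j}"
          using \<open>i \<in> I\<close> Some f_img[of i \<sigma>] unfolding wedge_complex_def by auto
      qed
      moreover have "spherical ((`) (wedge_vertex b i) ` ?R) N d"
        by (rule spherical_image[OF sph]) (rule inj_on_subset[OF wedge_vertex_inj], simp)
      ultimately show ?thesis by (simp add: n_def Some)
    qed
  qed
  moreover have "(\<Sum>j\<in>f ` ?W. n j) = card I * N"
  \<comment> \<open>For nonzero \<open>N\<close> some face of \<open>K\<close> contains
    \<open>s\<close>, so every index of \<open>I\<close> occurs as a value of \<open>f\<close>; for
    \<open>N = 0\<close> both sides vanish.\<close>
  proof (cases "N = 0")
    case True
    then have "n j = 0" for j by (cases j) (simp_all add: n_def)
    then show ?thesis using True by simp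
  next
    case False
    have "?R \<noteq> {}"
    proof
      assume R: "?R = {}"
      obtain F where F: "F \<subseteq> ?R" "card F = N" using sph by (rule sphericalE)
      then have "F = {}" unfolding R by simp
      then show False using F(2) False by simp
    qed
    then obtain \<sigma> where \<sigma>: "\<sigma> \<in> K" "s \<in> \<sigma>" by blast
    have sub: "Some ` I \<subseteq> f ` ?W"
    proof
      fix j assume "j \<in> Some ` I"
      then obtain i where i: "j = Some i" "i \<in> I" by blast
      have "f (wedge_vertex b i ` \<sigma>) = j" using f_img[of i \<sigma>] \<sigma>(2) i by simp
      moreover have "wedge_vertex b i ` \<sigma> \<in> ?W" using i \<sigma>(1) by (auto simp: wedge_complex_def)
      ultimately show "j \<in> f ` ?W" by blast
    qed
    have "(\<Sum>j\<in>f ` ?W. n j) = (\<Sum>j\<in>Some ` I. n j)"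
    proof (rule sum.mono_neutral_right[OF _ sub])
      show "\<forall>j\<in>f ` ?W - Some ` I. n j = 0"
      proof
        fix j assume j: "j \<in> f ` ?W - Some ` I"
        then have "j = None" using f_img by (auto simp: wedge_complex_def split: if_splits)
        then show "n j = 0" by (simp add: n_def)
      qed
    qed (use finW in simp)
    also have "\<dots> = (\<Sum>i\<in>I. N)" by (subst sum.reindex) (auto simp: n_def)
    finally show ?thesis by simp
  qed
  ultimately show ?thesis by simp
qed

text \<open>Toggle (j, True) for the first j such that (j, False) is missing. Only the facet of all
  (i, False) with i \<le> d, where this j is d + 1, stays unmatched, and it has d + 1
  vertices.\<close>

lemma spherical_cross_polytope: "spherical {\<sigma> \<in> cross_polytope d. (0, False) \<in> \<sigma>} 1 (Suc d)"
proof -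
  let ?D = "{\<sigma> \<in> cross_polytope d. (0, False) \<in> \<sigma>}"
  define f where "f = (\<lambda>\<sigma> :: (nat \<times> bool) set. LEAST j. (j, False) \<notin> \<sigma>)"
  have D: "\<sigma> \<subseteq> {..d} \<times> UNIV" "(i, True) \<in> \<sigma> \<Longrightarrow> (i, False) \<notin> \<sigma>" "(0, False) \<in> \<sigma>" if "\<sigma> \<in> ?D" for \<sigma> i
    using that by (auto simp: cross_polytope_def)
  have finD: "finite ?D" using simplicial_complexD(1)[OF simplicial_complex_cross_polytope] by simp
  have f_notin: "(f \<sigma>, False) \<notin> \<sigma>" and f_le: "f \<sigma> \<le> Suc d" if "\<sigma> \<in> ?D" for \<sigma>
  proof -
    have "(Suc d, False) \<notin> \<sigma>" using D(1)[OF that] by auto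
    then show "(f \<sigma>, False) \<notin> \<sigma>" "f \<sigma> \<le> Suc d"
      unfolding f_def by (rule LeastI, rule Least_le)
  qed
  have f_less: "(j, False) \<in> \<sigma>" if "j < f \<sigma>" for j \<sigma> using not_less_Least that unfolding f_def by blast
  let ?top = "{..d} \<times> {False}"
  have top_f: "\<sigma> = ?top" if \<sigma>: "\<sigma> \<in> ?D" "f \<sigma> = Suc d" for \<sigma>
  proof
    show "?top \<subseteq> \<sigma>" using f_less[of _ \<sigma>] \<sigma>(2) by auto
    show "\<sigma> \<subseteq> ?top"
    proof
      fix a assume a: "a \<in> \<sigma>"
      obtain i s where a_eq: "a = (i, s)" by (cases a)
      then have "i \<le> d" using D(1)[OF \<sigma>(1)] a by auto
      then have "(i, False) \<in> \<sigma>" using f_less[of i \<sigma>] \<sigma>(2) by simp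
      then show "a \<in> ?top" using D(2)[OF \<sigma>(1), of i] a a_eq \<open>i \<le> d\<close> by (cases s) auto
    qed
  qed
  have topD: "?top \<in> ?D" by (auto simp: cross_polytope_def)
  have ftop: "f ?top = Suc d"
    unfolding f_def by (rule Least_equality) (auto simp: not_less_eq_eq[symmetric])
  have mono: "f \<sigma> \<le> f \<rho>" if "\<rho> \<in> ?D" "\<sigma> \<subseteq> \<rho>" for \<sigma> \<rho>
  proof -
    have "(f \<rho>, False) \<notin> \<sigma>" using f_notin[OF that(1)] that(2) by blast
    then show ?thesis unfolding f_def by (rule Least_le)
  qed
  have "spherical ?D (\<Sum>j\<in>f ` ?D. if j = Suc d then 1 else 0) (Suc d)"
  proof (rule spherical_patchwork[where rank = id, OF finD])
    show "f \<sigma> = f \<rho> \<or> id (f \<sigma>) < id (f \<rho>)" if "\<sigma> \<in> ?D" "\<rho> \<in> ?D" "\<sigma> \<subseteq> \<rho>" for \<sigma> \<rho>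
      using mono[OF that(2,3)] by auto
    show "f \<rho> = f \<sigma>" if "\<sigma> \<in> ?D" "\<rho> \<in> ?D" "\<sigma> \<subseteq> \<rho>" "(if f \<sigma> = Suc d then 1 else 0 :: nat) \<noteq> 0" for \<sigma> \<rho>
      using mono[OF that(2,3)] f_le[OF that(2)] that(4) by (auto split: if_splits)
    show "spherical {\<sigma> \<in> ?D. f \<sigma> = j} (if j = Suc d then 1 else 0) (Suc d)" if j: "j \<in> f ` ?D" for j
    proof (cases "j = Suc d")
      case True
      then have "{\<sigma> \<in> ?D. f \<sigma> = j} = {?top}" using top_f topD ftop by blast
      then show ?thesis using True spherical_singleton[of ?top] by (simp add: card_cartesian_product)
    next
      case False
      then have jd: "j \<le> d" using j f_le by fastforce
      have "erasable {\<sigma> \<in> ?D. f \<sigma> = j}"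
      proof (rule erasable_toggle[where v = "(j, True)"])
        fix \<sigma> assume \<sigma>: "\<sigma> \<in> {\<sigma> \<in> ?D. f \<sigma> = j}"
        then have j_out: "(j, False) \<notin> \<sigma>" using f_notin by blast
        have f_same: "f (insert (j, True) \<sigma>) = f \<sigma>" "f (\<sigma> - {(j, True)}) = f \<sigma>" by (simp_all add: f_def)
        have "j \<noteq> 0" using D(3)[of \<sigma>] \<sigma> j_out by (cases j) auto
        then show "insert (j, True) \<sigma> \<in> {\<sigma> \<in> ?D. f \<sigma> = j} \<and> \<sigma> - {(j, True)} \<in> {\<sigma> \<in> ?D. f \<sigma> = j}"
          using \<sigma> jd j_out f_same by (auto simp: cross_polytope_def)
      qed (rule finite_subset[OF _ finD], auto)
      moreover have "finite {\<sigma> \<in> ?D. f \<sigma> = j}" by (rule finite_subset[OF _ finD]) auto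
      ultimately show ?thesis using False spherical_erasable by simp
    qed
  qed
  moreover have "(\<Sum>j\<in>f ` ?D. if j = Suc d then 1 else 0) = (1 :: nat)"
  proof -
    have "Suc d \<in> f ` ?D" using imageI[OF topD, of f] unfolding ftop .
    moreover have "finite (f ` ?D)" using finD by (rule finite_imageI)
    ultimately show ?thesis by (simp only: sum.delta if_True)
  qed
  ultimately show ?thesis by simp
qed

definition wedge_coordinates :: "('x \<Rightarrow> 'v \<Rightarrow> real) \<Rightarrow> 'v \<Rightarrow> 'i \<Rightarrow> 'x \<Rightarrow> ('i \<times> 'v) option \<Rightarrow> real" where
  "wedge_coordinates f b i x w =
    (case w of None \<Rightarrow> f x b | Some (j, v) \<Rightarrow> if j = i \<and> v \<noteq> b then f x v else 0)"

text \<open>Serves both induced spaces and wedges of spheres: \<open>\<kappa>\<close> tells to which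
  copy a point belongs, and \<open>fibres\<close> says that different copies meet only in the base
  point. The map into the realization has the same fibres and is a quotient map, as it leads from a
  compact space onto a Hausdorff one.\<close>

lemma wedge_homeomorphic:
  assumes K: "simplicial_complex K" and I: "finite I"
    and f: "homeomorphic_map X (realization K) f" and x\<^sub>0: "x\<^sub>0 \<in> topspace X" "f x\<^sub>0 = vertex b"
    and q: "quotient_map Z Y q" and Z: "compact_space Z" "topspace Z = A \<times> topspace X" "\<kappa> ` A = I"
    and cont: "continuous_map Z X snd" "\<And>j. continuous_map Z euclideanreal (\<lambda>z. if \<kappa> (fst z) = j then 1 else 0)"
    and fibres: "\<And>a x a' x'. (a, x) \<in> topspace Z \<Longrightarrow> (a', x') \<in> topspace Z \<Longrightarrow>
      q (a, x) = q (a', x') \<longleftrightarrow> \<kappa> a = \<kappa> a' \<and> x = x' \<or> x = x\<^sub>0 \<and> x' = x\<^sub>0"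
  shows "Y homeomorphic_space realization (wedge_complex I b K)"
proof (rule quotient_maps_homeomorphic[OF q])
  let ?W = "wedge_complex I b K" and ?r = "\<lambda>z. wedge_coordinates f b (\<kappa> (fst z)) (snd z)"
  have fX: "f ` topspace X = realization_points K" and fi: "inj_on f (topspace X)"
    and fc: "continuous_map X (realization K) f"
    using homeomorphic_imp_surjective_map[OF f] homeomorphic_imp_injective_map[OF f] homeomorphic_imp_continuous_map[OF f] by auto
  have fpt: "f x \<in> realization_points K" if "x \<in> topspace X" for x using fX that by blast
  have r_vertex: "wedge_coordinates f b i x (wedge_vertex b i v) = f x v" for i x v
    by (simp add: wedge_coordinates_def wedge_vertex_def)
  have r_out: "wedge_coordinates f b i x w = 0" if "w \<notin> range (wedge_vertex b i)" for i x w
  proof (cases w)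
    case None
    then have "w = wedge_vertex b i b" by (simp add: wedge_vertex_def)
    then show ?thesis using \<open>w \<notin> range (wedge_vertex b i)\<close> by blast
  next
    case (Some jv)
    obtain j v where jv: "jv = (j, v)" by (cases jv)
    have "\<not> (j = i \<and> v \<noteq> b)"
    proof
      assume "j = i \<and> v \<noteq> b"
      then have "w = wedge_vertex b i v" using Some jv by (simp add: wedge_vertex_def)
      then show False using \<open>w \<notin> range (wedge_vertex b i)\<close> by blast
    qed
    then show ?thesis using Some jv by (auto simp: wedge_coordinates_def)
  qed
  have r_in: "wedge_coordinates f b i x \<in> realization_points ?W" if i: "i \<in> I" and x: "x \<in> topspace X" for i x
  proof -
    let ?\<sigma> = "{v. f x v \<noteq> 0}"
    note F = realization_pointsD[OF fpt[OF x]]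
    have fin: "finite ?\<sigma>" using simplicial_complexD(2)[OF K F(2)] .
    have supp: "{w. wedge_coordinates f b i x w \<noteq> 0} = wedge_vertex b i ` ?\<sigma>"
    proof (intro equalityI subsetI)
      fix w assume w: "w \<in> {w. wedge_coordinates f b i x w \<noteq> 0}"
      then have "w \<in> range (wedge_vertex b i)" using r_out[of w i x] by auto
      then obtain v where v: "w = wedge_vertex b i v" by blast
      then have "f x v \<noteq> 0" using w r_vertex[of i x v] by simp
      then show "w \<in> wedge_vertex b i ` ?\<sigma>" using v by blast
    qed (use r_vertex[of i x] in auto)
    show ?thesis
    proof (rule realization_pointsI[of _ _ "wedge_vertex b i ` ?\<sigma>"])
      show "0 \<le> wedge_coordinates f b i x w" for w
        using F(1) by (auto simp: wedge_coordinates_def split: option.split)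
      show "{w. wedge_coordinates f b i x w \<noteq> 0} \<in> ?W" unfolding supp wedge_complex_def using i F(2) by blast
      have "sum (wedge_coordinates f b i x) (wedge_vertex b i ` ?\<sigma>) = sum (f x) ?\<sigma>"
        by (subst sum.reindex[OF inj_on_subset[OF wedge_vertex_inj]]) (auto simp: r_vertex)
      also have "\<dots> = 1" using fpt[OF x] by (simp add: realization_points_def)
      finally show "sum (wedge_coordinates f b i x) (wedge_vertex b i ` ?\<sigma>) = 1" .
    qed (use fin supp in auto)
  qed
  show "quotient_map Z (realization ?W) ?r"
  proof (rule continuous_imp_quotient_map)
    have cf: "continuous_map Z euclideanreal (\<lambda>z. f (snd z) v)" for v
      using continuous_map_compose[OF cont(1), of euclideanreal "\<lambda>x. f x v"] fc
      by (simp add: continuous_map_into_realization o_def)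
    have "continuous_map Z euclideanreal (\<lambda>z. ?r z w)" for w
    proof (cases w)
      case None
      then show ?thesis using cf by (simp add: wedge_coordinates_def)
    next
      case (Some jv)
      obtain j v where jv: "jv = (j, v)" by (cases jv)
      have "?r z w = (if \<kappa> (fst z) = j then 1 else 0) * (if v \<noteq> b then f (snd z) v else 0)" for z
        using Some jv by (auto simp: wedge_coordinates_def)
      moreover have "continuous_map Z euclideanreal (\<lambda>z. (if \<kappa> (fst z) = j then 1 else 0) * (if v \<noteq> b then f (snd z) v else 0))"
        by (intro continuous_map_real_mult cont) (cases "v = b"; simp add: cf)
      ultimately show ?thesis by simp
    qed
    then show "continuous_map Z (realization ?W) ?r"
      unfolding continuous_map_into_realization using Z r_in by auto
    show "?r ` topspace Z = topspace (realization ?W)"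
    proof (intro equalityI subsetI)
      fix t assume "t \<in> ?r ` topspace Z"
      then show "t \<in> topspace (realization ?W)" using Z r_in by auto
    next
      fix t assume "t \<in> topspace (realization ?W)"
      then have t: "t \<in> realization_points ?W" by simp
      note T = realization_pointsD[OF t]
      obtain i \<sigma> where i: "i \<in> I" "\<sigma> \<in> K" "{w. t w \<noteq> 0} = wedge_vertex b i ` \<sigma>"
        using T(2) by (auto simp: wedge_complex_def)
      have fin: "finite \<sigma>" using simplicial_complexD(2)[OF K i(2)] .
      let ?u = "\<lambda>v. t (wedge_vertex b i v)"
      have supp: "{v. ?u v \<noteq> 0} = \<sigma>"
        using i(3) wedge_vertex_inj[of b i] by (auto simp: inj_def set_eq_iff image_iff)
      have "sum ?u \<sigma> = sum t (wedge_vertex b i ` \<sigma>)"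
        by (subst sum.reindex[OF inj_on_subset[OF wedge_vertex_inj]]) auto
      also have "\<dots> = 1" by (rule realization_points_sum[OF t]) (use fin i(3) in auto)
      finally have "?u \<in> realization_points K"
        using T(1) supp i(2) fin by (intro realization_pointsI[of _ _ \<sigma>]) auto
      then obtain x where x: "x \<in> topspace X" "f x = ?u" using fX by (metis imageE)
      obtain a where a: "a \<in> A" "\<kappa> a = i" using Z(3) i(1) by blast
      have "t w = wedge_coordinates f b i x w" for w
      proof (cases "w \<in> range (wedge_vertex b i)")
        case True
        then obtain v where "w = wedge_vertex b i v" by blast
        then show ?thesis using x r_vertex[of i x v] by simp
      next
        case False
        then have "t w = 0" using i(3) by blast
        then show ?thesis using r_out[OF False] by simp
      qed
      then have "t = ?r (a, x)" using a by auto
      then show "t \<in> ?r ` topspace Z" using a x Z(2) by blast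
    qed
  qed (use Z Hausdorff_realization in auto)
  fix z z' assume zz: "z \<in> topspace Z" "z' \<in> topspace Z"
  obtain a x a' x' where ax: "z = (a, x)" "z' = (a', x')" by (cases z; cases z')
  have xs: "x \<in> topspace X" "x' \<in> topspace X" using zz ax Z(2) by auto
  have "?r z = ?r z' \<longleftrightarrow> \<kappa> a = \<kappa> a' \<and> x = x' \<or> x = x\<^sub>0 \<and> x' = x\<^sub>0"
  proof
    assume e: "?r z = ?r z'"
    show "\<kappa> a = \<kappa> a' \<and> x = x' \<or> x = x\<^sub>0 \<and> x' = x\<^sub>0"
    proof (cases "\<kappa> a = \<kappa> a'")
      case True
      have "f x v = f x' v" for v
        using fun_cong[OF e, of "wedge_vertex b (\<kappa> a) v"] True ax by (simp add: r_vertex)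
      then have "f x = f x'" by auto
      then show ?thesis using fi xs True by (auto dest: inj_onD)
    next
      case False
      \<comment> \<open>Equal images from different copies can have weight only at the base vertex;
        as the total weight is 1, this is the base point.\<close>
      have *: "f y = vertex b" if y: "y \<in> topspace X" "\<And>v. v \<noteq> b \<Longrightarrow> f y v = 0" for y
      proof -
        have "{v. f y v \<noteq> 0} \<subseteq> {b}" using y(2) by blast
        then have "sum (f y) {b} = 1" by (intro realization_points_sum[OF fpt[OF y(1)]]) auto
        then show ?thesis using y(2) by (auto simp: vertex_def)
      qed
      have "f x v = 0" if "v \<noteq> b" for v
        using fun_cong[OF e, of "Some (\<kappa> a, v)"] False ax that by (simp add: wedge_coordinates_def)
      then have "f x = f x\<^sub>0" using * xs x\<^sub>0 by simp
      moreover have "f x' v = 0" if "v \<noteq> b" for v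
        using fun_cong[OF e, of "Some (\<kappa> a', v)"] False ax that by (simp add: wedge_coordinates_def)
      then have "f x' = f x\<^sub>0" using * xs x\<^sub>0 by simp
      ultimately show ?thesis using fi xs x\<^sub>0(1) by (auto dest: inj_onD)
    qed
  next
    assume "\<kappa> a = \<kappa> a' \<and> x = x' \<or> x = x\<^sub>0 \<and> x' = x\<^sub>0"
    then show "?r z = ?r z'"
      using ax x\<^sub>0(2) by (auto simp: wedge_coordinates_def vertex_def split: option.split)
  qed
  then show "q z = q z' \<longleftrightarrow> ?r z = ?r z'" using fibres zz ax by simp
qed

section \<open>Fixed partitions\<close>

definition part_rel :: "'e set set \<Rightarrow> ('e \<times> 'e) set" where
  "part_rel Q = {(x, y). \<exists>B\<in>Q. x \<in> B \<and> y \<in> B}"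

lemma part_rel_quotient: "equiv E x \<Longrightarrow> part_rel (E // x) = x"
  unfolding part_rel_def
  by (auto simp: quotient_def elim!: equivE dest: symD transD refl_onD)

lemma quotient_part_rel: "partition_on E Q \<Longrightarrow> E // part_rel Q = Q"
  unfolding part_rel_def by (rule partition_on_eq_quotient)

lemma equiv_part_rel: "partition_on E Q \<Longrightarrow> equiv E (part_rel Q)"
  unfolding part_rel_def by (rule equiv_partition_on)

lemma refines_iff_part_rel:
  assumes P: "partition_on E P" and Q: "partition_on E Q"
  shows "refines E P Q \<longleftrightarrow> part_rel P \<subseteq> part_rel Q"
proof
  assume ref: "refines E P Q"
  show "part_rel P \<subseteq> part_rel Q"
  proof (rule subrelI)
    fix x y assume "(x, y) \<in> part_rel P"
    then obtain X where "X \<in> P" "x \<in> X" "y \<in> X" by (auto simp: part_rel_def)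
    moreover from this obtain Y where "Y \<in> Q" "X \<subseteq> Y" using ref by (auto simp: refines_def)
    ultimately show "(x, y) \<in> part_rel Q" by (auto simp: part_rel_def)
  qed
next
  assume sub: "part_rel P \<subseteq> part_rel Q"
  have "\<exists>Y\<in>Q. X \<subseteq> Y" if X: "X \<in> P" for X
  proof -
    have "X \<noteq> {}" using X partition_onD3[OF P] by auto
    then obtain x where x: "x \<in> X" by blast
    then have "(x, x) \<in> part_rel Q" using X sub by (auto simp: part_rel_def)
    then obtain Y where Y: "Y \<in> Q" "x \<in> Y" by (auto simp: part_rel_def)
    have "z \<in> Y" if z: "z \<in> X" for z
    proof -
      have "(x, z) \<in> part_rel Q" using x z X sub by (auto simp: part_rel_def)
      then obtain Z where Z: "Z \<in> Q" "x \<in> Z" "z \<in> Z" by (auto simp: part_rel_def)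
      then have "Z = Y" using Y partition_onD2[OF Q] by (auto simp: pairwise_def disjnt_iff)
      then show ?thesis using Z by simp
    qed
    then show ?thesis using Y by blast
  qed
  then show "refines E P Q" using P Q by (simp add: refines_def)
qed

lemma part_rel_inj: "partition_on E P \<Longrightarrow> partition_on E Q \<Longrightarrow> part_rel P = part_rel Q \<Longrightarrow> P = Q"
  using quotient_part_rel by metis

lemma part_rel_image: "part_rel ((`) h ` Q) = map_prod h h ` part_rel Q"
  unfolding part_rel_def by (force simp: image_iff)

context group_action
begin

definition fixes_partition :: "'c set set \<Rightarrow> bool" where
  "fixes_partition Q \<longleftrightarrow> (\<forall>g\<in>carrier G. (`) (\<phi> g) ` Q = Q)"

lemma partition_on_translate:
  assumes "g \<in> carrier G" "partition_on E Q"
  shows "partition_on E ((`) (\<phi> g) ` Q)"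
proof -
  have "(`) ((`) (\<phi> g)) Q - {{}} = (`) (\<phi> g) ` Q" using partition_onD3[OF assms(2)] by auto
  then show ?thesis
    using partition_on_inj_image[OF assms(2) inj_prop[OF assms(1)]] surj_prop[OF assms(1)] by simp
qed

lemma card_part_rel_translate:
  assumes "g \<in> carrier G" "partition_on E Q"
  shows "card (part_rel ((`) (\<phi> g) ` Q)) = card (part_rel Q)"
proof -
  have "part_rel Q \<subseteq> E \<times> E" using equiv_part_rel[OF assms(2)] by (rule equiv_type)
  then have "inj_on (map_prod (\<phi> g) (\<phi> g)) (part_rel Q)"
    using map_prod_inj_on[OF inj_prop[OF assms(1)] inj_prop[OF assms(1)]] inj_on_subset by blast
  then show ?thesis unfolding part_rel_image by (rule card_image)
qed

text \<open>Translation preserves the size of a partition, viewed as a set of pairs.\<close>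

lemma translate_eq_if_comparable:
  assumes "finite E" "g \<in> carrier G" and Q: "partition_on E Q"
    and "refines E Q ((`) (\<phi> g) ` Q) \<or> refines E ((`) (\<phi> g) ` Q) Q"
  shows "(`) (\<phi> g) ` Q = Q"
proof -
  let ?gQ = "(`) (\<phi> g) ` Q"
  have gQ: "partition_on E ?gQ" by (rule partition_on_translate[OF assms(2) Q])
  have fin: "finite (part_rel P)" if "partition_on E P" for P
    using equiv_type[OF equiv_part_rel[OF that]] assms(1) by (meson finite_SigmaI finite_subset)
  have "part_rel Q \<subseteq> part_rel ?gQ \<or> part_rel ?gQ \<subseteq> part_rel Q"
    using assms(4) refines_iff_part_rel[OF Q gQ] refines_iff_part_rel[OF gQ Q] by blast
  then have "part_rel ?gQ = part_rel Q"
    using card_subset_eq[OF fin[OF gQ], of "part_rel Q"] card_subset_eq[OF fin[OF Q], of "part_rel ?gQ"]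
      card_part_rel_translate[OF assms(2) Q] by auto
  then show ?thesis by (rule part_rel_inj[OF gQ Q])
qed

text \<open>Invariance of the relation only says that each translate refines the partition;
  comparable translates coincide, so this is already equality.\<close>

lemma fixes_partition_iff:
  assumes "finite E" and Q: "partition_on E Q"
  shows "fixes_partition Q \<longleftrightarrow> part_rel Q \<in> invariant_equivs"
proof
  assume fixed: "fixes_partition Q"
  have "map_prod (\<phi> g) (\<phi> g) ` part_rel Q = part_rel Q" if "g \<in> carrier G" for g
    using fixed that part_rel_image[of "\<phi> g" Q] by (simp add: fixes_partition_def)
  then have "(\<phi> g u, \<phi> g v) \<in> part_rel Q" if "g \<in> carrier G" "(u, v) \<in> part_rel Q" for g u v
    using that by (metis imageI map_prod_simp)
  then show "part_rel Q \<in> invariant_equivs"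
    using equiv_part_rel[OF Q] by (auto simp: invariant_equivs_def)
next
  assume inv: "part_rel Q \<in> invariant_equivs"
  show "fixes_partition Q"
    unfolding fixes_partition_def
  proof
    fix g assume g: "g \<in> carrier G"
    have "part_rel ((`) (\<phi> g) ` Q) \<subseteq> part_rel Q"
      unfolding part_rel_image using invariant_equivsD(5)[OF inv g] by auto
    then have "refines E ((`) (\<phi> g) ` Q) Q"
      using refines_iff_part_rel[OF partition_on_translate[OF g Q] Q] by simp
    then show "(`) (\<phi> g) ` Q = Q" using translate_eq_if_comparable[OF assms(1) g Q] by simp
  qed
qed

text \<open>Every orbit gets a representative. By freeness each point is a translate of it by a
  unique group element, and this element together with the representative forms the
  coordinates.\<close>

lemma ex_free_coordinates:
  assumes fin: "finite E" and free: "\<And>g u. g \<in> carrier G \<Longrightarrow> u \<in> E \<Longrightarrow> \<phi> g u = u \<Longrightarrow> g = \<one>"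
  obtains \<theta> S where "equivariant_coordinates G E \<phi> \<theta> (S :: 'c set)" "inj_on \<theta> E" "card E = order G * card S"
proof -
  interpret group G using group_hom by (simp add: group_hom_def)
  have one: "\<phi> \<one> u = u" if "u \<in> E" for u using id_eq_one that by (metis restrict_apply')
  have comp: "\<phi> (g \<otimes> h) u = \<phi> g (\<phi> h u)" if "g \<in> carrier G" "h \<in> carrier G" "u \<in> E" for g h u
    using composition_rule that by simp
  have mem: "\<phi> g u \<in> E" if "g \<in> carrier G" "u \<in> E" for g u using element_image that by blast
  have cancel: "\<phi> (inv g) (\<phi> g u) = u" if "g \<in> carrier G" "u \<in> E" for g u
    using comp[of "inv g" g u] one that by simp
  \<comment> \<open>The choice depends only on the orbit as a set, so it is constant along each
    orbit.\<close>
  define rep where "rep = (\<lambda>u. SOME v. v \<in> orbit G \<phi> u)"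
  have orbit_eq: "orbit G \<phi> (\<phi> g u) = orbit G \<phi> u" if g: "g \<in> carrier G" "u \<in> E" for g u
  proof (intro equalityI subsetI)
    fix v assume "v \<in> orbit G \<phi> (\<phi> g u)"
    then obtain h where h: "h \<in> carrier G" "v = \<phi> h (\<phi> g u)" by (auto simp: orbit_def)
    then have "v = \<phi> (h \<otimes> g) u" using comp g by simp
    then show "v \<in> orbit G \<phi> u" using h g by (auto simp: orbit_def)
  next
    fix v assume "v \<in> orbit G \<phi> u"
    then obtain h where h: "h \<in> carrier G" "v = \<phi> h u" by (auto simp: orbit_def)
    then have "v = \<phi> (h \<otimes> inv g) (\<phi> g u)" using comp[of h "inv g" "\<phi> g u"] cancel[OF g] mem[OF g] g by simp
    then show "v \<in> orbit G \<phi> (\<phi> g u)" using h g by (auto simp: orbit_def)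
  qed
  have rep_orbit: "\<exists>h\<in>carrier G. rep u = \<phi> h u" if "u \<in> E" for u
  proof -
    have "u \<in> orbit G \<phi> u" using one[OF that] unfolding orbit_def by (metis (mono_tags, lifting) mem_Collect_eq one_closed)
    then have "rep u \<in> orbit G \<phi> u" unfolding rep_def by (rule someI)
    then show ?thesis by (auto simp: orbit_def)
  qed
  have rep_mem: "rep u \<in> E" if "u \<in> E" for u using rep_orbit[OF that] mem that by auto
  have rep_translate: "rep (\<phi> g u) = rep u" if "g \<in> carrier G" "u \<in> E" for g u
    unfolding rep_def orbit_eq[OF that] ..
  have rep_rep: "rep (rep u) = rep u" if "u \<in> E" for u using rep_orbit[OF that] rep_translate that by auto
  have ex1: "\<exists>!g. g \<in> carrier G \<and> \<phi> g (rep u) = u" if u: "u \<in> E" for u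
  proof -
    obtain h where h: "h \<in> carrier G" "rep u = \<phi> h u" using rep_orbit[OF u] by blast
    have "\<phi> (inv h) (rep u) = u" using h cancel u by simp
    moreover have "g = g'" if g: "g \<in> carrier G" "\<phi> g (rep u) = u" "g' \<in> carrier G" "\<phi> g' (rep u) = u" for g g'
    proof -
      have "\<phi> (inv g' \<otimes> g) (rep u) = rep u"
        using comp[of "inv g'" g "rep u"] cancel[OF g(3) rep_mem[OF u]] g rep_mem[OF u] by simp
      then have "inv g' \<otimes> g = \<one>" using free[of "inv g' \<otimes> g" "rep u"] g rep_mem[OF u] by simp
      then show ?thesis using g by (metis inv_closed inv_equality inv_inv)
    qed
    ultimately show ?thesis using h by blast
  qed
  define \<gamma> where "\<gamma> = (\<lambda>u. THE g. g \<in> carrier G \<and> \<phi> g (rep u) = u)"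
  have \<gamma>: "\<gamma> u \<in> carrier G" "\<phi> (\<gamma> u) (rep u) = u" if "u \<in> E" for u
    using theI'[OF ex1[OF that]] by (auto simp: \<gamma>_def)
  have \<gamma>_eq: "\<gamma> u = g" if "u \<in> E" "g \<in> carrier G" "\<phi> g (rep u) = u" for u g
    using ex1[OF that(1)] \<gamma>[OF that(1)] that by blast
  let ?S = "rep ` E" and ?\<theta> = "\<lambda>u. (\<gamma> u, rep u)"
  have ec: "equivariant_coordinates G E \<phi> ?\<theta> ?S"
  proof
    show "finite E" by (rule fin)
    show "?\<theta> ` E = carrier G \<times> ?S"
    proof (intro equalityI subsetI)
      fix x assume "x \<in> carrier G \<times> ?S"
      then obtain g u where x: "x = (g, rep u)" "g \<in> carrier G" "u \<in> E" by auto
      let ?v = "\<phi> g (rep u)"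
      have "rep ?v = rep u" using rep_translate[OF x(2) rep_mem[OF x(3)]] rep_rep[OF x(3)] by simp
      moreover from this have "\<gamma> ?v = g" using \<gamma>_eq mem x rep_mem by simp
      moreover have "?v \<in> E" using x mem rep_mem by simp
      ultimately show "x \<in> ?\<theta> ` E" using x(1) by (intro image_eqI[of _ _ ?v]) simp_all
    qed (use \<gamma> in auto)
    show "?\<theta> (\<phi> g u) = (g \<otimes> fst (?\<theta> u), snd (?\<theta> u))" if "g \<in> carrier G" "u \<in> E" for g u
    proof -
      have "\<phi> (g \<otimes> \<gamma> u) (rep (\<phi> g u)) = \<phi> g u"
        using that \<gamma> comp[of g "\<gamma> u" "rep u"] rep_mem rep_translate by simp
      then show ?thesis using \<gamma>_eq[of "\<phi> g u" "g \<otimes> \<gamma> u"] that mem \<gamma> rep_translate by simp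
    qed
  qed
  have inj: "inj_on ?\<theta> E" using \<gamma>(2) by (intro inj_onI) (metis Pair_inject)
  moreover have "card E = order G * card ?S"
  proof -
    have "card E = card (?\<theta> ` E)" using inj by (simp add: card_image)
    also have "?\<theta> ` E = carrier G \<times> ?S"
      by (rule equivariant_coordinates.coordinates[OF ec])
    finally show ?thesis by (simp add: card_cartesian_product order_def)
  qed
  ultimately show ?thesis using ec inj by (intro that)
qed

end

lemma finite_proper_partitions: "finite (proper_partitions n)"
  using finitely_many_partition_on[of "{1..n}"] by (rule finite_subset[rotated]) (auto simp: proper_partitions_def)

text \<open>For injective coordinates the kernel is equality, that is the partition into singletons.
  Passing to classes is then an order isomorphism from the open interval above it to the proper
  fixed partitions.\<close>

lemma spherical_partitions:
  assumes G: "group_action G {1..n} \<phi>" and \<theta>: "inj_on \<theta> {1..n}"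
    and sph: "spherical (subset_chains {x \<in> group_action.invariant_equivs G {1..n} \<phi>.
      kernel_on {1..n} \<theta> \<subset> x \<and> x \<subset> {1..n} \<times> {1..n}}) N d"
  shows "spherical (rel_chains {Q \<in> proper_partitions n. group_action.fixes_partition G \<phi> Q} (refines {1..n})) N d"
proof -
  interpret group_action G "{1..n}" \<phi> by (rule G)
  note [simp del] = One_nat_def
  let ?A = "{x \<in> invariant_equivs. kernel_on {1..n} \<theta> \<subset> x \<and> x \<subset> {1..n} \<times> {1..n}}"
    and ?B = "{Q \<in> proper_partitions n. fixes_partition Q}"
  have fin: "finite {1..n}" by simp
  have ker: "kernel_on {1..n} \<theta> = part_rel ((\<lambda>i. {i}) ` {1..n})"
  proof -
    have "\<theta> u = \<theta> v \<longleftrightarrow> u = v" if "u \<in> {1..n}" "v \<in> {1..n}" for u v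
      using inj_on_eq_iff[OF \<theta> that] .
    then show ?thesis unfolding kernel_on_def part_rel_def by fastforce
  qed
  have top: "{1..n} \<times> {1..n} = part_rel {{1..n}}" by (auto simp: part_rel_def)
  have PP: "Q \<in> proper_partitions n \<longleftrightarrow> partition_on {1..n} Q \<and> Q \<noteq> {{1..n}} \<and> Q \<noteq> (\<lambda>i. {i}) ` {1..n}" for Q
    by (simp add: proper_partitions_def)
  have eqv: "equiv {1..n} x" if "x \<in> ?A" for x using that by (simp add: invariant_equivs_def)
  have bij: "bij_betw (\<lambda>x. {1..n} // x) ?A ?B"
  proof (rule bij_betwI[where g = part_rel])
    show "(\<lambda>x. {1..n} // x) \<in> ?A \<rightarrow> ?B"
    proof
      fix x assume x: "x \<in> ?A"
      note q = part_rel_quotient[OF eqv[OF x]]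
      have P: "partition_on {1..n} ({1..n} // x)" by (rule partition_on_quotient[OF eqv[OF x]])
      have "{1..n} // x \<noteq> {{1..n}}" using q top x by auto
      moreover have "{1..n} // x \<noteq> (\<lambda>i. {i}) ` {1..n}" using q ker x by auto
      ultimately show "{1..n} // x \<in> ?B" using P q x fixes_partition_iff[OF fin P] PP by auto
    qed
    show "part_rel \<in> ?B \<rightarrow> ?A"
    proof
      fix Q assume Q: "Q \<in> ?B"
      then have P: "partition_on {1..n} Q" "Q \<noteq> {{1..n}}" "Q \<noteq> (\<lambda>i. {i}) ` {1..n}" using PP by auto
      have inv: "part_rel Q \<in> invariant_equivs" using Q fixes_partition_iff[OF fin P(1)] by simp
      note iD = invariant_equivsD[OF inv]
      have E0: "{1..n} \<noteq> {}" using P by (auto simp: partition_on_empty)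
      have "part_rel Q \<noteq> {1..n} \<times> {1..n}" using part_rel_inj[OF P(1) partition_on_space[OF E0]] P(2) top by auto
      moreover have "part_rel Q \<noteq> kernel_on {1..n} \<theta>"
        using part_rel_inj[OF P(1) partition_on_singletons] P(3) ker by auto
      moreover have "kernel_on {1..n} \<theta> \<subseteq> part_rel Q"
        using iD(2) inj_onD[OF \<theta>] by (auto simp: kernel_on_def)
      ultimately show "part_rel Q \<in> ?A" using inv iD(1) by auto
    qed
    show "part_rel ({1..n} // x) = x" if "x \<in> ?A" for x by (rule part_rel_quotient[OF eqv[OF that]])
    show "{1..n} // part_rel Q = Q" if "Q \<in> ?B" for Q using that PP by (intro quotient_part_rel) auto
  qed
  have rel: "refines {1..n} ({1..n} // x) ({1..n} // y) \<longleftrightarrow> x \<subseteq> y" if "x \<in> ?A" "y \<in> ?A" for x y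
    using refines_iff_part_rel[OF partition_on_quotient[OF eqv[OF that(1)]] partition_on_quotient[OF eqv[OF that(2)]]]
      part_rel_quotient[OF eqv[OF that(1)]] part_rel_quotient[OF eqv[OF that(2)]] by simp
  show ?thesis by (rule spherical_rel_chains_iso[OF sph bij rel])
qed

text \<open>A fixed point of the realization is supported on a chain of fixed partitions, since a partition
  comparable with a translate of itself is fixed.\<close>

lemma fixed_partition_complex_eq:
  assumes G: "group_action G {1..n} \<phi>"
  shows "fixed_partition_complex G \<phi> n =
    realization (rel_chains {Q \<in> proper_partitions n. group_action.fixes_partition G \<phi> Q} (refines {1..n}))"
proof -
  interpret group_action G "{1..n}" \<phi> by (rule G)
  note [simp del] = One_nat_def
  let ?C = "rel_chains (proper_partitions n) (refines {1..n})"
    and ?D = "rel_chains {Q \<in> proper_partitions n. fixes_partition Q} (refines {1..n})"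
  let ?F = "{t :: nat set set \<Rightarrow> real. \<forall>g\<in>carrier G. realization_map ((`) ((`) (\<phi> g))) t = t}"
  have "t \<in> ?F \<longleftrightarrow> {Q. t Q \<noteq> 0} \<in> ?D" if t: "t \<in> realization_points ?C" for t
  proof -
    note T = realization_pointsD[OF t]
    have fin: "finite {Q. t Q \<noteq> 0}" using T(2) by (simp add: rel_chains_def)
    have PP: "Q \<in> proper_partitions n" "partition_on {1..n} Q" if "t Q \<noteq> 0" for Q
      using T(2) that by (auto simp: rel_chains_def proper_partitions_def)
    show ?thesis
    proof
      assume F: "t \<in> ?F"
      have "fixes_partition Q" if Q: "t Q \<noteq> 0" for Q
        unfolding fixes_partition_def
      proof
        fix g assume g: "g \<in> carrier G"
        let ?h = "(`) ((`) (\<phi> g))"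
        \<comment> \<open>All weights are nonnegative, so the weight of \<open>Q\<close> is part of
          the weight of its translate. The translate thus lies in the support, which is a chain, and
          is comparable with \<open>Q\<close>.\<close>
        have "0 < t Q" using T(1)[of Q] Q by simp
        also have "t Q \<le> (\<Sum>R | t R \<noteq> 0 \<and> ?h R = ?h Q. t R)"
          by (rule member_le_sum) (use T(1) Q fin in auto)
        also have "\<dots> = realization_map ?h t (?h Q)" by (simp add: realization_map_def)
        also have "\<dots> = t (?h Q)" using F g by simp
        finally have "t (?h Q) \<noteq> 0" by simp
        then have "refines {1..n} Q (?h Q) \<or> refines {1..n} (?h Q) Q"
          using T(2) Q by (auto simp: rel_chains_def)
        then show "?h Q = Q" using translate_eq_if_comparable[OF _ g PP(2)[OF Q]] by simp
      qed
      then show "{Q. t Q \<noteq> 0} \<in> ?D" using T(2) by (auto simp: rel_chains_def)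
    next
      assume D: "{Q. t Q \<noteq> 0} \<in> ?D"
      have "realization_map ((`) ((`) (\<phi> g))) t = t" if g: "g \<in> carrier G" for g
      proof
        fix R
        have "{Q. t Q \<noteq> 0 \<and> (`) (\<phi> g) ` Q = R} = (if t R \<noteq> 0 then {R} else {})"
          using D g by (auto simp: rel_chains_def fixes_partition_def)
        then show "realization_map ((`) ((`) (\<phi> g))) t R = t R" by (simp add: realization_map_def)
      qed
      then show "t \<in> ?F" by simp
    qed
  qed
  moreover have "?D \<subseteq> ?C" by (auto simp: rel_chains_def)
  ultimately have "realization_points ?C \<inter> ?F = realization_points ?D"
    unfolding realization_points_def by blast
  then show ?thesis
    by (simp add: fixed_partition_complex_def partition_complex_def geometric_realization_rel_chains
        realization_def subtopology_subtopology)
qed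

text \<open>The trivial group acts freely and fixes every partition. With n = m + 2 this is the
  classical wedge of (n-1)! spheres of dimension n - 3.\<close>

lemma spherical_proper_partitions:
  "spherical (rel_chains (proper_partitions (Suc (Suc m))) (refines {1..Suc (Suc m)})) (fact (Suc m)) m"
proof -
  let ?E = "{1..Suc (Suc m)}" and ?G = "singleton_group ()"
  define \<psi> where "\<psi> = (\<lambda>g :: unit. \<lambda>x\<in>?E. x)"
  have "group_hom ?G (BijGroup ?E) \<psi>"
  proof (intro group_hom.intro group_hom_axioms.intro homI group_BijGroup)
    have \<psi>_Bij: "\<psi> g \<in> Bij ?E" for g unfolding \<psi>_def by (rule id_Bij)
    show "\<psi> g \<in> carrier (BijGroup ?E)" for g using \<psi>_Bij by (simp add: BijGroup_def)
    have "compose ?E (\<psi> g) (\<psi> h) = \<psi> k" for g h k by (auto simp: \<psi>_def compose_def fun_eq_iff)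
    then show "\<psi> (g \<otimes>\<^bsub>?G\<^esub> h) = \<psi> g \<otimes>\<^bsub>BijGroup ?E\<^esub> \<psi> h" for g h
      using \<psi>_Bij by (simp add: BijGroup_def)
  qed simp
  then interpret group_action ?G ?E \<psi> by (rule group_action.intro)
  obtain \<theta> S where \<theta>: "equivariant_coordinates ?G ?E \<psi> \<theta> (S :: nat set)" "inj_on \<theta> ?E" "card ?E = order ?G * card S"
    by (rule ex_free_coordinates) (auto simp: singleton_group_def)
  have o: "order ?G = 1" by (simp add: order_def)
  have "fixes_partition Q" if "Q \<in> proper_partitions (Suc (Suc m))" for Q
  proof -
    have "\<psi> g ` B = B" if "B \<in> Q" for g B
    proof -
      have "B \<subseteq> ?E" using that \<open>Q \<in> _\<close> by (auto simp: proper_partitions_def partition_on_def)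
      then show ?thesis by (force simp: \<psi>_def)
    qed
    then show ?thesis by (simp add: fixes_partition_def)
  qed
  then have "{Q \<in> proper_partitions (Suc (Suc m)). fixes_partition Q} = proper_partitions (Suc (Suc m))" by auto
  moreover have "card S = Suc (Suc m)" using \<theta>(3) o by simp
  ultimately show ?thesis
    using spherical_partitions[OF group_action_axioms \<theta>(2) spherical_equivs[OF \<theta>(1) _ o], of m] by (simp only: simp_thms)
qed

section \<open>Elementary abelian groups\<close>

lemma comm_group_product_group:
  assumes "\<And>i. i \<in> I \<Longrightarrow> comm_group (G i)"
  shows "comm_group (product_group I G)"
proof (rule group.group_comm_groupI)
  show "group (product_group I G)" by (intro product_group comm_group.axioms(2) assms)
  fix x y assume "x \<in> carrier (product_group I G)" "y \<in> carrier (product_group I G)"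
  then show "x \<otimes>\<^bsub>product_group I G\<^esub> y = y \<otimes>\<^bsub>product_group I G\<^esub> x"
    using assms by (auto simp: fun_eq_iff PiE_iff intro!: comm_groupE(4))
qed

lemma elementary_abelian_group_elem_abelian:
  assumes "prime p"
  shows "elementary_abelian_group (elem_abelian p k) p"
proof -
  have "comm_group (elem_abelian p k)"
    unfolding elem_abelian_def by (rule comm_group_product_group) simp
  then interpret comm_group "elem_abelian p k" .
  have pow: "(x [^]\<^bsub>elem_abelian p k\<^esub> n) i = (int n * x i) mod int p"
    if "x \<in> carrier (elem_abelian p k)" "i < k" for x n i
    using that by (induction n) (simp_all add: elem_abelian_def mod_simps algebra_simps)
  show ?thesis
  proof
    show "finite (carrier (elem_abelian p k))"
      using prime_gt_0_nat[OF assms] by (auto simp: elem_abelian_def carrier_integer_mod_group intro!: finite_PiE)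
    fix x assume x: "x \<in> carrier (elem_abelian p k)"
    have "x [^]\<^bsub>elem_abelian p k\<^esub> p \<in> carrier (elem_abelian p k)" using x by simp
    then show "x [^]\<^bsub>elem_abelian p k\<^esub> p = \<one>\<^bsub>elem_abelian p k\<^esub>"
      using pow[OF x] by (auto simp: fun_eq_iff elem_abelian_def PiE_iff extensional_def)
  qed (rule assms)
qed

lemma order_elem_abelian: "prime p \<Longrightarrow> card (carrier (elem_abelian p k)) = p ^ k"
  using prime_gt_0_nat[of p] by (simp add: elem_abelian_def carrier_integer_mod_group card_PiE)

lemma elementary_abelian_group_iso:
  assumes "elementary_abelian_group H p" "G \<cong> H" "group G"
  shows "elementary_abelian_group G p"
proof -
  interpret H: elementary_abelian_group H p by (rule assms)
  interpret G: group G by (rule assms)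
  obtain h where h: "h \<in> hom G H" "bij_betw h (carrier G) (carrier H)"
    using assms(2) by (auto simp: is_iso_def iso_def)
  have inj: "x = y" if "h x = h y" "x \<in> carrier G" "y \<in> carrier G" for x y
    using h(2) that by (auto simp: bij_betw_def inj_on_def)
  have mem: "h x \<in> carrier H" if "x \<in> carrier G" for x using h(2) that by (auto simp: bij_betw_def)
  have one: "h \<one>\<^bsub>G\<^esub> = \<one>\<^bsub>H\<^esub>" using hom_one[OF h(1)] by simp
  have pow: "h (x [^]\<^bsub>G\<^esub> n) = h x [^]\<^bsub>H\<^esub> (n :: nat)" if "x \<in> carrier G" for x n
    using that by (induction n) (simp_all add: one hom_mult[OF h(1)])
  have "comm_group G"
    by (rule G.group_comm_groupI, rule inj) (simp_all add: hom_mult[OF h(1)] mem H.m_comm)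
  then show ?thesis
  proof (rule elementary_abelian_group.intro, unfold_locales)
    show "prime p" by (rule H.prime_p)
    show "finite (carrier G)" using h(2) H.finite_carrier by (simp add: bij_betw_finite)
    show "x [^]\<^bsub>G\<^esub> p = \<one>\<^bsub>G\<^esub>" if "x \<in> carrier G" for x
      by (rule inj) (simp_all add: that pow one H.exponent mem)
  qed
qed

section \<open>Induced spaces as wedges over cosets\<close>

lemma induced_class:
  assumes "a \<in> carrier K" "x \<in> topspace X"
  shows "induced_rel K H (\<lambda>h x. x) X x\<^sub>0 `` {(a, x)} =
    {(b, y). b \<in> carrier K \<and> y \<in> topspace X \<and> (b \<in> a <#\<^bsub>K\<^esub> H \<and> y = x \<or> x = x\<^sub>0 \<and> y = x\<^sub>0)}"
  using assms unfolding induced_rel_def l_coset_def by auto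

text \<open>For the trivial action a class is a coset times a point, except that all cosets are
  joined at the base point. As \<open>K\<close> is commutative, left cosets may be replaced by the
  right cosets that Lagrange's theorem counts.\<close>

lemma induced_space_homeomorphic:
  assumes K: "comm_group K" "finite (carrier K)" and H: "subgroup H K" and C: "simplicial_complex C"
    and f: "homeomorphic_map X (realization C) f" and x\<^sub>0: "x\<^sub>0 \<in> topspace X" "f x\<^sub>0 = vertex b"
  shows "induced_space K H (\<lambda>h x. x) X x\<^sub>0 homeomorphic_space
    realization (wedge_complex (rcosets\<^bsub>K\<^esub> H) b C)"
proof -
  interpret comm_group K by (rule K)
  have coset: "a <#\<^bsub>K\<^esub> H = H #>\<^bsub>K\<^esub> a" if "a \<in> carrier K" for a
    using that subgroup.mem_carrier[OF H] by (auto simp: l_coset_def r_coset_def m_comm)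
  have same: "H #>\<^bsub>K\<^esub> a = H #>\<^bsub>K\<^esub> a'" if "a' \<in> H #>\<^bsub>K\<^esub> a" "a \<in> carrier K" for a a'
    using repr_independence[OF that H] .
  let ?Z = "prod_topology (discrete_topology (carrier K)) X"
  show ?thesis
    unfolding induced_space_def
  proof (rule wedge_homeomorphic[where \<kappa> = "\<lambda>a. H #>\<^bsub>K\<^esub> a"])
    show "simplicial_complex C" "homeomorphic_map X (realization C) f" "x\<^sub>0 \<in> topspace X" "f x\<^sub>0 = vertex b"
      by (fact C f x\<^sub>0)+
    show "quotient_map ?Z (quotient_topology ?Z (\<lambda>z. induced_rel K H (\<lambda>h x. x) X x\<^sub>0 `` {z}))
        (\<lambda>z. induced_rel K H (\<lambda>h x. x) X x\<^sub>0 `` {z})" by (rule quotient_map_quotient_topology)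
    have "rcosets\<^bsub>K\<^esub> H = (\<lambda>a. H #>\<^bsub>K\<^esub> a) ` carrier K" by (auto simp: RCOSETS_def)
    then show "finite (rcosets\<^bsub>K\<^esub> H)" and "(\<lambda>a. H #>\<^bsub>K\<^esub> a) ` carrier K = rcosets\<^bsub>K\<^esub> H" using K(2) by simp_all
    have "compact_space X" using compact_space_realization[OF C] f homeomorphic_compact_space homeomorphic_map_imp_homeomorphic_space by metis
    then show "compact_space ?Z" using K(2) by (simp add: compact_space_prod_topology compact_space_discrete_topology)
    show "topspace ?Z = carrier K \<times> topspace X" by simp
    show "continuous_map ?Z X snd" by (rule continuous_map_snd)
    show "continuous_map ?Z euclideanreal (\<lambda>z. if H #>\<^bsub>K\<^esub> fst z = j then 1 else 0)" for j
    proof -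
      have "continuous_map (discrete_topology (carrier K)) euclideanreal (\<lambda>a. if H #>\<^bsub>K\<^esub> a = j then 1 else 0)" by simp
      from continuous_map_compose[OF continuous_map_fst this] show ?thesis by (simp add: o_def)
    qed
    fix a x a' x' assume "(a, x) \<in> topspace ?Z" "(a', x') \<in> topspace ?Z"
    then have ax: "a \<in> carrier K" "x \<in> topspace X" "a' \<in> carrier K" "x' \<in> topspace X" by auto
    let ?q = "\<lambda>z. induced_rel K H (\<lambda>h x. x) X x\<^sub>0 `` {z}"
    show "?q (a, x) = ?q (a', x') \<longleftrightarrow> H #>\<^bsub>K\<^esub> a = H #>\<^bsub>K\<^esub> a' \<and> x = x' \<or> x = x\<^sub>0 \<and> x' = x\<^sub>0"
    proof
      assume eq: "?q (a, x) = ?q (a', x')"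
      have "a' \<in> H #>\<^bsub>K\<^esub> a'" using rcos_self[OF ax(3) H] .
      then have "(a', x') \<in> ?q (a', x')" unfolding induced_class[OF ax(3,4)] using ax coset by simp
      then have "(a', x') \<in> ?q (a, x)" using eq by simp
      then have "a' \<in> H #>\<^bsub>K\<^esub> a \<and> x' = x \<or> x = x\<^sub>0 \<and> x' = x\<^sub>0"
        unfolding induced_class[OF ax(1,2)] using ax coset by simp
      then show "H #>\<^bsub>K\<^esub> a = H #>\<^bsub>K\<^esub> a' \<and> x = x' \<or> x = x\<^sub>0 \<and> x' = x\<^sub>0" using same ax by auto
    next
      assume "H #>\<^bsub>K\<^esub> a = H #>\<^bsub>K\<^esub> a' \<and> x = x' \<or> x = x\<^sub>0 \<and> x' = x\<^sub>0"
      then show "?q (a, x) = ?q (a', x')"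
        unfolding induced_class[OF ax(1,2)] induced_class[OF ax(3,4)] using coset ax by auto
    qed
  qed
qed

text \<open>For m = 1, where the diagonal is the whole group: every class is
  \<open>carrier K\<close> times a point. The base point may lie outside \<open>X\<close>, so the
  empty space is covered, which occurs for k = 1.\<close>

lemma induced_space_whole_group:
  assumes "group K"
  shows "induced_space K (carrier K) (\<lambda>h x. x) X x\<^sub>0 homeomorphic_space X"
proof -
  interpret group K by (rule assms)
  let ?Z = "prod_topology (discrete_topology (carrier K)) X"
  have coset: "b \<in> a <#\<^bsub>K\<^esub> carrier K" if "a \<in> carrier K" "b \<in> carrier K" for a b
    unfolding l_coset_def using that by (auto intro!: bexI[of _ "inv\<^bsub>K\<^esub> a \<otimes>\<^bsub>K\<^esub> b"] simp: m_assoc[symmetric])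
  show ?thesis
    unfolding induced_space_def
  proof (rule quotient_maps_homeomorphic[OF quotient_map_quotient_topology])
    have "discrete_topology (carrier K) \<noteq> trivial_topology"
    proof
      assume "discrete_topology (carrier K) = trivial_topology"
      then have "carrier K = {}" by (metis topspace_discrete_topology)
      then show False using one_closed by simp
    qed
    then show "quotient_map ?Z X snd" by simp
    fix z z' assume zz: "z \<in> topspace ?Z" "z' \<in> topspace ?Z"
    obtain a x a' x' where z: "z = (a, x)" "z' = (a', x')" by (cases z; cases z')
    then have ax: "a \<in> carrier K" "x \<in> topspace X" "a' \<in> carrier K" "x' \<in> topspace X" using zz by auto
    have cls: "induced_rel K (carrier K) (\<lambda>h x. x) X x\<^sub>0 `` {(c, y)} = carrier K \<times> {y}"
      if "c \<in> carrier K" "y \<in> topspace X" for c y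
      unfolding induced_class[OF that] using that coset by auto
    show "induced_rel K (carrier K) (\<lambda>h x. x) X x\<^sub>0 `` {z} = induced_rel K (carrier K) (\<lambda>h x. x) X x\<^sub>0 `` {z'}
        \<longleftrightarrow> snd z = snd z'"
      using cls ax z by auto
  qed
qed

text \<open>The diagonal embedding is a homomorphism, and evaluation at coordinate 0, present
  because m is positive, shows that it is injective.\<close>

lemma
  assumes "prime p" "m \<ge> 1"
  shows comm_group_elem_abelian_power: "comm_group (elem_abelian_power p k m)"
    and card_elem_abelian_power: "card (carrier (elem_abelian_power p k m)) = p ^ (k * m)"
    and subgroup_diagonal: "subgroup (diagonal_subgroup p k m) (elem_abelian_power p k m)"
    and card_diagonal: "card (diagonal_subgroup p k m) = p ^ k"
proof -
  interpret A: elementary_abelian_group "elem_abelian p k" p by (rule elementary_abelian_group_elem_abelian[OF assms(1)])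
  let ?K = "elem_abelian_power p k m" and ?H = "diagonal_subgroup p k m" and ?d = "\<lambda>v. \<lambda>i\<in>{..<m}. v"
  show K: "comm_group ?K" unfolding elem_abelian_power_def by (rule comm_group_product_group) (rule A.comm_group_axioms)
  show "card (carrier ?K) = p ^ (k * m)"
    by (simp add: elem_abelian_power_def card_PiE order_elem_abelian[OF assms(1)] power_mult)
  interpret K: comm_group ?K by (rule K)
  have d_mult: "?d v \<otimes>\<^bsub>?K\<^esub> ?d w = ?d (v \<otimes>\<^bsub>elem_abelian p k\<^esub> w)" for v w
    by (auto simp: elem_abelian_power_def)
  have d_one: "\<one>\<^bsub>?K\<^esub> = ?d \<one>\<^bsub>elem_abelian p k\<^esub>" by (simp add: elem_abelian_power_def)
  have d_mem: "?d v \<in> carrier ?K" if "v \<in> carrier (elem_abelian p k)" for v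
    using that by (simp add: elem_abelian_power_def)
  show "subgroup ?H ?K"
  proof (rule K.subgroupI)
    show "?H \<subseteq> carrier ?K" using d_mem by (auto simp: diagonal_subgroup_def)
    show "?H \<noteq> {}" using A.one_closed by (auto simp: diagonal_subgroup_def)
    fix a assume "a \<in> ?H"
    then obtain v where v: "v \<in> carrier (elem_abelian p k)" "a = ?d v" by (auto simp: diagonal_subgroup_def)
    have "inv\<^bsub>?K\<^esub> a = ?d (inv\<^bsub>elem_abelian p k\<^esub> v)"
      using v d_mem d_mult[of "inv\<^bsub>elem_abelian p k\<^esub> v" v] d_one by (intro K.inv_equality) simp_all
    then show "inv\<^bsub>?K\<^esub> a \<in> ?H" using v by (simp add: diagonal_subgroup_def)
    fix b assume "b \<in> ?H"
    then obtain w where w: "w \<in> carrier (elem_abelian p k)" "b = ?d w" by (auto simp: diagonal_subgroup_def)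
    then show "a \<otimes>\<^bsub>?K\<^esub> b \<in> ?H" using v d_mult by (simp add: diagonal_subgroup_def)
  qed
  have "inj ?d"
  proof (rule injI)
    fix v w assume "?d v = ?d w"
    from fun_cong[OF this, of 0] show "v = w" using assms(2) by simp
  qed
  then have "card ?H = card (carrier (elem_abelian p k))"
    unfolding diagonal_subgroup_def by (intro card_image) (auto intro: inj_on_subset)
  then show "card ?H = p ^ k" by (simp add: order_elem_abelian[OF assms(1)])
qed

lemma diagonal_subgroup_1: "diagonal_subgroup p k 1 = carrier (elem_abelian_power p k 1)"
proof (intro equalityI subsetI)
  fix x assume x: "x \<in> carrier (elem_abelian_power p k 1)"
  then have "x = (\<lambda>i\<in>{..<1}. x 0)" by (auto simp: elem_abelian_power_def PiE_iff extensional_def fun_eq_iff)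
  moreover have "x 0 \<in> carrier (elem_abelian p k)" using x by (auto simp: elem_abelian_power_def)
  ultimately show "x \<in> diagonal_subgroup p k 1" unfolding diagonal_subgroup_def by blast
qed (auto simp: diagonal_subgroup_def elem_abelian_power_def)

section \<open>Wedges of spheres and of suspensions\<close>

lemma wedge_spheres_homeomorphic:
  assumes "finite I"
  shows "wedge I (\<lambda>_. nsphere d) (\<lambda>_. sphere_pole) homeomorphic_space
    realization (wedge_complex I (0, True) (cross_polytope d))"
proof -
  obtain f where f: "homeomorphic_map (nsphere d) (realization (cross_polytope d)) f" "f sphere_pole = vertex (0, True)"
    by (rule sphere_homeomorphic_cross_polytope)
  let ?Z = "sum_topology (\<lambda>_. nsphere d) I"
  have compS: "compact_space (nsphere d)"
    using compact_space_realization[OF simplicial_complex_cross_polytope] f(1) homeomorphic_compact_space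
      homeomorphic_map_imp_homeomorphic_space by metis
  show ?thesis
    unfolding wedge_def
  proof (rule wedge_homeomorphic[where \<kappa> = id])
    show "simplicial_complex (cross_polytope d)" by (rule simplicial_complex_cross_polytope)
    show "finite I" "homeomorphic_map (nsphere d) (realization (cross_polytope d)) f" "f sphere_pole = vertex (0, True)"
      by (fact assms f)+
    show "quotient_map ?Z (quotient_topology ?Z (\<lambda>(i, x). if x = sphere_pole then None else Some (i, x)))
        (\<lambda>(i, x). if x = sphere_pole then None else Some (i, x))" by (rule quotient_map_quotient_topology)
    show "sphere_pole \<in> topspace (nsphere d)" unfolding sphere_pole_def by (rule in_topspace_nsphere)
    have "compactin ?Z (\<Union>i\<in>I. Pair i ` topspace (nsphere d))"
      using assms compS continuous_map_component_injection[of _ I "\<lambda>_. nsphere d"]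
      by (intro compactin_Union) (auto intro!: image_compactin simp: compact_space_def)
    moreover have "(\<Union>i\<in>I. Pair i ` topspace (nsphere d)) = topspace ?Z" by auto
    ultimately show "compact_space ?Z" by (simp add: compact_space_def)
    show "topspace ?Z = I \<times> topspace (nsphere d)" by (auto simp: o_def)
    show "id ` I = I" by simp
    show "continuous_map ?Z (nsphere d) snd"
      unfolding continuous_map_def by (auto simp: openin_sum_topology o_def) (auto dest: openin_subset simp: Int_absorb1 Collect_conj_eq)
    show "continuous_map ?Z euclideanreal (\<lambda>z. if id (fst z) = j then 1 else 0)" for j
    proof -
      have "openin (nsphere d) {x \<in> topspace (nsphere d). Q}" for Q by (cases Q) auto
      then show ?thesis unfolding continuous_map_def by (auto simp: openin_sum_topology o_def)
    qed
  qed (auto simp: o_def)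
qed

text \<open>A suspension is a join with two opposite points, the cross-polytope boundary of
  dimension 0. The base point is tracked because the copies are later glued there.\<close>

lemma suspension_join_homeomorphic:
  assumes K: "simplicial_complex K" "{} \<in> K" and L: "simplicial_complex L" "{} \<in> L"
  obtains f where "homeomorphic_map (suspension (space_join (realization K) (realization L)))
      (realization (join_complex (cross_polytope 0) (join_complex K L))) f"
    "f (JLeft sphere_pole) = vertex (Inl (0, True))"
proof -
  obtain g where g: "homeomorphic_map (nsphere 0) (realization (cross_polytope 0)) g" "g sphere_pole = vertex (0, True)"
    by (rule sphere_homeomorphic_cross_polytope)
  have id: "homeomorphic_map (realization M) (realization M) (\<lambda>x. x)" for M :: "'z set set"
    using homeomorphic_map_id[of "realization M" "realization M"] by (simp add: id_def)
  have J: "homeomorphic_map (space_join (realization K) (realization L)) (realization (join_complex K L)) (join_coordinates (\<lambda>x. x) (\<lambda>x. x))"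
    by (rule space_join_homeomorphic[OF K L id id])
  have empty: "{} \<in> join_complex K L" "{} \<in> cross_polytope 0"
    using K(2) L(2) by (simp_all add: join_complex_iff cross_polytope_def)
  have "homeomorphic_map (suspension (space_join (realization K) (realization L)))
      (realization (join_complex (cross_polytope 0) (join_complex K L)))
      (join_coordinates g (join_coordinates (\<lambda>x. x) (\<lambda>x. x)))"
    unfolding suspension_def sphere_space_def
    using space_join_homeomorphic[OF simplicial_complex_cross_polytope empty(2) simplicial_complex_join[OF K(1) L(1)] empty(1) g(1) J]
    by simp
  moreover have "join_coordinates g (join_coordinates (\<lambda>x. x) (\<lambda>x. x)) (JLeft sphere_pole) = vertex (Inl (0, True))"
    by (auto simp: g(2) vertex_def fun_eq_iff split: sum.split)
  ultimately show ?thesis by (rule that)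
qed

text \<open>The second suspension point is the opposite pole \<open>s\<close>. Its open star is this
  point joined with \<open>M\<close>, so it has as many critical faces as \<open>M\<close>, with one
  more vertex.\<close>

lemma spherical_wedge_suspension:
  assumes "finite I" "simplicial_complex M" "spherical M N d"
  shows "spherical (wedge_complex I (Inl (0, True)) (join_complex (cross_polytope 0) M)) (card I * N) (Suc d)"
proof (rule spherical_wedge[where s = "Inl (0, False)", OF assms(1) simplicial_complex_join[OF simplicial_complex_cross_polytope assms(2)]])
  show "insert (Inl (0, True)) \<sigma> \<in> join_complex (cross_polytope 0) M"
    if "\<sigma> \<in> join_complex (cross_polytope 0) M" "Inl (0, False) \<notin> \<sigma>" for \<sigma>
  proof -
    have "Inl -` insert (Inl (0, True)) \<sigma> = insert (0, True) (Inl -` \<sigma>)" "Inr -` insert (Inl (0, True)) \<sigma> = Inr -` \<sigma>" by auto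
    then show ?thesis using that by (auto simp: join_complex_iff cross_polytope_def)
  qed
  show "Inl (0, True) \<notin> \<sigma>" if "\<sigma> \<in> join_complex (cross_polytope 0) M" "Inl (0, False) \<in> \<sigma>" for \<sigma>
    using that by (auto simp: join_complex_iff cross_polytope_def)
  have "{\<sigma> \<in> join_complex (cross_polytope 0) M. Inl (0, False) \<in> \<sigma>} =
      join_complex {\<sigma> \<in> cross_polytope 0. (0, False) \<in> \<sigma>} M"
    by (auto simp: join_complex_iff)
  then show "spherical {\<sigma> \<in> join_complex (cross_polytope 0) M. Inl (0, False) \<in> \<sigma>} N (Suc d)"
    using spherical_join[OF spherical_cross_polytope[of 0] assms(3) simplicial_complexD(2)[OF assms(2)]] by simp
qed simp

lemma spherical_wedge_spheres:
  assumes "finite I"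
  shows "spherical (wedge_complex I (0, True) (cross_polytope d)) (card I) (Suc d)"
proof -
  have "spherical (wedge_complex I (0, True) (cross_polytope d)) (card I * 1) (Suc d)"
    by (rule spherical_wedge[where s = "(0, False)", OF assms simplicial_complex_cross_polytope _ _ _ spherical_cross_polytope])
      (auto simp: cross_polytope_def)
  then show ?thesis by simp
qed

section \<open>The homotopy types of the two sides\<close>

lemma empty_homeomorphic_space: "topspace X = {} \<Longrightarrow> topspace Y = {} \<Longrightarrow> X homeomorphic_space Y"
  unfolding homeomorphic_space_def homeomorphic_maps_def continuous_map_def by auto

text \<open>Critical faces with e vertices give spheres of dimension e - 1. For e = 0 only the empty
  face can be critical, so N = 1 and both spaces are empty. With N > 0 the index set of the wedge is
  nonempty and its complex contains the empty face.\<close>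

lemma spherical_homotopy_wedge_spheres:
  assumes "simplicial_complex K" "{} \<in> K" "spherical K N e" "N > 0" "e = 0 \<Longrightarrow> N = 1"
  shows "realization K homotopy_equivalent_space
    wedge {..<N} (\<lambda>_. sphere_space (int e - 1)) (\<lambda>_. sphere_pole)"
proof (cases e)
  case 0
  have "simplicial_complex {{} :: 'a set}" by (rule simplicial_complexI) auto
  moreover have "spherical {{} :: 'a set} N e" using spherical_singleton[of "{} :: 'a set"] assms(5) 0 by simp
  ultimately have "realization K homotopy_equivalent_space realization {{} :: 'a set}"
    by (intro spherical_homotopy_equivalent[OF assms(1-3)]) auto
  moreover have "realization {{} :: 'a set} homeomorphic_space wedge {..<N} (\<lambda>_. sphere_space (int e - 1)) (\<lambda>_. sphere_pole)"
  proof (rule empty_homeomorphic_space)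
    show "topspace (realization {{} :: 'a set}) = {}" using realization_pointsD(2,3) by fastforce
    show "topspace (wedge {..<N} (\<lambda>_. sphere_space (int e - 1)) (\<lambda>_. sphere_pole)) = {}"
      using 0 by (simp add: wedge_def sphere_space_def)
  qed
  ultimately show ?thesis using homeomorphic_imp_homotopy_equivalent_space homotopy_eqv_trans by blast
next
  case (Suc d)
  let ?W = "wedge_complex {..<N} (0, True) (cross_polytope d)"
  have "simplicial_complex ?W" by (simp add: simplicial_complex_wedge simplicial_complex_cross_polytope)
  moreover have "{} \<in> ?W"
  proof -
    have "{} \<in> cross_polytope d" by (simp add: cross_polytope_def)
    then show ?thesis using assms(4) unfolding wedge_complex_def by force
  qed
  moreover have "spherical ?W N e" using spherical_wedge_spheres[of "{..<N}" d] Suc by simp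
  ultimately have "realization K homotopy_equivalent_space realization ?W"
    by (rule spherical_homotopy_equivalent[OF assms(1-3)])
  moreover have "wedge {..<N} (\<lambda>_. sphere_space (int e - 1)) (\<lambda>_. sphere_pole) homeomorphic_space realization ?W"
    using wedge_spheres_homeomorphic[of "{..<N}" d] Suc by (simp add: sphere_space_def)
  ultimately show ?thesis
    using homeomorphic_imp_homotopy_equivalent_space homeomorphic_space_sym homotopy_eqv_trans by blast
qed

text \<open>Here k = j + 1 and m = i + 1, so that i + j vertices mean dimension m + k - 3. Freeness
  supplies coordinates with n / p^k = m orbits.\<close>

lemma fixed_partition_complex_wedge_spheres:
  assumes p: "prime p" and P: "P \<cong> elem_abelian p (Suc j)" and free: "free_action P {1..n} \<phi>"
    and n: "n = Suc i * p ^ Suc j"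
  shows "fixed_partition_complex P \<phi> n homotopy_equivalent_space
    wedge {..<p ^ (Suc j * i + (Suc j choose 2)) * fact i} (\<lambda>_. sphere_space (int (i + j) - 1)) (\<lambda>_. sphere_pole)"
proof -
  interpret group_action P "{1..n}" \<phi> using free by (simp add: free_action_def)
  have "group P" using group_hom by (simp add: group_hom_def)
  interpret elementary_abelian_group P p
    by (rule elementary_abelian_group_iso[OF elementary_abelian_group_elem_abelian[OF p] P \<open>group P\<close>])
  have order: "order P = p ^ Suc j" using iso_same_card[OF P] order_elem_abelian[OF p] by (simp add: order_def)
  obtain \<theta> S where \<theta>: "equivariant_coordinates P {1..n} \<phi> \<theta> (S :: nat set)" "inj_on \<theta> {1..n}"
      "card {1..n} = order P * card S"
    by (rule ex_free_coordinates) (use free in \<open>auto simp: free_action_def\<close>)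
  have p0: "p > 0" using prime_gt_0_nat[OF p] .
  have "p ^ Suc j * Suc i = p ^ Suc j * card S" using \<theta>(3) order n by (simp only: card_atLeastAtMost) (simp add: mult.commute)
  moreover have "p ^ Suc j \<noteq> 0" using p0 by simp
  ultimately have S: "card S = Suc i" using mult_left_cancel by metis
  let ?K = "rel_chains {Q \<in> proper_partitions n. fixes_partition Q} (refines {1..n})"
  have "spherical ?K (fact i * p ^ (Suc j * i) * p ^ (Suc j choose 2)) (i + j)"
    by (rule spherical_partitions[OF group_action_axioms \<theta>(2) spherical_invariant_equivs[OF \<theta>(1) S order]])
  then have "spherical ?K (p ^ (Suc j * i + (Suc j choose 2)) * fact i) (i + j)"
    by (simp only: power_add mult_ac)
  moreover have "simplicial_complex ?K"
    by (rule simplicial_complex_rel_chains) (simp add: finite_proper_partitions)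
  ultimately show ?thesis
    unfolding fixed_partition_complex_eq[OF group_action_axioms]
    using p0 by (intro spherical_homotopy_wedge_spheres) (auto simp: binomial_eq_0)
qed

text \<open>The factors come from the p^(k(m-1)) cosets of the diagonal, the subgroup complex, and
  the (m-1)! spheres of |Pi_m|. For m = 1 there is neither a suspension nor a partition complex, and
  \<open>X\<close> is a copy of the subgroup complex.\<close>

lemma induced_space_wedge_spheres:
  fixes p j i :: nat
  defines "X \<equiv> suspended_partition_join (subgroup_complex p (Suc j)) (Suc i)"
    and "x\<^sub>0 \<equiv> suspended_partition_join_base (subgroup_complex p (Suc j)) (Suc i)"
  assumes p: "prime p"
  shows "induced_space (elem_abelian_power p (Suc j) (Suc i)) (diagonal_subgroup p (Suc j) (Suc i)) (\<lambda>h x. x) X x\<^sub>0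
    homotopy_equivalent_space
    wedge {..<p ^ (Suc j * i + (Suc j choose 2)) * fact i} (\<lambda>_. sphere_space (int (i + j) - 1)) (\<lambda>_. sphere_pole)"
proof -
  let ?A = "elem_abelian p (Suc j)" and ?K = "elem_abelian_power p (Suc j) (Suc i)"
    and ?H = "diagonal_subgroup p (Suc j) (Suc i)"
  interpret A: elementary_abelian_group ?A p by (rule elementary_abelian_group_elem_abelian[OF p])
  have p0: "p > 0" using prime_gt_0_nat[OF p] .
  let ?S = "{B. subgroup B ?A \<and> {\<one>\<^bsub>?A\<^esub>} \<subset> B \<and> B \<subset> carrier ?A}"
  let ?T = "subset_chains ?S"
  have "{B. subgroup B ?A \<and> B \<noteq> {\<one>\<^bsub>?A\<^esub>} \<and> B \<noteq> carrier ?A} = ?S"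
  proof -
    have "\<one>\<^bsub>?A\<^esub> \<in> B \<and> B \<subseteq> carrier ?A" if "subgroup B ?A" for B
      using subgroup.one_closed[OF that] subgroup.subset[OF that] by simp
    then show ?thesis by (intro Collect_cong) auto
  qed
  then have T: "subgroup_complex p (Suc j) = realization ?T"
    by (simp add: subgroup_complex_def geometric_realization_rel_chains)
  have "?S \<subseteq> Pow (carrier ?A)" by auto
  then have T_complex: "simplicial_complex ?T"
    using A.finite_carrier by (intro simplicial_complex_rel_chains) (meson finite_Pow_iff finite_subset)
  have T_spherical: "spherical ?T (p ^ (Suc j choose 2)) j"
    using order_elem_abelian[OF p] A.triv_subgroup by (intro A.spherical_subgroups) auto
  have i1: "1 \<le> Suc i" by simp
  note K = comm_group_elem_abelian_power[OF p i1, of "Suc j"] card_elem_abelian_power[OF p i1, of "Suc j"]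
    subgroup_diagonal[OF p i1, of "Suc j"] card_diagonal[OF p i1, of "Suc j"]
  show ?thesis
  proof (cases i)
    case 0
    let ?r = "\<lambda>x. JRight (JLeft x)"
    have "X = quotient_topology (realization ?T) ?r"
      by (simp add: X_def suspended_partition_join_def T 0)
    then have "homeomorphic_map (realization ?T) X ?r"
      by (simp add: homeomorphic_map_def quotient_map_quotient_topology inj_on_def)
    then have "realization ?T homeomorphic_space X" by (rule homeomorphic_map_imp_homeomorphic_space)
    moreover have "induced_space ?K ?H (\<lambda>h x. x) X x\<^sub>0 homeomorphic_space X"
      using induced_space_whole_group[OF comm_group.axioms(2)[OF K(1)], of X x\<^sub>0] diagonal_subgroup_1[of p "Suc j"] 0 by simp
    ultimately have "induced_space ?K ?H (\<lambda>h x. x) X x\<^sub>0 homotopy_equivalent_space realization ?T"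
      using homeomorphic_space_sym homeomorphic_space_trans homeomorphic_imp_homotopy_equivalent_space by blast
    also have "realization ?T homotopy_equivalent_space
        wedge {..<p ^ (Suc j choose 2)} (\<lambda>_. sphere_space (int j - 1)) (\<lambda>_. sphere_pole)"
      using T_complex T_spherical p0 by (intro spherical_homotopy_wedge_spheres) (auto simp: binomial_eq_0)
    finally show ?thesis using 0 by simp
  next
    case (Suc l)
    let ?M = "rel_chains (proper_partitions (Suc i)) (refines {1..Suc i})"
    let ?C = "join_complex (cross_polytope 0) (join_complex ?T ?M)"
    have M_complex: "simplicial_complex ?M"
      by (rule simplicial_complex_rel_chains[OF finite_proper_partitions])
    have "X = suspension (space_join (realization ?T) (realization ?M))"
      unfolding X_def suspended_partition_join_def partition_complex_def geometric_realization_rel_chains T using Suc by simp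
    moreover obtain f where "homeomorphic_map (suspension (space_join (realization ?T) (realization ?M))) (realization ?C) f"
        "f (JLeft sphere_pole) = vertex (Inl (0, True))"
      by (rule suspension_join_homeomorphic[OF T_complex _ M_complex]) simp_all
    moreover have x0: "x\<^sub>0 = JLeft sphere_pole" by (simp add: x\<^sub>0_def suspended_partition_join_base_def Suc)
    ultimately have f: "homeomorphic_map X (realization ?C) f" "f x\<^sub>0 = vertex (Inl (0, True))" by simp_all
    have "sphere_pole \<in> topspace (sphere_space 0)"
      unfolding sphere_pole_def using in_topspace_nsphere[of 0] by (simp add: sphere_space_def)
    then have x0X: "x\<^sub>0 \<in> topspace X"
      using Suc by (simp add: x0 X_def suspended_partition_join_def suspension_def join_points_def)
    have TM: "simplicial_complex (join_complex ?T ?M)" by (rule simplicial_complex_join[OF T_complex M_complex])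
    have C: "simplicial_complex ?C" by (rule simplicial_complex_join[OF simplicial_complex_cross_polytope TM])
    let ?I = "rcosets\<^bsub>?K\<^esub> ?H"
    have "card (carrier ?K) > 0" using K(2) p0 by simp
    then have finK: "finite (carrier ?K)" by (rule card_ge_0_finite)
    have "card ?I * card ?H = card (carrier ?K)"
      using group.lagrange[OF comm_group.axioms(2)[OF K(1)] K(3)] by (simp add: order_def)
    moreover have "p ^ (Suc j * Suc i) = p ^ (Suc j * i) * p ^ Suc j"
      by (simp only: mult_Suc_right[of "Suc j" i] power_add mult.commute[of "p ^ Suc j"])
    ultimately have "card ?I * p ^ Suc j = p ^ (Suc j * i) * p ^ Suc j"
      using K(2,4) by (simp only:)
    moreover have "p ^ Suc j \<noteq> 0" using p0 by simp
    ultimately have cardI: "card ?I = p ^ (Suc j * i)" using mult_right_cancel by blast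
    have finI: "finite ?I" using cardI p0 by (intro card_ge_0_finite) simp
    have I0: "?I \<noteq> {}" using cardI p0 by auto
    let ?W = "wedge_complex ?I (Inl (0, True)) ?C"
    have "spherical (join_complex ?T ?M) (p ^ (Suc j choose 2) * fact i) (j + l)"
    proof (rule spherical_join[OF T_spherical])
      show "spherical ?M (fact i) l" using spherical_proper_partitions[of l] Suc by (simp only:)
      show "finite \<rho>" if "\<rho> \<in> ?M" for \<rho> using that by (rule simplicial_complexD(2)[OF M_complex])
    qed
    then have "spherical ?W (card ?I * (p ^ (Suc j choose 2) * fact i)) (Suc (j + l))"
      by (rule spherical_wedge_suspension[OF finI TM])
    moreover have "card ?I * (p ^ (Suc j choose 2) * fact i) = p ^ (Suc j * i + (Suc j choose 2)) * fact i"
      by (simp only: cardI power_add mult_ac)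
    \<comment> \<open>The join adds the vertex counts j = k - 1 and l = m - 2; the suspension adds
      one more.\<close>
    moreover have "Suc (j + l) = i + j" using Suc by simp
    ultimately have W: "spherical ?W (p ^ (Suc j * i + (Suc j choose 2)) * fact i) (i + j)" by (simp only:)
    have "{} \<in> ?C" by (simp add: join_complex_iff cross_polytope_def)
    then have "{} \<in> ?W" using I0 unfolding wedge_complex_def by force
    then have "realization ?W homotopy_equivalent_space
        wedge {..<p ^ (Suc j * i + (Suc j choose 2)) * fact i} (\<lambda>_. sphere_space (int (i + j) - 1)) (\<lambda>_. sphere_pole)"
      using W p0 Suc by (intro spherical_homotopy_wedge_spheres simplicial_complex_wedge finI C) auto
    moreover have "induced_space ?K ?H (\<lambda>h x. x) X x\<^sub>0 homeomorphic_space realization ?W"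
      by (rule induced_space_homeomorphic[OF K(1) finK K(3) C f(1) x0X f(2)])
    ultimately show ?thesis
      using homeomorphic_imp_homotopy_equivalent_space homotopy_eqv_trans by blast
  qed
qed

theorem corollary9p3:
  fixes P :: "('g, 'm) monoid_scheme" and \<phi> :: "'g \<Rightarrow> nat \<Rightarrow> nat" and p k m n :: nat
  assumes "prime p" and "k \<ge> 1"
    and "P \<cong> elem_abelian p k"
    and "free_action P {1..n} \<phi>"
    and "n = m * p ^ k" and "m \<ge> 1"
  shows "let X = suspended_partition_join (subgroup_complex p k) m;
             x\<^sub>0 = suspended_partition_join_base (subgroup_complex p k) m;
             Y = induced_space (elem_abelian_power p k m) (diagonal_subgroup p k m) (\<lambda>h x. x) X x\<^sub>0
         in fixed_partition_complex P \<phi> n homotopy_equivalent_space Y \<and>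
            Y homotopy_equivalent_space
              wedge {..<p ^ (k * (m - 1) + (k choose 2)) * fact (m - 1)}
                (\<lambda>_. sphere_space (int m + int k - 3)) (\<lambda>_. sphere_pole)"
proof -
  obtain j where k: "k = Suc j" using assms(2) by (cases k) auto
  obtain i where m: "m = Suc i" using assms(6) by (cases m) auto
  have d: "int m + int k - 3 = int (i + j) - 1" using k m by simp
  have i: "m - 1 = i" using m by simp
  show ?thesis
    unfolding Let_def d i unfolding k m
    using fixed_partition_complex_wedge_spheres[OF assms(1) assms(3)[unfolded k] assms(4) assms(5)[unfolded k m]]
      induced_space_wedge_spheres[OF assms(1), of j i]
    by (blast intro: homotopy_eqv_trans homotopy_equivalent_space_sym[THEN iffD1])
qed

end
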